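(* Let $\alpha>2$. Suppose that $\mu>0$ and that conditions (R1) and (R2) of the context hold. Consider the relations, as $t\to+\infty$ through the integers, $$\mathbf P(S_N=t)=(\mathbf E N)\,\mathbf P(X_1=t)(1+o(1))+\mu^{-1}\,\mathbf P\bigl(N=\lfloor t/\mu\rfloor\bigr)(1+o(1)),\qquad(\ast)$$ $$\mathbf P(S_N=t)\sim\mu^{-1}\,\mathbf P\bigl(N=\lfloor t/\mu\rfloor\bigr).\qquad(\ast\ast)$$ (i) Let $2<\alpha<3$. Assume that $\mathbf P(X_1=t)\sim a t^{-\alpha}$ for some constant $a>0$ and that the limit $\lim_{t\to+\infty}\mathbf P(X_1<-t)/\mathbf P(X_1>t)$ exists and is finite. Then $\mathbf E N<\infty$ implies $(\ast)$. Furthermore, if in addition $\mathbf P(X_1=t)=o\bigl(\mathbf P(N=t)\bigr)$ as $t\to+\infty$, then either of the conditions $\mathbf E N<\infty$ or (P) implies $(\ast\ast)$. (ii) Let $\alpha>3$. Assume that $\mathbf P(X_1=t)=t^{-\alpha}L_1(t)$ for $t=1,2,\dots$, where $L_1$ is slowly varying at infinity, that $\mathbf E\bigl(X_1^2\,\mathbb I_{\{X_1<-t\}}\bigr)=o(1/\log t)$ as $t\to+\infty$, and that $$\sum_{n\ge t}n^{-3/2}\,\mathbf P(N=n)=o\bigl(\mathbf P(N=t)\bigr)\quad\text{as } t\to+\infty.$$ Then $\mathbf E N<\infty$ implies $(\ast)$. Furthermore, if in addition $\mathbf P(X_1=t)=o\bigl(\mathbf P(N=t)\bigr)$ as $t\to+\infty$,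 then either of the conditions $\mathbf E N<\infty$ or (P) implies $(\ast\ast)$.
   Context: $X_1,X_2,\dots$ are i.i.d. integer valued random variables (not necessarily non-negative); $N$ is a non-negative integer valued random variable independent of $\{X_i\}$; $S_N=X_1+\dots+X_N$ (with $S_0=0$). $\mu=\mathbf E X_1$. $f(t)\sim g(t)$ means $f(t)/g(t)\to1$ as $t\to+\infty$. Conditions on $N$ (with $t,s,t_1,t_2$ positive integers): (R1) There exist $c_1>1$ and $c_2,c_3>0$ such that $c_2\le\mathbf P(N=t_2)/\mathbf P(N=t_1)\le c_3$ for any $t_1,t_2$ with $1\le t_2/t_1\le c_1$. (R2) There exists $\varkappa>\max\{(\alpha-1)^{-1},\,0.5\}$ such that $\displaystyle\lim_{t\to+\infty}\ \sup_{s:\,|t-s|\le t^{\varkappa}}\frac{\mathbf P(N=t)}{\mathbf P(N=s)}=1$. (P) For some $\gamma>1$, $\mathbf P(N=t)=t^{-\gamma}L_2(t)$ for $t=1,2,\dots$, where $L_2$ is slowly varying at infinity. *)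

theory Defs
  imports "HOL-Probability.Probability" "HOL-Library.Landau_Symbols"
begin

text \<open>The summands are indexed from 1, so \<open>X 0\<close> plays no role. The last assumption makes \<open>N\<close>
  independent of the whole sequence: its second argument is the sigma-algebra generated by
  all the \<open>X i\<close> together. Neither \<open>X i\<close> nor \<open>N\<close> needs a separate measurability assumption, as
  both independence predicates include it.\<close>

locale random_sum = prob_space M
  for M :: "'a measure" +
  fixes X :: "nat \<Rightarrow> 'a \<Rightarrow> int" and N :: "'a \<Rightarrow> nat"
  assumes indep_X: "indep_vars (\<lambda>_. count_space UNIV) X {1..}"
    and ident_X: "\<And>i. i \<ge> 1 \<Longrightarrow> distr M (count_space UNIV) (X i) = distr M (count_space UNIV) (X 1)"
    and indep_N_X: "indep_set {N -` A \<inter> space M | A. True}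
          (sigma_sets (space M) (\<Union>i\<in>{1..}. {X i -` A \<inter> space M | A. True}))"

definition random_partial_sum :: "(nat \<Rightarrow> 'a \<Rightarrow> int) \<Rightarrow> ('a \<Rightarrow> nat) \<Rightarrow> 'a \<Rightarrow> int" where
  "random_partial_sum X N \<omega> = (\<Sum>i=1..N \<omega>. X i \<omega>)"

definition slowly_varying :: "(real \<Rightarrow> real) \<Rightarrow> bool" where
  "slowly_varying L \<longleftrightarrow>
     L \<in> borel_measurable borel \<and>
     (\<forall>\<^sub>F x in at_top. L x > 0) \<and>
     (\<forall>c>0. ((\<lambda>x. L (c * x) / L x) \<longlongrightarrow> 1) at_top)"

text \<open>Taking \<open>t1 = t2\<close> below forces \<open>P(N = t) > 0\<close> for every \<open>t \<ge> 1\<close>, because \<open>0 / 0 = 0 < c2\<close>.\<close>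

definition cond_R1 :: "'a measure \<Rightarrow> ('a \<Rightarrow> nat) \<Rightarrow> bool" where
  "cond_R1 M N \<longleftrightarrow> (\<exists>c1>1. \<exists>c2>0. \<exists>c3>0. \<forall>t1\<ge>1. \<forall>t2\<ge>1.
     1 \<le> real t2 / real t1 \<and> real t2 / real t1 \<le> c1 \<longrightarrow>
     c2 \<le> \<P>(\<omega> in M. N \<omega> = t2) / \<P>(\<omega> in M. N \<omega> = t1) \<and>
     \<P>(\<omega> in M. N \<omega> = t2) / \<P>(\<omega> in M. N \<omega> = t1) \<le> (c3::real))"

text \<open>The supremum is over a finite set that contains \<open>t\<close>, so it is a genuine real supremum.
  Its quotients are meaningful only if \<open>P(N = s) > 0\<close> for all \<open>s \<ge> 1\<close>, which \<open>cond_R1\<close>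
  guarantees.\<close>

definition cond_R2 :: "'a measure \<Rightarrow> ('a \<Rightarrow> nat) \<Rightarrow> real \<Rightarrow> bool" where
  "cond_R2 M N \<alpha> \<longleftrightarrow> (\<exists>\<kappa> > max (1 / (\<alpha> - 1)) (1 / 2).
     (\<lambda>t::nat. SUP s\<in>{s::nat. s \<ge> 1 \<and> \<bar>real t - real s\<bar> \<le> real t powr \<kappa>}.
        \<P>(\<omega> in M. N \<omega> = t) / \<P>(\<omega> in M. N \<omega> = s)) \<longlonglongrightarrow> 1)"

definition cond_P :: "'a measure \<Rightarrow> ('a \<Rightarrow> nat) \<Rightarrow> bool" where
  "cond_P M N \<longleftrightarrow> (\<exists>\<gamma>>1. \<exists>L. slowly_varying L \<and>
     (\<forall>t\<ge>1. \<P>(\<omega> in M. N \<omega> = t) = real t powr (-\<gamma>) * L (real t)))"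

text \<open>The two \<open>1 + o(1)\<close> factors are independent of each other. The identity is required only for
  large \<open>t\<close>, since for small \<open>t\<close> the right-hand side may vanish identically.\<close>

definition two_term_asymp ::
    "'a measure \<Rightarrow> (nat \<Rightarrow> 'a \<Rightarrow> int) \<Rightarrow> ('a \<Rightarrow> nat) \<Rightarrow> real \<Rightarrow> bool" where
  "two_term_asymp M X N \<mu> \<longleftrightarrow>
     (\<exists>\<epsilon>1 \<epsilon>2 :: nat \<Rightarrow> real. \<epsilon>1 \<in> o(\<lambda>_. 1) \<and> \<epsilon>2 \<in> o(\<lambda>_. 1) \<and>
       (\<forall>\<^sub>F t in at_top.
          \<P>(\<omega> in M. random_partial_sum X N \<omega> = int t) =
            (LINT \<omega>|M. real (N \<omega>)) * \<P>(\<omega> in M. X 1 \<omega> = int t) * (1 + \<epsilon>1 t)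
            + 1 / \<mu> * \<P>(\<omega> in M. N \<omega> = nat \<lfloor>real t / \<mu>\<rfloor>) * (1 + \<epsilon>2 t)))"

definition one_term_asymp ::
    "'a measure \<Rightarrow> (nat \<Rightarrow> 'a \<Rightarrow> int) \<Rightarrow> ('a \<Rightarrow> nat) \<Rightarrow> real \<Rightarrow> bool" where
  "one_term_asymp M X N \<mu> \<longleftrightarrow>
     (\<lambda>t::nat. \<P>(\<omega> in M. random_partial_sum X N \<omega> = int t)) \<sim>[at_top]
     (\<lambda>t. 1 / \<mu> * \<P>(\<omega> in M. N \<omega> = nat \<lfloor>real t / \<mu>\<rfloor>))"

text \<open>Integrability is required explicitly because the Bochner integral of a non-integrable function
  is 0, which would satisfy the little-o condition vacuously.\<close>

definition left_tail_cond :: "'a measure \<Rightarrow> ('a \<Rightarrow> int) \<Rightarrow> bool" where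
  "left_tail_cond M Y \<longleftrightarrow>
     (\<forall>\<^sub>F t::nat in at_top.
        set_integrable M {\<omega> \<in> space M. Y \<omega> < - int t} (\<lambda>\<omega>. (real_of_int (Y \<omega>))\<^sup>2)) \<and>
     (\<lambda>t::nat. LINT \<omega>:{\<omega> \<in> space M. Y \<omega> < - int t}|M. (real_of_int (Y \<omega>))\<^sup>2)
       \<in> o(\<lambda>t. 1 / ln (real t))"

end

theory Submission
  imports Defs "HOL-Real_Asymp.Real_Asymp"
begin

text \<open>
  Write \<open>q n t\<close> for \<open>P(S_n = t)\<close>, so that \<open>P(S_N = t)\<close> is the sum of \<open>P(N = n) q n t\<close> over \<open>n\<close>.
  For \<open>n \<le> \<delta> t\<close> a sum equal to \<open>t\<close> typically has one large summand: \<open>q n t \<sim> n P(X_1 = t)\<close> for each \<open>n\<close>, and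
  \<open>q n t \<le> C n P(X_1 = t)\<close> uniformly, so dominated convergence gives the term \<open>(E N) P(X_1 = t)\<close>.
  For \<open>n\<close> within \<open>t powr \<theta>\<close> of \<open>t / \<mu>\<close> the weights \<open>P(N = n)\<close> are asymptotically constant, and the lattice
  renewal theorem turns the sum of \<open>q n t\<close> over this window into \<open>1 / \<mu>\<close>.

  No local limit theorem is needed. If the walk visits \<open>t\<close> at some time in a window during which its
  mean stays at distance \<open>x\<close> from \<open>t\<close>, then it is still off its mean by order \<open>x\<close> at the end of the
  window with probability at least \<open>1/2\<close>; hence the expected number of such visits is bounded by a
  deviation probability. With \<open>P(\<bar>S_n - n \<mu>\<bar> \<ge> x) \<le> C n x powr - \<beta>\<close>, where \<open>\<beta>\<close> is \<open>\<alpha> - 1\<close> in case (i) and \<open>2\<close> in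
  case (ii), the times \<open>n > \<delta> t\<close> outside the window contribute \<open>o(1)\<close> visits up to \<open>2 t / \<mu>\<close>, and beyond
  that they contribute at most a multiple of the sum of \<open>P(N = n) n powr - \<beta>\<close>.
\<close>

section \<open>Random walks on the integers\<close>

text \<open>Steps may be negative, so the walk can return, and the bound for visits in a window
  carries the expected number of returns as a factor. Its boundedness is bootstrapped from the same
  bound: for the point 0 and the epochs from \<open>a\<close> to \<open>2 * a\<close> it controls
  the increase of \<open>green D\<close> by \<open>green D a\<close> times a factor summable along
  powers of 2.

  One exponent \<beta> serves both cases, because
  \<open>min ((y / x)\<^sup>2) (\<bar>y\<bar> / x)\<close> has expectation of order
  \<open>x powr - \<beta>\<close> both for tails of that order with \<beta> < 2 and for finite
  variance. The window exponent \<theta> must exceed \<open>1 / \<beta>\<close>, since the visits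
  outside the window and before \<open>2 * T\<close>, where \<open>T = tau t\<close>, are of order
  \<open>T * (T powr \<theta>) powr - \<beta>\<close>; the two values of \<open>1 / \<beta>\<close>
  are the two entries of the maximum in (R2).

  Harmonicity only shows that the renewal measure has vanishing increments. Its limit comes from a
  conserved quantity, the expected net number of upward crossings of a level.

  Under (P) with \<gamma> \<le> 2 the mean of N may be infinite; a truncated mean and the uniform
  bound for \<open>q n t\<close> then replace dominated convergence.\<close>

lemma integrable_pmf_bounded:
  fixes g :: "'b \<Rightarrow> real"
  assumes "\<And>y. \<bar>g y\<bar> \<le> B"
  shows "integrable (measure_pmf D) g"
  by (rule measure_pmf.integrable_const_bound[where B=B]) (use assms in auto)

text \<open>Each new step is put in front, so an induction on \<open>n\<close> conditions on the
  first step; \<open>walk_add\<close> gives the splitting at any other epoch.\<close>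

primrec walk :: "int pmf \<Rightarrow> nat \<Rightarrow> int pmf" where
  "walk D 0 = return_pmf 0"
| "walk D (Suc n) = bind_pmf D (\<lambda>y. map_pmf ((+) y) (walk D n))"

lemma pmf_map_plus: "pmf (map_pmf ((+) y) W) t = pmf W (t - y :: int)"
  using pmf_map_inj'[of "(+) y" W "t - y"] by simp

lemma pmf_walk_Suc: "pmf (walk D (Suc n)) t = (\<integral>y. pmf (walk D n) (t - y) \<partial>measure_pmf D)"
  by (simp add: pmf_bind pmf_map_plus)

lemma prob_bind_plus:
  "measure_pmf.prob (bind_pmf V (\<lambda>y. map_pmf ((+) y) W)) B
    = (\<integral>y. measure_pmf.prob W {s. y + s \<in> B} \<partial>measure_pmf V)"
  for B :: "int set"
  by (simp add: measure_pmf_bind measure_pmf.measure_bind[where N="count_space UNIV"]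
      measure_map_pmf vimage_def measure_pmf_in_subprob_algebra)

lemma prob_walk_Suc:
  "measure_pmf.prob (walk D (Suc n)) B
    = (\<integral>y. measure_pmf.prob (walk D n) {s. y + s \<in> B} \<partial>measure_pmf D)"
  by (simp add: prob_bind_plus)

lemma walk_add: "walk D (m + n) = bind_pmf (walk D m) (\<lambda>y. map_pmf ((+) y) (walk D n))"
proof (induction m)
  case 0
  have "(+) (0::int) = (\<lambda>x. x)" by auto
  then show ?case by (simp add: bind_return_pmf)
next
  case (Suc m)
  have "map_pmf ((+) (y + x)) W = map_pmf (\<lambda>z. y + (x + z)) W" for x y :: int and W
    by (rule map_pmf_cong) auto
  with Suc show ?case
    by (simp add: map_pmf_comp bind_assoc_pmf bind_map_pmf map_bind_pmf o_def)
qed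

lemma pmf_walk_add:
  "pmf (walk D (m + n)) t = (\<integral>y. pmf (walk D n) (t - y) \<partial>measure_pmf (walk D m))"
  by (simp add: walk_add pmf_bind pmf_map_plus)

lemma prob_walk_add:
  "measure_pmf.prob (walk D (m + n)) B
    = (\<integral>y. measure_pmf.prob (walk D n) {s. y + s \<in> B} \<partial>measure_pmf (walk D m))"
  by (simp add: walk_add prob_bind_plus)

section \<open>Expected returns and the hitting bound for visits\<close>

definition green :: "int pmf \<Rightarrow> nat \<Rightarrow> real" where
  "green D n = (\<Sum>k\<le>n. pmf (walk D k) 0)"

lemma green_mono: "m \<le> n \<Longrightarrow> green D m \<le> green D n"
  unfolding green_def by (rule sum_mono2) auto

lemma green_ge_1: "1 \<le> green D n"
  using green_mono[of 0 n D] by (simp add: green_def)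

text \<open>First hitting decomposition: once the walk sits at \<open>t\<close> it ends in \<open>B\<close> with probability at least
  \<open>1/2\<close>, so hitting \<open>t\<close> is at most twice as likely as ending in \<open>B\<close>.\<close>

lemma visits_le:
  assumes "\<And>j. j \<le> n \<Longrightarrow> 1/2 \<le> measure_pmf.prob (walk D j) {s. t + s \<in> B}"
  shows "(\<Sum>k\<le>n. pmf (walk D k) (t - x)) \<le> 2 * green D n * measure_pmf.prob (walk D n) {s. x + s \<in> B}"
  using assms
proof (induction n arbitrary: x)
  case 0
  have "1/2 \<le> measure_pmf.prob (walk D 0) {s. t + s \<in> B}" using 0 by blast
  then have "t \<in> B" by (cases "t \<in> B") (simp_all add: indicator_def)
  then show ?case by (auto simp: green_def indicator_def)
next
  case (Suc n)
  show ?case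
  \<comment> \<open>Started at \<open>t\<close>, the expected count is the Green function itself and
    the hypothesis at epoch \<open>Suc n\<close> bounds the final probability from below. Started
    elsewhere, epoch 0 contributes nothing and the first step leads to the same claim for
    \<open>n\<close> from \<open>x + y\<close>.\<close>
  proof (cases "x = t")
    case True
    have "1/2 \<le> measure_pmf.prob (walk D (Suc n)) {s. x + s \<in> B}"
      using Suc.prems[of "Suc n"] True by simp
    then have "green D (Suc n) * 1 \<le> green D (Suc n) * (2 * measure_pmf.prob (walk D (Suc n)) {s. x + s \<in> B})"
      using green_ge_1[of D "Suc n"] by (intro mult_left_mono) auto
    moreover have "(\<Sum>k\<le>Suc n. pmf (walk D k) (t - x)) = green D (Suc n)"
      by (simp only: green_def True diff_self)
    ultimately show ?thesis by (simp add: mult.assoc mult.left_commute)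
  next
    case False
    have IH: "(\<Sum>k\<le>n. pmf (walk D k) (t - (x + y)))
        \<le> 2 * green D n * measure_pmf.prob (walk D n) {s. y + s \<in> {s. x + s \<in> B}}" for y
      using Suc.IH[of "x + y"] Suc.prems by (simp add: add.assoc)
    have "(\<Sum>k\<le>Suc n. pmf (walk D k) (t - x)) = (\<Sum>k\<le>n. pmf (walk D (Suc k)) (t - x))"
      using False by (subst sum.atMost_Suc_shift) (simp del: walk.simps(2))
    also have "\<dots> = (\<integral>y. (\<Sum>k\<le>n. pmf (walk D k) (t - (x + y))) \<partial>measure_pmf D)"
      unfolding pmf_walk_Suc
      by (subst Bochner_Integration.integral_sum)
         (auto intro!: integrable_pmf_bounded[where B=1] simp: pmf_le_1 algebra_simps)
    also have "\<dots> \<le> (\<integral>y. 2 * green D n * measure_pmf.prob (walk D n) {s. y + s \<in> {s. x + s \<in> B}} \<partial>measure_pmf D)"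
    proof (rule integral_mono)
      show "integrable (measure_pmf D) (\<lambda>y. \<Sum>k\<le>n. pmf (walk D k) (t - (x + y)))"
        by (rule Bochner_Integration.integrable_sum)
           (auto intro!: integrable_pmf_bounded[where B=1] simp: pmf_le_1)
      show "integrable (measure_pmf D)
         (\<lambda>y. 2 * green D n * measure_pmf.prob (walk D n) {s. y + s \<in> {s. x + s \<in> B}})"
        by (intro integrable_mult_right integrable_pmf_bounded[where B=1]) auto
    qed (rule IH)
    also have "\<dots> = 2 * green D n * measure_pmf.prob (walk D (Suc n)) {s. x + s \<in> B}"
      unfolding prob_walk_Suc by simp
    also have "\<dots> \<le> 2 * green D (Suc n) * measure_pmf.prob (walk D (Suc n)) {s. x + s \<in> B}"
      by (intro mult_right_mono mult_left_mono green_mono) auto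
    finally show ?thesis .
  qed
qed

text \<open>By the Markov property at epoch \<open>a\<close>, the window is a fresh walk of
  \<open>n\<close> steps with random start \<open>y\<close>. The hitting bound holds for each
  \<open>y\<close>, and integrating over \<open>y\<close> restores the law at epoch
  \<open>a + n\<close>.\<close>

lemma visits_window_le:
  assumes "\<And>j. j \<le> n \<Longrightarrow> 1/2 \<le> measure_pmf.prob (walk D j) {s. t + s \<in> B}"
  shows "(\<Sum>k\<in>{a..a+n}. pmf (walk D k) t) \<le> 2 * green D n * measure_pmf.prob (walk D (a + n)) B"
proof -
  have "(\<Sum>k\<in>{a..a+n}. pmf (walk D k) t) = (\<Sum>k\<le>n. pmf (walk D (a + k)) t)"
    by (rule sum.reindex_bij_witness[of _ "\<lambda>k. a + k" "\<lambda>k. k - a"]) auto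
  also have "\<dots> = (\<integral>y. (\<Sum>k\<le>n. pmf (walk D k) (t - y)) \<partial>measure_pmf (walk D a))"
    unfolding pmf_walk_add
    by (subst Bochner_Integration.integral_sum)
       (auto intro!: integrable_pmf_bounded[where B=1] simp: pmf_le_1)
  also have "\<dots> \<le> (\<integral>y. 2 * green D n * measure_pmf.prob (walk D n) {s. y + s \<in> B} \<partial>measure_pmf (walk D a))"
  proof (rule integral_mono)
    show "integrable (measure_pmf (walk D a)) (\<lambda>y. \<Sum>k\<le>n. pmf (walk D k) (t - y))"
      by (rule Bochner_Integration.integrable_sum)
         (auto intro!: integrable_pmf_bounded[where B=1] simp: pmf_le_1)
    show "integrable (measure_pmf (walk D a))
       (\<lambda>y. 2 * green D n * measure_pmf.prob (walk D n) {s. y + s \<in> B})"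
      by (intro integrable_mult_right integrable_pmf_bounded[where B=1]) auto
  qed (rule visits_le[OF assms])
  also have "\<dots> = 2 * green D n * measure_pmf.prob (walk D (a + n)) B"
    unfolding prob_walk_add by simp
  finally show ?thesis .
qed

section \<open>Second moments and truncation\<close>

lemma finite_set_pmf_walk: "finite (set_pmf D) \<Longrightarrow> finite (set_pmf (walk D n))"
  by (induction n) auto

text \<open>Finite support makes every integral a finite sum. The centre \<open>a\<close> is
  arbitrary so that the induction can absorb a first step \<open>y\<close> by moving the centre to
  \<open>a - y\<close>.\<close>

lemma second_moment_walk_le:
  assumes fin: "finite (set_pmf D)"
  defines "m \<equiv> (\<integral>y. real_of_int y \<partial>measure_pmf D)"
    and "S \<equiv> (\<integral>y. (real_of_int y)\<^sup>2 \<partial>measure_pmf D)"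
  shows "(\<integral>s. (real_of_int s - a)\<^sup>2 \<partial>measure_pmf (walk D n)) \<le> n * S + (n * m - a)\<^sup>2"
proof (induction n arbitrary: a)
  case 0
  show ?case by simp
next
  case (Suc n)
  have int: "integrable (measure_pmf D) g" for g :: "int \<Rightarrow> real"
    by (rule integrable_measure_pmf_finite[OF fin])
  have "(\<integral>s. (real_of_int s - a)\<^sup>2 \<partial>measure_pmf (walk D (Suc n)))
      = (\<integral>y. (\<integral>s. (real_of_int s - (a - y))\<^sup>2 \<partial>measure_pmf (walk D n)) \<partial>measure_pmf D)"
    using finite_set_pmf_walk[OF fin, of n] fin
    by (simp add: pmf_expectation_bind[where A="set_pmf D"] integral_measure_pmf[where A="set_pmf D"] algebra_simps)
  also have "\<dots> \<le> (\<integral>y. n * S + (n * m - a)\<^sup>2 + 2 * (n * m - a) * y + (real_of_int y)\<^sup>2 \<partial>measure_pmf D)"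
  proof (rule integral_mono[OF int int])
    fix y
    show "(\<integral>s. (real_of_int s - (a - y))\<^sup>2 \<partial>measure_pmf (walk D n))
      \<le> n * S + (n * m - a)\<^sup>2 + 2 * (n * m - a) * y + (real_of_int y)\<^sup>2"
      using Suc.IH[of "a - y"] by (simp add: power2_eq_square algebra_simps)
  qed
  also have "\<dots> = n * S + (n * m - a)\<^sup>2 + 2 * (n * m - a) * m + S"
    unfolding m_def S_def
    by (subst Bochner_Integration.integral_add[OF int int])+ (simp add: measure_pmf.prob_space)
  \<comment> \<open>The two sides differ by \<open>m\<^sup>2\<close>, because the raw second moment
    \<open>S\<close> stands in for the variance.\<close>
  also have "\<dots> \<le> Suc n * S + (Suc n * m - a)\<^sup>2"
    by (simp add: power2_eq_square algebra_simps)
  finally show ?case .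
qed

text \<open>A union bound: walks with the original and the truncated steps differ only if one of the
  \<open>n\<close> steps exceeds \<open>x\<close>. Conditioning on the first step replaces an
  explicit coupling. Large steps are replaced by 0 rather than discarded, so the truncated law is
  again a probability law.\<close>

lemma prob_walk_truncate_le:
  fixes D :: "int pmf"
  defines "D' \<equiv> (\<lambda>x. map_pmf (\<lambda>y. if \<bar>real_of_int y\<bar> \<le> x then y else 0) D)"
  shows "measure_pmf.prob (walk D n) B
    \<le> measure_pmf.prob (walk (D' x) n) B + n * measure_pmf.prob D {y. \<bar>real_of_int y\<bar> > x}"
proof (induction n arbitrary: B)
  case 0
  then show ?case by simp
next
  case (Suc n)
  define T where "T = (\<lambda>y::int. if \<bar>real_of_int y\<bar> \<le> x then y else 0)"
  define P where "P = measure_pmf.prob D {y. \<bar>real_of_int y\<bar> > x}"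
  have int: "integrable (measure_pmf D) (\<lambda>y. measure_pmf.prob (walk W n) {s. h y + s \<in> B})"
    for h :: "int \<Rightarrow> int" and W
    by (rule integrable_pmf_bounded[where B=1]) auto
  have ind: "integrable (measure_pmf D) (indicator {y. \<bar>real_of_int y\<bar> > x} :: int \<Rightarrow> real)"
    by (rule integrable_pmf_bounded[where B=1]) (simp add: indicator_def)
  have "measure_pmf.prob (walk D (Suc n)) B
      = (\<integral>y. measure_pmf.prob (walk D n) {s. y + s \<in> B} \<partial>measure_pmf D)"
    by (rule prob_walk_Suc)
  also have "\<dots> \<le> (\<integral>y. (measure_pmf.prob (walk (D' x) n) {s. T y + s \<in> B} + n * P)
       + indicator {y. \<bar>real_of_int y\<bar> > x} y \<partial>measure_pmf D)"
  proof (rule integral_mono[OF int[where h="\<lambda>y. y"]])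
    show "integrable (measure_pmf D) (\<lambda>y. (measure_pmf.prob (walk (D' x) n) {s. T y + s \<in> B} + n * P)
       + indicator {y. \<bar>real_of_int y\<bar> > x} y)"
      by (intro Bochner_Integration.integrable_add int)
         (auto intro!: integrable_pmf_bounded[where B=1] simp: indicator_def)
    fix y
    show "measure_pmf.prob (walk D n) {s. y + s \<in> B}
      \<le> (measure_pmf.prob (walk (D' x) n) {s. T y + s \<in> B} + n * P) + indicator {y. \<bar>real_of_int y\<bar> > x} y"
    proof (cases "\<bar>real_of_int y\<bar> > x")
      case True
      have "0 \<le> measure_pmf.prob (walk (D' x) n) {s. T y + s \<in> B} + n * P"
        by (simp add: P_def)
      with True show ?thesis
        by (intro order.trans[OF measure_pmf.prob_le_1]) (simp add: indicator_def)
    next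
      case False
      then show ?thesis using Suc[of "{s. y + s \<in> B}"] by (simp add: T_def P_def)
    qed
  qed
  also have "\<dots> = (\<integral>y. measure_pmf.prob (walk (D' x) n) {s. T y + s \<in> B} \<partial>measure_pmf D) + n * P + P"
    using int[of "D' x" T] ind by (simp add: P_def measure_pmf.prob_space)
  also have "(\<integral>y. measure_pmf.prob (walk (D' x) n) {s. T y + s \<in> B} \<partial>measure_pmf D)
      = measure_pmf.prob (walk (D' x) (Suc n)) B"
    unfolding prob_walk_Suc by (simp add: D'_def T_def)
  finally show ?case by (simp add: P_def algebra_simps)
qed

section \<open>Walks with positive drift: deviations and visits\<close>

text \<open>The last assumption controls the tail, the truncated second moment and the truncated first
  moment at level \<open>x\<close> simultaneously.\<close>

locale drift_walk =
  fixes D :: "int pmf" and \<mu> \<beta> K :: real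
  assumes integrable_D: "integrable (measure_pmf D) real_of_int"
    and mean_D: "(\<integral>y. real_of_int y \<partial>measure_pmf D) = \<mu>"
    and mu_pos: "0 < \<mu>"
    and beta_gt_1: "1 < \<beta>"
    and truncated_moment: "0 < x \<Longrightarrow>
      (\<integral>y. min ((real_of_int y / x)\<^sup>2) (\<bar>real_of_int y\<bar> / x) \<partial>measure_pmf D) \<le> K * x powr - \<beta>"
begin

lemma integrable_min: "0 < x \<Longrightarrow>
  integrable (measure_pmf D) (\<lambda>y. min ((real_of_int y / x)\<^sup>2) (\<bar>real_of_int y\<bar> / x))"
  by (rule Bochner_Integration.integrable_bound[where f="\<lambda>y. real_of_int y / x"])
     (use integrable_D in auto)

lemma K_nonneg: "0 \<le> K"
proof -
  have "0 \<le> (\<integral>y. min ((real_of_int y / 1)\<^sup>2) (\<bar>real_of_int y\<bar> / 1) \<partial>measure_pmf D)"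
    by (rule Bochner_Integration.integral_nonneg) auto
  then show ?thesis using order.trans[OF _ truncated_moment[of 1]] by simp
qed

text \<open>Truncation at \<open>x\<close> and Chebyshev. With
  \<open>k = K * x powr - \<beta>\<close>, the truncated moment bounds the probability of a step
  above \<open>x\<close> by \<open>k\<close>, the second moment of a truncated step by
  \<open>x\<^sup>2 * k\<close> and the shift of its mean by \<open>x * k\<close>. If
  \<open>n * k \<le> 1\<close>, the squared total shift is at most
  \<open>x\<^sup>2 * (n * k)\<close>, so variance, shift and discarded steps cost
  \<open>n * k\<close> each, whence the 3. If \<open>n * k > 1\<close>, the bound exceeds 1.\<close>

lemma deviation_le:
  assumes x: "0 < x"
  shows "measure_pmf.prob (walk D n) {s. x \<le> \<bar>real_of_int s - n * \<mu>\<bar>} \<le> 3 * K * n * x powr - \<beta>"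
proof -
  define T where "T = (\<lambda>y::int. if \<bar>real_of_int y\<bar> \<le> x then y else 0)"
  define D' where "D' = map_pmf T D"
  define g where "g = (\<lambda>y::int. min ((real_of_int y / x)\<^sup>2) (\<bar>real_of_int y\<bar> / x))"
  define k where "k = K * x powr - \<beta>"
  have k0: "0 \<le> k" using K_nonneg by (simp add: k_def)
  have g: "integrable (measure_pmf D) g" "(\<integral>y. g y \<partial>measure_pmf D) \<le> k"
    using integrable_min[OF x] truncated_moment[OF x] by (simp_all add: g_def k_def)
  have g_big: "g y = \<bar>real_of_int y\<bar> / x" if "\<bar>real_of_int y\<bar> > x" for y
  proof -
    have "\<bar>real_of_int y\<bar> / x \<ge> 1" using that x by simp
    then have "\<bar>real_of_int y\<bar> / x * 1 \<le> \<bar>real_of_int y\<bar> / x * (\<bar>real_of_int y\<bar> / x)"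
      by (intro mult_left_mono) auto
    then show ?thesis by (simp add: g_def power2_eq_square min_def)
  qed
  have g_small: "g y = (real_of_int y / x)\<^sup>2" if "\<bar>real_of_int y\<bar> \<le> x" for y
  proof -
    have "\<bar>real_of_int y\<bar> / x \<le> 1" using that x by simp
    then have "\<bar>real_of_int y\<bar> / x * (\<bar>real_of_int y\<bar> / x) \<le> \<bar>real_of_int y\<bar> / x * 1"
      by (intro mult_left_mono) (use x in auto)
    then show ?thesis by (simp add: g_def power2_eq_square min_def)
  qed
  have g0: "0 \<le> g y" for y using x by (simp add: g_def)
  have P: "measure_pmf.prob D {y. \<bar>real_of_int y\<bar> > x} \<le> k"
  proof -
    have "measure_pmf.prob D {y. \<bar>real_of_int y\<bar> > x} = (\<integral>y. indicator {y. \<bar>real_of_int y\<bar> > x} y \<partial>measure_pmf D)"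
      by simp
    also have "\<dots> \<le> (\<integral>y. g y \<partial>measure_pmf D)"
    proof (rule integral_mono[OF _ g(1)])
      fix y show "indicator {y. \<bar>real_of_int y\<bar> > x} y \<le> g y"
        using g0[of y] g_big[of y] x by (auto simp: indicator_def)
    qed (auto intro!: integrable_pmf_bounded[where B=1] simp: indicator_def)
    finally show ?thesis using g(2) by simp
  qed
  have "T ` UNIV \<subseteq> {-\<lfloor>x\<rfloor>..\<lfloor>x\<rfloor>}"
  proof
    fix z assume "z \<in> T ` UNIV"
    then have "\<bar>real_of_int z\<bar> \<le> x" using x by (auto simp: T_def split: if_splits)
    then show "z \<in> {-\<lfloor>x\<rfloor>..\<lfloor>x\<rfloor>}" by (simp add: abs_le_iff le_floor_iff) linarith
  qed
  then have fin: "finite (set_pmf D')" unfolding D'_def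
    by (metis finite_atLeastAtMost_int finite_subset image_mono set_map_pmf subset_UNIV)
  define m where "m = (\<integral>y. real_of_int y \<partial>measure_pmf D')"
  define S where "S = (\<integral>y. (real_of_int y)\<^sup>2 \<partial>measure_pmf D')"
  have T_bd: "\<bar>real_of_int (T y)\<bar> \<le> x" for y using x by (simp add: T_def)
  have intT: "integrable (measure_pmf D) (\<lambda>y. real_of_int (T y))"
    by (rule integrable_pmf_bounded[OF T_bd])
  have T2: "(real_of_int (T y))\<^sup>2 \<le> x\<^sup>2 * g y" for y
    using g_small[of y] x g0[of y] by (auto simp: T_def field_simps)
  have S_le: "S \<le> x\<^sup>2 * k"
  proof -
    have "S = (\<integral>y. (real_of_int (T y))\<^sup>2 \<partial>measure_pmf D)" by (simp add: S_def D'_def)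
    also have "\<dots> \<le> (\<integral>y. x\<^sup>2 * g y \<partial>measure_pmf D)"
    proof (rule integral_mono)
      show "integrable (measure_pmf D) (\<lambda>y. (real_of_int (T y))\<^sup>2)"
      proof (rule integrable_pmf_bounded[where B="x\<^sup>2"])
        fix y show "\<bar>(real_of_int (T y))\<^sup>2\<bar> \<le> x\<^sup>2"
          using power_mono[OF T_bd[of y], of 2] by simp
      qed
    qed (use g T2 in auto)
    also have "\<dots> \<le> x\<^sup>2 * k" using g by (simp add: mult_left_mono)
    finally show ?thesis .
  qed
  have m_close: "\<bar>m - \<mu>\<bar> \<le> x * k"
  proof -
    have "m - \<mu> = (\<integral>y. real_of_int (T y) - real_of_int y \<partial>measure_pmf D)"
      using intT integrable_D by (simp add: m_def D'_def flip: mean_D)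
    also have "\<bar>\<dots>\<bar> \<le> (\<integral>y. \<bar>real_of_int (T y) - real_of_int y\<bar> \<partial>measure_pmf D)"
      by (rule integral_abs_bound)
    also have "\<dots> \<le> (\<integral>y. x * g y \<partial>measure_pmf D)"
    proof (rule integral_mono)
      fix y show "\<bar>real_of_int (T y) - real_of_int y\<bar> \<le> x * g y"
        using g0[of y] g_big[of y] x by (cases "\<bar>real_of_int y\<bar> \<le> x") (auto simp: T_def)
    qed (use g intT integrable_D in auto)
    also have "\<dots> \<le> x * k" using g x by (simp add: mult_left_mono)
    finally show ?thesis .
  qed
  define a where "a = n * \<mu>"
  have nk0: "0 \<le> n * k" using k0 by simp
  show ?thesis
  proof (cases "n * k \<le> 1")
    case False
    then have "1 \<le> 3 * (n * k)" by simp
    then show ?thesis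
      by (intro order.trans[OF measure_pmf.prob_le_1]) (simp add: k_def mult_ac)
  next
    case True
    have intW: "integrable (measure_pmf (walk D' n)) h" for h :: "int \<Rightarrow> real"
      by (rule integrable_measure_pmf_finite[OF finite_set_pmf_walk[OF fin]])
    have "x\<^sup>2 * measure_pmf.prob (walk D' n) {s. x \<le> \<bar>real_of_int s - a\<bar>}
      = (\<integral>s. x\<^sup>2 * indicator {s. x \<le> \<bar>real_of_int s - a\<bar>} s \<partial>measure_pmf (walk D' n))" by simp
    also have "\<dots> \<le> (\<integral>s. (real_of_int s - a)\<^sup>2 \<partial>measure_pmf (walk D' n))"
    proof (rule integral_mono[OF intW intW])
      fix s show "x\<^sup>2 * indicator {s. x \<le> \<bar>real_of_int s - a\<bar>} s \<le> (real_of_int s - a)\<^sup>2"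
        using power_mono[of x "\<bar>real_of_int s - a\<bar>" 2] x by (auto simp: indicator_def)
    qed
    also have "\<dots> \<le> n * S + (n * m - a)\<^sup>2"
      using second_moment_walk_le[OF fin] by (simp add: S_def m_def)
    also have "\<dots> \<le> n * (x\<^sup>2 * k) + (n * (x * k))\<^sup>2"
    proof -
      have "n * m - a = n * (m - \<mu>)" by (simp add: a_def algebra_simps)
      then have "\<bar>n * m - a\<bar> \<le> n * (x * k)"
        using m_close by (simp add: abs_mult mult_left_mono)
      then have "\<bar>n * m - a\<bar>\<^sup>2 \<le> (n * (x * k))\<^sup>2" by (intro power_mono) auto
      then show ?thesis using S_le by (intro add_mono mult_left_mono) auto
    qed
    also have "\<dots> = x\<^sup>2 * (n * k + (n * k) * (n * k))"
      by (simp add: power2_eq_square algebra_simps)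
    also have "\<dots> \<le> x\<^sup>2 * (n * k + n * k)"
      using mult_left_mono[OF True nk0] by (intro mult_left_mono add_left_mono) simp_all
    finally have "measure_pmf.prob (walk D' n) {s. x \<le> \<bar>real_of_int s - a\<bar>} \<le> 2 * (n * k)"
      using x by (simp add: mult.commute)
    moreover have "n * measure_pmf.prob D {y. \<bar>real_of_int y\<bar> > x} \<le> n * k"
      using P by (intro mult_left_mono) auto
    ultimately have "measure_pmf.prob (walk D n) {s. x \<le> \<bar>real_of_int s - a\<bar>} \<le> 3 * (n * k)"
      using prob_walk_truncate_le[of D n "{s. x \<le> \<bar>real_of_int s - a\<bar>}" x]
      by (simp add: D'_def T_def)
    then show ?thesis by (simp add: a_def k_def algebra_simps)
  qed
qed

text \<open>The hitting bound with a half-line as target set: from \<open>t\<close> the walk stays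
  in it with probability at least 1/2, whereas being in it at epoch \<open>b\<close> is a deviation
  of at least \<open>x / 2\<close>. The constant is 12 = 2 * 2 * 3, from the hitting bound, the
  treatment of large \<open>e\<close> and the deviation bound.\<close>

lemma visits_off_mean_le:
  assumes x: "0 < x" and ab: "a \<le> b" and t: "b * \<mu> + x \<le> t \<or> t \<le> a * \<mu> - x"
  shows "(\<Sum>n\<in>{a..b}. pmf (walk D n) t) \<le> 12 * K * green D (b - a) * b * (x / 2) powr - \<beta>"
proof -
  define n where "n = b - a"
  define e where "e = 3 * K * b * (x / 2) powr - \<beta>"
  have b: "b = a + n" using ab by (simp add: n_def)
  have e0: "0 \<le> e" using K_nonneg by (simp add: e_def)
  have dev: "measure_pmf.prob (walk D j) {s. x / 2 \<le> \<bar>real_of_int s - j * \<mu>\<bar>} \<le> e" if "j \<le> b" for j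
  proof -
    have "3 * K * j * (x / 2) powr - \<beta> \<le> e"
      unfolding e_def using that K_nonneg by (intro mult_right_mono mult_left_mono) auto
    then show ?thesis using deviation_le[of "x / 2" j] x by simp
  qed
  have G: "1 \<le> green D n" by (rule green_ge_1)
  have "(\<Sum>k\<in>{a..b}. pmf (walk D k) t) \<le> 2 * green D n * (2 * e)"
  proof (cases "e \<le> 1/2")
    \<comment> \<open>If \<open>e\<close> exceeds 1/2 the deviation bound says nothing; the trivial
      target \<open>UNIV\<close> suffices, as \<open>2 * e\<close> is then at least 1.\<close>
    case False
    have "(\<Sum>k\<in>{a..b}. pmf (walk D k) t) \<le> 2 * green D n * measure_pmf.prob (walk D (a + n)) UNIV"
      unfolding b by (rule visits_window_le) simp
    also have "\<dots> \<le> 2 * green D n * (2 * e)"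
      using False G by (intro mult_left_mono) auto
    finally show ?thesis .
  next
    case True
    \<comment> \<open>For \<open>t\<close> above the means the drift helps, so the barrier can stay
      at \<open>t - x / 2\<close>. For \<open>t\<close> below the means the walk may drift upwards
      by up to \<open>n * \<mu>\<close> after its visit, and the barrier has to move along.\<close>
    define B where "B = (if b * \<mu> + x \<le> t then {s. t - x / 2 \<le> real_of_int s} else {s. real_of_int s \<le> t + n * \<mu> + x / 2})"
    have half: "1/2 \<le> measure_pmf.prob (walk D j) {s. t + s \<in> B}" if j: "j \<le> n" for j
    proof -
      have jm: "0 \<le> j * \<mu>" "j * \<mu> \<le> n * \<mu>" using mu_pos j by auto
      have "- {s. t + s \<in> B} \<subseteq> {s. x / 2 \<le> \<bar>real_of_int s - j * \<mu>\<bar>}"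
        using jm x by (auto simp: B_def split: if_splits)
      then have "measure_pmf.prob (walk D j) (- {s. t + s \<in> B})
          \<le> measure_pmf.prob (walk D j) {s. x / 2 \<le> \<bar>real_of_int s - j * \<mu>\<bar>}"
        by (rule measure_pmf.finite_measure_mono) simp
      also have "\<dots> \<le> e" using j b by (intro dev) simp
      finally have "measure_pmf.prob (walk D j) (- {s. t + s \<in> B}) \<le> e" .
      moreover have "measure_pmf.prob (walk D j) (- {s. t + s \<in> B}) = 1 - measure_pmf.prob (walk D j) {s. t + s \<in> B}"
        using measure_pmf.prob_compl[of "{s. t + s \<in> B}" "walk D j"] by (simp add: Compl_eq_Diff_UNIV)
      ultimately show ?thesis using True by simp
    qed
    have "(\<Sum>k\<in>{a..b}. pmf (walk D k) t) \<le> 2 * green D n * measure_pmf.prob (walk D (a + n)) B"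
      unfolding b by (rule visits_window_le[OF half])
    also have "\<dots> \<le> 2 * green D n * (2 * e)"
    proof -
      have bm: "b * \<mu> = a * \<mu> + n * \<mu>" by (simp add: b algebra_simps)
      have "B \<subseteq> {s. x / 2 \<le> \<bar>real_of_int s - b * \<mu>\<bar>}"
        using t x bm by (auto simp: B_def split: if_splits)
      then have "measure_pmf.prob (walk D b) B
          \<le> measure_pmf.prob (walk D b) {s. x / 2 \<le> \<bar>real_of_int s - b * \<mu>\<bar>}"
        by (rule measure_pmf.finite_measure_mono) simp
      also have "\<dots> \<le> e" by (intro dev) simp
      finally have "measure_pmf.prob (walk D b) B \<le> e" .
      then show ?thesis using G e0 b by (intro mult_left_mono) auto
    qed
    finally show ?thesis .
  qed
  then show ?thesis by (simp add: e_def n_def mult_ac)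
qed

text \<open>Between the epochs \<open>a\<close> and \<open>2 * a\<close> the mean is at least
  \<open>a * \<mu>\<close> away from 0, so returns to 0 are off-mean visits. As the window has
  length \<open>a\<close>, the bound involves \<open>green D a\<close> only and becomes a relative
  increase of order \<open>a powr (1 - \<beta>)\<close>.\<close>

lemma green_double:
  assumes "1 \<le> a"
  shows "green D (2 * a) \<le> green D a * (1 + 24 * K * (\<mu> / 2) powr - \<beta> * a powr (1 - \<beta>))"
proof -
  have "green D (2 * a) = green D a + (\<Sum>k\<in>{a<..2*a}. pmf (walk D k) 0)"
  proof -
    have "{..2*a} = {..a} \<union> {a<..2*a}" by auto
    then show ?thesis unfolding green_def by (subst sum.union_disjoint[symmetric]) auto
  qed
  also have "(\<Sum>k\<in>{a<..2*a}. pmf (walk D k) 0) \<le> (\<Sum>k\<in>{a..2*a}. pmf (walk D k) 0)"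
    by (rule sum_mono2) auto
  also have "\<dots> \<le> 12 * K * green D (2 * a - a) * real (2 * a) * (a * \<mu> / 2) powr - \<beta>"
    using mu_pos assms by (intro visits_off_mean_le) auto
  also have "(a * \<mu> / 2) powr - \<beta> = a powr - \<beta> * (\<mu> / 2) powr - \<beta>"
    using mu_pos powr_mult[of "real a" "\<mu> / 2" "- \<beta>"] by simp
  also have "12 * K * green D (2 * a - a) * real (2 * a) * (a powr - \<beta> * (\<mu> / 2) powr - \<beta>)
    = green D a * (24 * K * (\<mu> / 2) powr - \<beta> * (a * a powr - \<beta>))"
    by simp
  also have "a * a powr - \<beta> = a powr (1 - \<beta>)"
    using assms by (simp add: powr_diff powr_minus divide_simps)
  finally show ?thesis by (simp add: algebra_simps)
qed

text \<open>Along \<open>a = 2 ^ k\<close> the relative increases are \<open>c * r ^ k\<close> with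
  \<open>r < 1\<close>, so the product of the factors \<open>1 + c * r ^ k\<close> is bounded;
  \<open>1 + u \<le> exp u\<close> reduces it to a geometric series.\<close>

lemma bdd_above_green: "bdd_above (range (green D))"
proof -
  define c where "c = 24 * K * (\<mu> / 2) powr - \<beta>"
  define r where "r = (2::real) powr (1 - \<beta>)"
  have r: "0 < r" "r < 1" using beta_gt_1 by (simp_all add: r_def powr_less_one)
  have c0: "0 \<le> c" using K_nonneg by (simp add: c_def)
  have bound: "green D (2 ^ k) \<le> green D 1 * exp (c * (\<Sum>j<k. r ^ j))" for k
  proof (induction k)
    case (Suc k)
    have "real (2 ^ k) powr (1 - \<beta>) = r ^ k"
      by (simp add: r_def powr_realpow[symmetric] powr_powr mult.commute)
    then have "green D (2 ^ Suc k) \<le> green D (2 ^ k) * (1 + c * r ^ k)"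
      using green_double[of "2 ^ k"] by (simp add: c_def)
    also have "\<dots> \<le> (green D 1 * exp (c * (\<Sum>j<k. r ^ j))) * exp (c * r ^ k)"
    proof (rule mult_mono[OF Suc.IH exp_ge_add_one_self])
      show "0 \<le> green D 1 * exp (c * (\<Sum>j<k. r ^ j))"
        using green_ge_1[of D 1] by simp
      show "0 \<le> 1 + c * r ^ k" using c0 r by (simp add: add_nonneg_nonneg)
    qed
    finally show ?case by (simp add: exp_add distrib_left mult.assoc)
  qed simp
  have "green D n \<le> green D 1 * exp (c * (1 / (1 - r)))" for n
  proof -
    have "n \<le> 2 ^ n" by (simp add: less_imp_le)
    then have "green D n \<le> green D (2 ^ n)" by (rule green_mono)
    also have "\<dots> \<le> green D 1 * exp (c * (\<Sum>j<n. r ^ j))" by (rule bound)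
    also have "(\<Sum>j<n. r ^ j) \<le> 1 / (1 - r)"
      using r by (simp add: sum_gp_strict divide_right_mono)
    then have "c * (\<Sum>j<n. r ^ j) \<le> c * (1 / (1 - r))" using c0 by (rule mult_left_mono)
    then have "green D 1 * exp (c * (\<Sum>j<n. r ^ j)) \<le> green D 1 * exp (c * (1 / (1 - r)))"
      using green_ge_1[of D 1] by (intro mult_left_mono) (simp_all only: exp_le_cancel_iff)
    finally show ?thesis .
  qed
  then show ?thesis by (intro bdd_aboveI2)
qed

section \<open>Uniform bounds for visits, off the mean and at late epochs\<close>

definition green_sup :: real where "green_sup = (SUP n. green D n)"

lemma green_le_sup: "green D n \<le> green_sup"
  unfolding green_sup_def by (rule cSUP_upper[OF _ bdd_above_green]) simp

lemma green_sup_ge_1: "1 \<le> green_sup"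
  using green_ge_1[of D 0] green_le_sup[of 0] by simp

lemma sum_visits_le: "finite A \<Longrightarrow> (\<Sum>n\<in>A. pmf (walk D n) t) \<le> 2 * green_sup"
proof -
  assume "finite A"
  then obtain m where m: "A \<subseteq> {..m}" by (meson finite_nat_iff_bounded_le)
  have "(\<Sum>n\<in>A. pmf (walk D n) t) \<le> (\<Sum>n\<in>{0..0+m}. pmf (walk D n) t)"
    using m by (intro sum_mono2) auto
  also have "\<dots> \<le> 2 * green D m * measure_pmf.prob (walk D (0 + m)) UNIV"
    by (rule visits_window_le) simp
  also have "\<dots> \<le> 2 * green_sup" using green_le_sup[of m] by simp
  finally show ?thesis .
qed

definition off_const :: real where "off_const = 12 * K * green_sup * 2 powr \<beta>"

lemma off_const_nonneg: "0 \<le> off_const"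
  using K_nonneg green_sup_ge_1 by (simp add: off_const_def)

lemma visits_off_mean:
  assumes x: "0 < x" and t: "b * \<mu> + x \<le> t \<or> t \<le> a * \<mu> - x"
  shows "(\<Sum>n\<in>{a..b}. pmf (walk D n) t) \<le> off_const * b * x powr - \<beta>"
proof (cases "a \<le> b")
  case True
  have "(\<Sum>n\<in>{a..b}. pmf (walk D n) t) \<le> 12 * K * green D (b - a) * b * (x / 2) powr - \<beta>"
    by (rule visits_off_mean_le[OF x True t])
  also have "\<dots> \<le> 12 * K * green_sup * b * (x / 2) powr - \<beta>"
    using K_nonneg by (intro mult_right_mono mult_left_mono green_le_sup) auto
  also have "\<dots> = off_const * b * x powr - \<beta>"
    using x by (simp add: off_const_def powr_divide powr_minus divide_simps)
  finally show ?thesis .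
qed (use off_const_nonneg in simp)

text \<open>The off-mean estimate with \<open>b = 2 * a\<close> and \<open>x = a * \<mu> / 2\<close>
  gives the factor \<open>2 * (\<mu> / 2) powr - \<beta>\<close>; replacing \<open>a\<close> by any
  \<open>k < 2 * a\<close> gives \<open>2 powr \<beta>\<close>.\<close>

definition block_const :: real where "block_const = 2 * off_const * (\<mu> / 2) powr - \<beta> * 2 powr \<beta>"

lemma block_const_nonneg: "0 \<le> block_const"
  using off_const_nonneg by (simp add: block_const_def)

text \<open>Dyadic blocks: from epoch \<open>a \<ge> m\<close> on, the mean exceeds \<open>t\<close>
  by at least \<open>a * \<mu> / 2\<close>, so the epochs in \<open>{a..2*a}\<close> contribute
  visits of order \<open>a powr (1 - \<beta>)\<close>. Weights within a block are comparable, which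
  allows the block to be charged to its own sum of \<open>p k * k powr - \<beta>\<close>.\<close>

lemma visits_weighted_tail:
  fixes p :: "nat \<Rightarrow> real"
  assumes m: "1 \<le> m" and t: "t \<le> m * \<mu> / 2" and p0: "\<And>n. 0 \<le> p n" and C0: "0 \<le> C"
    and p: "\<And>a n k. m \<le> a \<Longrightarrow> n \<in> {a..2*a} \<Longrightarrow> k \<in> {a..2*a} \<Longrightarrow> p n \<le> C * p k"
  shows "(\<Sum>n\<in>{m..<m*2^J}. p n * pmf (walk D n) t)
    \<le> block_const * C * (\<Sum>n\<in>{m..<m*2^J}. p n * n powr - \<beta>)"
proof (induction J)
  case (Suc J)
  define a where "a = m * 2 ^ J"
  have a: "1 \<le> a" "m \<le> a" using m by (simp_all add: a_def)
  have split: "{m..<m*2^Suc J} = {m..<a} \<union> {a..<2*a}"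
    using a(2) ivl_disj_un_two(3)[of m a "2 * a"] by (simp add: a_def mult_ac)
  have x: "0 < a * \<mu> / 2" using a mu_pos by simp
  have ta: "t \<le> a * \<mu> - a * \<mu> / 2"
  proof -
    have "m * \<mu> \<le> a * \<mu>" using a mu_pos by simp
    then show ?thesis using t by (simp add: mult.commute)
  qed
  define s where "s = (\<Sum>n\<in>{a..2*a}. pmf (walk D n) t)"
  have "s \<le> off_const * real (2 * a) * (a * \<mu> / 2) powr - \<beta>"
    unfolding s_def using visits_off_mean[OF x, of "2 * a" t a] ta by simp
  also have "(a * \<mu> / 2) powr - \<beta> = a powr - \<beta> * (\<mu> / 2) powr - \<beta>"
    using mu_pos powr_mult[of "real a" "\<mu> / 2" "- \<beta>"] by simp
  finally have s: "s \<le> a * (2 * off_const * (\<mu> / 2) powr - \<beta> * a powr - \<beta>)"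
    by (simp add: mult_ac)
  have s0: "0 \<le> s" by (simp add: s_def sum_nonneg)
  have block: "(\<Sum>n\<in>{a..<2*a}. p n * pmf (walk D n) t) \<le> C * p k * s" if k: "k \<in> {a..<2*a}" for k
  proof -
    have "(\<Sum>n\<in>{a..<2*a}. p n * pmf (walk D n) t) \<le> (\<Sum>n\<in>{a..<2*a}. (C * p k) * pmf (walk D n) t)"
      using k a by (intro sum_mono mult_right_mono p[of a]) auto
    also have "\<dots> \<le> (C * p k) * s"
      unfolding sum_distrib_left[symmetric] s_def
      using C0 p0[of k] by (intro mult_left_mono sum_mono2) auto
    finally show ?thesis .
  qed
  \<comment> \<open>The block has \<open>a\<close> members and \<open>block\<close> holds for each
    of them as reference point \<open>k\<close>; summing over \<open>k\<close> spreads the reference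
    weight over the whole block.\<close>
  have "a * (\<Sum>n\<in>{a..<2*a}. p n * pmf (walk D n) t) = (\<Sum>k\<in>{a..<2*a}. (\<Sum>n\<in>{a..<2*a}. p n * pmf (walk D n) t))"
    by simp
  also have "\<dots> \<le> (\<Sum>k\<in>{a..<2*a}. C * p k * s)" by (intro sum_mono block)
  also have "\<dots> \<le> (\<Sum>k\<in>{a..<2*a}. C * p k * (a * (2 * off_const * (\<mu> / 2) powr - \<beta> * (2 powr \<beta> * k powr - \<beta>))))"
  proof (intro sum_mono mult_left_mono)
    fix k assume k: "k \<in> {a..<2*a}"
    have "real k / 2 \<le> a" "0 < real k / 2" using k a by auto
    then have "a powr - \<beta> \<le> (k / 2) powr - \<beta>"
      using beta_gt_1 by (intro powr_mono2') auto
    also have "\<dots> = 2 powr \<beta> * k powr - \<beta>" by (simp add: powr_divide powr_minus divide_simps)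
    finally have "a powr - \<beta> \<le> 2 powr \<beta> * k powr - \<beta>" .
    then have "a * (2 * off_const * (\<mu> / 2) powr - \<beta> * a powr - \<beta>)
      \<le> a * (2 * off_const * (\<mu> / 2) powr - \<beta> * (2 powr \<beta> * k powr - \<beta>))"
      using off_const_nonneg by (intro mult_left_mono) auto
    with s show "s \<le> a * (2 * off_const * (\<mu> / 2) powr - \<beta> * (2 powr \<beta> * k powr - \<beta>))"
      by (rule order.trans)
    show "0 \<le> C * p k" using C0 p0 by simp
  qed
  also have "\<dots> = a * (block_const * C * (\<Sum>k\<in>{a..<2*a}. p k * k powr - \<beta>))"
    by (simp add: block_const_def sum_distrib_left mult_ac)
  finally have "(\<Sum>n\<in>{a..<2*a}. p n * pmf (walk D n) t)
      \<le> block_const * C * (\<Sum>k\<in>{a..<2*a}. p k * k powr - \<beta>)"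
    using a by simp
  moreover have "(\<Sum>n\<in>{m..<m*2^Suc J}. h n) = (\<Sum>n\<in>{m..<a}. h n) + (\<Sum>n\<in>{a..<2*a}. h n)"
    for h :: "nat \<Rightarrow> real"
    unfolding split by (rule sum.union_disjoint) auto
  ultimately show ?case using Suc.IH by (simp add: a_def distrib_left)
qed simp

end

section \<open>The renewal theorem\<close>

lemma tendsto_integral_pmf:
  fixes g :: "nat \<Rightarrow> 'b \<Rightarrow> real"
  assumes "\<And>z. (\<lambda>k. g k z) \<longlonglongrightarrow> L z" and "integrable (measure_pmf D) w" and "\<And>k z. \<bar>g k z\<bar> \<le> w z"
  shows "(\<lambda>k. \<integral>z. g k z \<partial>measure_pmf D) \<longlonglongrightarrow> (\<integral>z. L z \<partial>measure_pmf D)"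
  by (rule integral_dominated_convergence[where w=w]) (use assms in auto)

lemma sum_union_le:
  fixes h :: "'b \<Rightarrow> real"
  assumes "finite A" "finite B" "\<And>x. 0 \<le> h x"
  shows "sum h (A \<union> B) \<le> sum h A + sum h B"
  using assms by (simp add: sum_Un sum_nonneg)

lemma tendsto_int_at_top:
  assumes "(\<lambda>k. g (int k)) \<longlonglongrightarrow> L"
  shows "(g \<longlongrightarrow> L) at_top"
proof -
  from filterlim_compose[OF assms filterlim_nat_sequentially] have "((\<lambda>t. g (int (nat t))) \<longlongrightarrow> L) at_top" .
  then show ?thesis
  proof (rule Lim_transform_eventually)
    show "\<forall>\<^sub>F t in at_top. g (int (nat t)) = g t"
      using eventually_ge_at_top[of "0::int"] by eventually_elim simp
  qed
qed

lemma filterlim_int_shift: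
  assumes "filterlim c at_top F"
  shows "filterlim (\<lambda>k. c k + (j :: int)) at_top F"
  unfolding filterlim_at_top
proof
  fix Z
  have "\<forall>\<^sub>F k in F. Z - j \<le> c k" using assms by (simp add: filterlim_at_top)
  then show "\<forall>\<^sub>F k in F. Z \<le> c k + j" by eventually_elim simp
qed

text \<open>Extremal argument for the limit superior \<open>s\<close> of \<open>d\<close>: if \<open>d\<close> is close to \<open>s\<close> at \<open>t\<close>, harmonicity makes
  it close to \<open>s\<close> at \<open>t - y\<close>, \<open>t - 2y\<close>, ..., and the sum of these values telescopes to a bounded
  quantity.\<close>

lemma harmonic_difference_eventually_less:
  fixes d w :: "int \<Rightarrow> real"
  assumes bd: "\<And>t. \<bar>w t\<bar> \<le> B" and y: "pmf D y > 0" and d: "\<And>t. d t = w (t + y) - w t"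
    and harm: "\<And>t. t > 0 \<Longrightarrow> t + y > 0 \<Longrightarrow> d t = (\<integral>z. d (t - z) \<partial>measure_pmf D)"
    and eps: "0 < \<epsilon>"
  shows "\<forall>\<^sub>F t in at_top. d t < \<epsilon>"
proof -
  have dbd: "\<bar>d t\<bar> \<le> 2 * B" for t using bd[of "t + y"] bd[of t] by (simp add: d)
  \<comment> \<open>The infimum of the eventual upper bounds of \<open>d\<close> is its limit
    superior along the nonnegative integers.\<close>
  define S where "S = {a. \<forall>\<^sub>F k in sequentially. d (int k) \<le> a}"
  define s where "s = Inf S"
  have S_ne: "2 * B \<in> S" unfolding S_def mem_Collect_eq by (intro always_eventually allI) (rule abs_le_D1[OF dbd])
  have S_bd: "-(2 * B) \<le> a" if a: "a \<in> S" for a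
  proof -
    obtain n where "\<forall>k\<ge>n. d (int k) \<le> a" using a by (auto simp: S_def eventually_sequentially)
    then have "d (int n) \<le> a" by simp
    then show ?thesis using dbd[of "int n"] by simp
  qed
  have up: "\<forall>\<^sub>F k in sequentially. d (int k) \<le> s + e" if "e > 0" for e
  proof -
    have "\<exists>a\<in>S. a < s + e" unfolding s_def
      using S_ne that by (intro cInf_lessD) auto
    then obtain a where a: "\<forall>\<^sub>F k in sequentially. d (int k) \<le> a" "a < s + e" by (auto simp: S_def)
    show ?thesis using a(1) by eventually_elim (use a(2) in simp)
  qed
  have lo: "\<exists>k\<ge>n. d (int k) > s - e" if "e > 0" for e and n :: nat
  proof (rule ccontr)
    assume "\<not> ?thesis"
    then have "\<forall>\<^sub>F k in sequentially. d (int k) \<le> s - e"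
      unfolding eventually_sequentially by (meson not_le)
    then have "s - e \<in> S" by (simp add: S_def)
    then have "s \<le> s - e" unfolding s_def using S_bd by (intro cInf_lower bdd_belowI)
    then show False using that by simp
  qed
  have "\<forall>n. \<exists>k\<ge>n. d (int k) > s - inverse (Suc n)" using lo by simp
  then obtain r :: "nat \<Rightarrow> nat" where r: "\<And>n. n \<le> r n" "\<And>n. d (int (r n)) > s - inverse (Suc n)"
    by metis
  \<comment> \<open>The excess over the limit superior vanishes at infinity. It is the only slack in
    the averaging argument below.\<close>
  define e where "e = (\<lambda>t. max 0 (d t - s))"
  have e_lim: "(e \<longlongrightarrow> 0) at_top"
  proof (rule tendsto_int_at_top, rule tendstoI)
    fix x :: real assume "x > 0"
    then show "\<forall>\<^sub>F k in sequentially. dist (e (int k)) 0 < x"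
      using up[of "x/2"] by (auto simp: e_def elim!: eventually_mono)
  qed
  have r_top: "filterlim (\<lambda>k. int (r k)) at_top sequentially"
  proof -
    have "filterlim r at_top sequentially"
      by (rule filterlim_at_top_mono[OF filterlim_ident]) (use r in auto)
    then show ?thesis by (rule filterlim_compose[OF filterlim_int_sequentially])
  qed
  have step: "(\<lambda>k. d (c k - y)) \<longlonglongrightarrow> s"
    if c: "filterlim c at_top sequentially" and lim: "(\<lambda>k. d (c k)) \<longlonglongrightarrow> s" for c :: "nat \<Rightarrow> int"
  proof -
    have e_c: "(\<lambda>k. e (c k - z)) \<longlonglongrightarrow> 0" for z
      using filterlim_compose[OF e_lim filterlim_int_shift[OF c, of "-z"]] by simp
    have "(\<lambda>k. \<integral>z. e (c k - z) \<partial>measure_pmf D) \<longlonglongrightarrow> (\<integral>z. 0 \<partial>measure_pmf D)"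
    proof (rule tendsto_integral_pmf[OF e_c])
      show "integrable (measure_pmf D) (\<lambda>_. 2 * B + \<bar>s\<bar>)" by simp
      fix k z show "\<bar>e (c k - z)\<bar> \<le> 2 * B + \<bar>s\<bar>"
        using dbd[of "c k - z"] by (simp add: e_def)
    qed
    then have E: "(\<lambda>k. \<integral>z. e (c k - z) \<partial>measure_pmf D) \<longlonglongrightarrow> 0" by simp
    have int_d: "integrable (measure_pmf D) (\<lambda>z. d (t - z))" for t
      by (rule integrable_pmf_bounded[OF dbd])
    have int_e: "integrable (measure_pmf D) (\<lambda>z. e (t - z))" for t
    proof (rule integrable_pmf_bounded)
      fix z show "\<bar>e (t - z)\<bar> \<le> 2 * B + \<bar>s\<bar>" using dbd[of "t - z"] by (simp add: e_def)
    qed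
    \<comment> \<open>In the average of \<open>d (t - z)\<close> the atom \<open>z = y\<close> has
      mass \<open>pmf D y\<close>. A deficit of \<open>d (t - y)\<close> below \<open>s\<close>
      therefore has to be paid for by the deficit of \<open>d t\<close> and the averaged
      excess.\<close>
    have key: "s - d (t - y) \<le> (s - d t + (\<integral>z. e (t - z) \<partial>measure_pmf D)) / pmf D y" if "t > 0" "t + y > 0" for t
    proof -
      have int_i: "integrable (measure_pmf D) (\<lambda>z. indicator {y} z * (d (t - y) - s))"
        by (intro integrable_mult_left integrable_pmf_bounded[where B=1]) (simp add: indicator_def)
      have "d t = (\<integral>z. d (t - z) \<partial>measure_pmf D)" using that by (rule harm)
      also have "\<dots> \<le> (\<integral>z. (s + e (t - z)) + indicator {y} z * (d (t - y) - s) \<partial>measure_pmf D)"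
      proof (rule integral_mono[OF int_d])
        show "integrable (measure_pmf D) (\<lambda>z. (s + e (t - z)) + indicator {y} z * (d (t - y) - s))"
          by (intro Bochner_Integration.integrable_add int_e int_i) simp
        fix z show "d (t - z) \<le> (s + e (t - z)) + indicator {y} z * (d (t - y) - s)"
          by (cases "z = y") (auto simp: e_def)
      qed
      also have "\<dots> = s + (\<integral>z. e (t - z) \<partial>measure_pmf D) + pmf D y * (d (t - y) - s)"
        using int_e[of t] int_i by (simp add: measure_pmf.prob_space measure_pmf_single)
      finally show ?thesis using y by (simp add: field_simps)
    qed
    have "(\<lambda>k. s - d (c k - y)) \<longlonglongrightarrow> 0"
    proof (rule tendsto_sandwich)
      show "(\<lambda>k. - e (c k - y)) \<longlonglongrightarrow> 0" using tendsto_minus[OF e_c[of y]] by simp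
      show "\<forall>\<^sub>F k in sequentially. - e (c k - y) \<le> s - d (c k - y)"
        by (intro always_eventually allI) (simp add: e_def)
      have "(\<lambda>k. (s - d (c k) + (\<integral>z. e (c k - z) \<partial>measure_pmf D)) / pmf D y) \<longlonglongrightarrow> (s - s + 0) / pmf D y"
        by (intro tendsto_intros lim E) (use y in simp)
      then show "(\<lambda>k. (s - d (c k) + (\<integral>z. e (c k - z) \<partial>measure_pmf D)) / pmf D y) \<longlonglongrightarrow> 0" by simp
      have "\<forall>\<^sub>F k in sequentially. c k > max 0 (-y)"
        by (rule eventually_compose_filterlim[OF eventually_gt_at_top c])
      then show "\<forall>\<^sub>F k in sequentially. s - d (c k - y)
          \<le> (s - d (c k) + (\<integral>z. e (c k - z) \<partial>measure_pmf D)) / pmf D y"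
        by eventually_elim (rule key, auto)
    qed
    from tendsto_diff[OF tendsto_const[of s] this] show ?thesis by simp
  qed
  have lim0: "(\<lambda>k. d (int (r k))) \<longlonglongrightarrow> s"
  proof -
    have "(\<lambda>k. d (int (r k)) - s) \<longlonglongrightarrow> 0"
    proof (rule tendsto_sandwich)
      show "\<forall>\<^sub>F k in sequentially. - inverse (real (Suc k)) \<le> d (int (r k)) - s"
        using r(2) by (intro always_eventually allI) (metis add.commute diff_ge_0_iff_ge diff_minus_eq_add less_imp_le le_diff_eq uminus_add_conv_diff)
      show "\<forall>\<^sub>F k in sequentially. d (int (r k)) - s \<le> e (int (r k))" by (simp add: e_def)
      show "(\<lambda>k. - inverse (real (Suc k))) \<longlonglongrightarrow> 0"
        using tendsto_minus[OF LIMSEQ_inverse_real_of_nat] by simp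
      show "(\<lambda>k. e (int (r k))) \<longlonglongrightarrow> 0" by (rule filterlim_compose[OF e_lim r_top])
    qed
    from tendsto_add[OF this tendsto_const[of s]] show ?thesis by simp
  qed
  have lims: "(\<lambda>k. d (int (r k) - int j * y)) \<longlonglongrightarrow> s" for j
  proof (induction j)
    case (Suc j)
    have "filterlim (\<lambda>k. int (r k) - int j * y) at_top sequentially"
      using filterlim_int_shift[OF r_top, of "- (int j * y)"] by simp
    from step[OF this Suc] show ?case by (simp add: algebra_simps)
  qed (simp add: lim0)
  have "J * s \<le> 2 * B" for J :: nat
  proof (rule tendsto_upperbound)
    show "(\<lambda>k. \<Sum>j<J. d (int (r k) - int j * y)) \<longlonglongrightarrow> J * s"
      using tendsto_sum[of "{..<J}" "\<lambda>j k. d (int (r k) - int j * y)" "\<lambda>_. s"] lims by simp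
    have "(\<Sum>j<J. d (t - int j * y)) = w (t + y) - w (t + y - int J * y)" for t
      by (induction J) (simp_all add: d algebra_simps)
    then have "(\<Sum>j<J. d (t - int j * y)) \<le> 2 * B" for t
      using bd[of "t + y"] bd[of "t + y - int J * y"] by (simp add: abs_le_iff)
    then show "\<forall>\<^sub>F k in sequentially. (\<Sum>j<J. d (int (r k) - int j * y)) \<le> 2 * B"
      by simp
  qed simp
  then have "s \<le> 0"
    by (metis linorder_not_le reals_Archimedean3)
  then have "\<forall>\<^sub>F t in at_top. e t < \<epsilon>"
    using order_tendstoD(2)[OF e_lim eps] by simp
  then show ?thesis
    by eventually_elim (use \<open>s \<le> 0\<close> in \<open>auto simp: e_def\<close>)
qed

lemma int_lipschitz:
  fixes V :: "int \<Rightarrow> real"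
  assumes "\<And>t. \<bar>V t - V (t - 1)\<bar> \<le> B"
  shows "\<bar>V t - V (t - y)\<bar> \<le> B * \<bar>real_of_int y\<bar>"
proof (induction y rule: int_induct[where k=0])
  case (step1 y)
  then show ?case using assms[of "t - y"] by (simp add: algebra_simps)
next
  case (step2 y)
  have "t - y + 1 - 1 = t - y" by simp
  then show ?case using step2 assms[of "t - y + 1"] by (simp add: algebra_simps)
qed simp

text \<open>Serves as a discrete integral of \<open>visits\<close> in the renewal theorem, where
  only its increments matter.\<close>

lemma int_antidifference:
  fixes u :: "int \<Rightarrow> real"
  obtains V where "\<And>t. V t - V (t - 1) = u t"
proof -
  define V where "V t = sum u {0<..t} - sum u {t<..0}" for t
  have "V t - V (t - 1) = u t" for t
  proof (cases "t \<ge> 1")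
    case True
    then have "{0<..t} = insert t {0<..t-1}" by auto
    then show ?thesis using True by (simp add: V_def)
  next
    case False
    then have "{t-1<..0} = insert t {t<..0}" by auto
    then show ?thesis using False by (simp add: V_def)
  qed
  then show ?thesis using that by blast
qed

section \<open>The renewal measure and its limit\<close>

context drift_walk
begin

definition visits :: "int \<Rightarrow> real" where "visits t = (\<Sum>n. pmf (walk D n) t)"

lemma summable_visits: "summable (\<lambda>n. pmf (walk D n) t)"
  by (rule summableI_nonneg_bounded[where x="2 * green_sup"]) (auto intro: sum_visits_le)

lemma visits_nonneg: "0 \<le> visits t"
  unfolding visits_def by (rule suminf_nonneg[OF summable_visits]) simp

lemma visits_bound: "visits t \<le> 2 * green_sup"
  unfolding visits_def by (rule suminf_le_const[OF summable_visits]) (simp add: sum_visits_le)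

lemma abs_visits: "\<bar>visits t\<bar> \<le> 2 * green_sup"
  using visits_nonneg[of t] visits_bound[of t] by simp

text \<open>The renewal equation: the first-step decomposition of the visits up to a finite epoch
  passes to the limit, dominated by the uniform bound for visits.\<close>

lemma visits_eq: "visits t = (if t = 0 then 1 else 0) + (\<integral>y. visits (t - y) \<partial>measure_pmf D)"
proof -
  define U where "U n t = (\<Sum>k<n. pmf (walk D k) t)" for n t
  have lim: "(\<lambda>n. U n t) \<longlonglongrightarrow> visits t" for t
    unfolding U_def visits_def by (rule summable_LIMSEQ[OF summable_visits])
  have "(\<lambda>n. \<integral>y. U n (t - y) \<partial>measure_pmf D) \<longlonglongrightarrow> (\<integral>y. visits (t - y) \<partial>measure_pmf D)"
  proof (rule tendsto_integral_pmf[OF lim])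
    show "integrable (measure_pmf D) (\<lambda>_. 2 * green_sup)" by simp
    fix n y
    have "0 \<le> U n (t - y)" by (simp add: U_def sum_nonneg)
    then show "\<bar>U n (t - y)\<bar> \<le> 2 * green_sup" using sum_visits_le[of "{..<n}"] by (simp add: U_def)
  qed
  from tendsto_add[OF tendsto_const[of "if t = 0 then 1 else 0"] this]
  have "(\<lambda>n. U (Suc n) t) \<longlonglongrightarrow> (if t = 0 then 1 else 0) + (\<integral>y. visits (t - y) \<partial>measure_pmf D)"
  proof (rule Lim_transform_eventually, intro always_eventually allI)
    fix n
    have "U (Suc n) t = pmf (walk D 0) t + (\<Sum>k<n. pmf (walk D (Suc k)) t)"
      unfolding U_def by (rule sum.lessThan_Suc_shift)
    also have "(\<Sum>k<n. pmf (walk D (Suc k)) t) = (\<integral>y. U n (t - y) \<partial>measure_pmf D)"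
      unfolding U_def pmf_walk_Suc
      by (subst Bochner_Integration.integral_sum)
         (auto intro!: integrable_pmf_bounded[where B=1] simp: pmf_le_1)
    finally show "(if t = 0 then 1 else 0) + (\<integral>y. U n (t - y) \<partial>measure_pmf D) = U (Suc n) t"
      by (auto simp: indicator_def)
  qed
  moreover have "(\<lambda>n. U (Suc n) t) \<longlonglongrightarrow> visits t" using lim by (rule LIMSEQ_Suc)
  ultimately show ?thesis using LIMSEQ_unique by blast
qed

text \<open>The weighted tail estimate with all weights equal to 1. The tail of the series is
  written as limit minus partial sum, so that its convergence to 0 is immediate.\<close>

definition tail_bound :: "nat \<Rightarrow> real" where
  "tail_bound m = block_const * ((\<Sum>n. real n powr - \<beta>) - (\<Sum>n<m. real n powr - \<beta>))"

lemma summable_powr_beta: "summable (\<lambda>n. real n powr - \<beta>)"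
  using beta_gt_1 by (subst summable_real_powr_iff) simp

lemma tail_bound_tendsto_0: "tail_bound \<longlonglongrightarrow> 0"
proof -
  have "(\<lambda>m. block_const * ((\<Sum>n. real n powr - \<beta>) - (\<Sum>n<m. real n powr - \<beta>))) \<longlonglongrightarrow> block_const * ((\<Sum>n. real n powr - \<beta>) - (\<Sum>n. real n powr - \<beta>))"
    by (intro tendsto_intros summable_LIMSEQ summable_powr_beta)
  then show ?thesis by (simp add: tail_bound_def[abs_def])
qed

lemma sum_visits_tail_le:
  assumes m: "1 \<le> m" and t: "t \<le> m * \<mu> / 2" and A: "finite A" "A \<subseteq> {m..}"
  shows "(\<Sum>n\<in>A. pmf (walk D n) t) \<le> tail_bound m"
proof -
  obtain J where J: "A \<subseteq> {m..<m*2^J}"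
  proof -
    obtain b where b: "A \<subseteq> {..<b}" using A(1) finite_nat_iff_bounded by blast
    have "b \<le> m * 2 ^ b"
      using m less_exp[of b] mult_le_mono[of 1 m b "2 ^ b"] by simp
    then have "A \<subseteq> {m..<m*2^b}" using b A(2) by fastforce
    then show ?thesis using that by blast
  qed
  have "(\<Sum>n\<in>A. pmf (walk D n) t) \<le> (\<Sum>n\<in>{m..<m*2^J}. 1 * pmf (walk D n) t)"
    using J by (simp add: sum_mono2)
  also have "\<dots> \<le> block_const * 1 * (\<Sum>n\<in>{m..<m*2^J}. 1 * n powr - \<beta>)"
    by (rule visits_weighted_tail[OF m t]) auto
  also have "\<dots> \<le> tail_bound m"
  proof -
    have "(\<Sum>n<m. real n powr - \<beta>) + (\<Sum>n\<in>{m..<m*2^J}. real n powr - \<beta>) = (\<Sum>n\<in>{..<m} \<union> {m..<m*2^J}. real n powr - \<beta>)"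
      by (subst sum.union_disjoint) auto
    also have "\<dots> \<le> (\<Sum>n. real n powr - \<beta>)"
      by (rule sum_le_suminf[OF summable_powr_beta]) auto
    finally show ?thesis
      using block_const_nonneg by (simp add: tail_bound_def mult_left_mono)
  qed
  finally show ?thesis .
qed

text \<open>Estimates for finite sets of remaining epochs are enough, since \<open>visits t\<close>
  is a limit of finite sums.\<close>

lemma visits_minus_sum_le:
  assumes "finite A" and "\<And>C. finite C \<Longrightarrow> C \<inter> A = {} \<Longrightarrow> (\<Sum>n\<in>C. pmf (walk D n) t) \<le> b"
  shows "visits t \<le> (\<Sum>n\<in>A. pmf (walk D n) t) + b"
  unfolding visits_def
proof (rule suminf_le_const[OF summable_visits])
  fix N
  have "(\<Sum>n<N. pmf (walk D n) t) \<le> (\<Sum>n\<in>A \<union> ({..<N} - A). pmf (walk D n) t)"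
    using assms(1) by (intro sum_mono2) auto
  also have "\<dots> = (\<Sum>n\<in>A. pmf (walk D n) t) + (\<Sum>n\<in>{..<N} - A. pmf (walk D n) t)"
    using assms(1) by (intro sum.union_disjoint) auto
  also have "(\<Sum>n\<in>{..<N} - A. pmf (walk D n) t) \<le> b" by (rule assms(2)) auto
  finally show "(\<Sum>n<N. pmf (walk D n) t) \<le> (\<Sum>n\<in>A. pmf (walk D n) t) + b" by simp
qed

text \<open>The epochs outside the window are covered by \<open>{0..a}\<close>, where the mean is at
  least \<open>x\<close> below \<open>t\<close>, by \<open>{b..m}\<close>, where it is at least
  \<open>x\<close> above \<open>t\<close>, and by the late epochs from \<open>m\<close> on. The
  overlaps at the ends only weaken an upper bound.\<close>

lemma sum_visits_outside_le:
  assumes x: "0 < x" and m: "1 \<le> m" and t: "a * \<mu> + x \<le> t" "t \<le> b * \<mu> - x" "t \<le> m * \<mu> / 2"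
    and C: "finite C" "C \<inter> {a..b} = {}"
  shows "(\<Sum>n\<in>C. pmf (walk D n) t) \<le> off_const * (real a + real m) * x powr - \<beta> + tail_bound m"
proof -
  have "(\<Sum>n\<in>C. pmf (walk D n) t) \<le> (\<Sum>n\<in>{0..a} \<union> {b..m} \<union> (C \<inter> {m..}). pmf (walk D n) t)"
    using C by (intro sum_mono2) (auto simp: disjoint_iff not_le)
  also have "\<dots> \<le> (\<Sum>n\<in>{0..a}. pmf (walk D n) t) + (\<Sum>n\<in>{b..m}. pmf (walk D n) t) + (\<Sum>n\<in>C \<inter> {m..}. pmf (walk D n) t)"
    using C by (intro order.trans[OF sum_union_le add_mono[OF sum_union_le order.refl]]) auto
  also have "\<dots> \<le> off_const * a * x powr - \<beta> + off_const * m * x powr - \<beta> + tail_bound m"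
    using t C by (intro add_mono visits_off_mean sum_visits_tail_le x m) auto
  finally show ?thesis
    by (simp add: algebra_simps)
qed

text \<open>The drift is positive, so \<open>- int k\<close> is at distance at least
  \<open>k\<close> from the mean at every epoch: the first \<open>m\<close> epochs are off-mean
  visits, the others fall under the tail bound. This is the boundary value that later fixes the
  renewal limit.\<close>

lemma visits_at_minus_infinity: "(\<lambda>k. visits (- int k)) \<longlonglongrightarrow> 0"
proof (rule tendstoI)
  fix e :: real assume e: "e > 0"
  obtain m where m: "1 \<le> m" "tail_bound m < e / 2"
    using eventually_conj[OF order_tendstoD(2)[OF tail_bound_tendsto_0, of "e/2"] eventually_ge_at_top[of 1]] e
    by (auto simp: eventually_sequentially)
  have "(\<lambda>k. off_const * m * real k powr - \<beta>) \<longlonglongrightarrow> off_const * m * 0"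
    using beta_gt_1 by (intro tendsto_intros tendsto_neg_powr filterlim_real_sequentially) auto
  then have "\<forall>\<^sub>F k in sequentially. off_const * m * real k powr - \<beta> < e / 2"
    using e by (intro order_tendstoD(2)) auto
  then show "\<forall>\<^sub>F k in sequentially. dist (visits (- int k)) 0 < e"
    using eventually_gt_at_top[of 0]
  proof eventually_elim
    case (elim k)
    have "visits (- int k) \<le> (\<Sum>n\<in>{0..m}. pmf (walk D n) (- int k)) + tail_bound m"
    proof (rule visits_minus_sum_le)
      fix C assume "finite C" "C \<inter> {0..m} = {}"
      then show "(\<Sum>n\<in>C. pmf (walk D n) (- int k)) \<le> tail_bound m"
        using mu_pos by (intro sum_visits_tail_le m) (auto simp: disjoint_iff intro: less_imp_le order.trans[of _ 0])
    qed simp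
    also have "(\<Sum>n\<in>{0..m}. pmf (walk D n) (- int k)) \<le> off_const * m * real k powr - \<beta>"
      using elim by (intro visits_off_mean) auto
    finally show ?case using elim m visits_nonneg[of "- int k"] by simp
  qed
qed

text \<open>Away from the origin the renewal equation makes \<open>visits\<close>, and hence its
  differences, harmonic. The extremal argument applies to \<open>visits\<close> and to
  \<open>- visits\<close>; the conditions \<open>t > 0\<close> and \<open>t + y > 0\<close> avoid
  the source at 0.\<close>

lemma visits_difference_tendsto_0:
  assumes y: "pmf D y > 0"
  shows "((\<lambda>t. visits (t + y) - visits t) \<longlongrightarrow> 0) at_top"
proof -
  have int: "integrable (measure_pmf D) (\<lambda>z. visits (t - z))" for t
    by (rule integrable_pmf_bounded[OF abs_visits])
  have harm: "visits (t + y) - visits t = (\<integral>z. visits (t - z + y) - visits (t - z) \<partial>measure_pmf D)"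
    if "t > 0" "t + y > 0" for t
    using that int[of t] int[of "t + y"] visits_eq[of t] visits_eq[of "t + y"] by (simp add: algebra_simps)
  show ?thesis
  proof (rule tendstoI)
    fix e :: real assume e: "e > 0"
    have "\<forall>\<^sub>F t in at_top. visits (t + y) - visits t < e"
      by (rule harmonic_difference_eventually_less[where w=visits and D=D and y=y, OF abs_visits y])
         (use harm e in auto)
    moreover have "\<forall>\<^sub>F t in at_top. - (visits (t + y) - visits t) < e"
    proof (rule harmonic_difference_eventually_less[where w="\<lambda>t. - visits t" and D=D and y=y, OF _ y])
      fix t assume "t > 0" "t + y > 0"
      from harm[OF this] show "- (visits (t + y) - visits t) = (\<integral>z. - (visits (t - z + y) - visits (t - z)) \<partial>measure_pmf D)"
        by (simp only: Bochner_Integration.integral_minus)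
    qed (use e abs_visits in auto)
    ultimately show "\<forall>\<^sub>F t in at_top. dist (visits (t + y) - visits t) 0 < e"
      by eventually_elim (simp add: abs_less_iff)
  qed
qed

text \<open>Two adjacent atoms make \<open>visits\<close> asymptotically constant on bounded ranges.
  With \<open>V\<close> the discrete integral of \<open>visits\<close>, the increment
  \<open>V t - V (t - z)\<close> is then close to \<open>z * visits t\<close>, and averaging over
  \<open>z\<close> gives \<open>\<mu> * visits t\<close>. The exact value of this average is the
  crossing number \<open>\<Phi> t = 1\<close>.\<close>

lemma renewal:
  assumes y: "pmf D y > 0" "pmf D (y + 1) > 0"
  shows "(visits \<longlongrightarrow> 1 / \<mu>) at_top"
proof -
  have top: "filterlim (\<lambda>k. int k + j) at_top sequentially" for j
    by (intro filterlim_int_shift filterlim_int_sequentially)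
  have d1: "((\<lambda>t. visits (t + 1) - visits t) \<longlongrightarrow> 0) at_top"
  proof -
    have sh: "filterlim (\<lambda>t::int. t + (- y)) at_top at_top"
      by (intro filterlim_int_shift filterlim_ident)
    \<comment> \<open>Both differences start from \<open>t - y\<close>; subtracting the one of step
      \<open>y\<close> from the one of step \<open>y + 1\<close> leaves a difference of step 1. This
      is where adjacency of the atoms enters.\<close>
    from filterlim_compose[OF visits_difference_tendsto_0[OF y(1)] sh]
      filterlim_compose[OF visits_difference_tendsto_0[OF y(2)] sh]
    have "((\<lambda>t. (visits (t - y + (y + 1)) - visits (t - y)) - (visits (t - y + y) - visits (t - y))) \<longlongrightarrow> 0 - 0) at_top"
      by (intro tendsto_diff) simp_all
    then show ?thesis by (simp add: algebra_simps)
  qed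
  have d: "((\<lambda>t. visits (t - j) - visits t) \<longlongrightarrow> 0) at_top" for j
  proof (induction j rule: int_induct[where k=0])
    case (step1 j)
    have "filterlim (\<lambda>t::int. t + (- (j + 1))) at_top at_top"
      by (intro filterlim_int_shift filterlim_ident)
    from tendsto_diff[OF step1(2) filterlim_compose[OF d1 this]] show ?case by (simp add: algebra_simps)
  next
    case (step2 j)
    have "filterlim (\<lambda>t::int. t + (- j)) at_top at_top"
      by (intro filterlim_int_shift filterlim_ident)
    from tendsto_add[OF step2(2) filterlim_compose[OF d1 this]] show ?case by (simp add: algebra_simps)
  qed simp
  obtain V where V: "\<And>t. V t - V (t - 1) = visits t"
    using int_antidifference[of visits] by blast
  have V_lip: "\<bar>V t - V (t - z)\<bar> \<le> 2 * green_sup * \<bar>real_of_int z\<bar>" for t z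
    by (rule int_lipschitz) (simp add: V abs_visits)
  \<comment> \<open>If \<open>visits\<close> is close to \<open>L k\<close> at every fixed distance
    from \<open>c k\<close>, then \<open>V\<close> changes by about \<open>z * L k\<close> over
    \<open>z\<close> sites. It is used with \<open>L = 0\<close> towards minus infinity and with
    \<open>L k = visits (int k)\<close> towards infinity.\<close>
  have V_lim: "(\<lambda>k. V (c k) - V (c k - z) - z * L k) \<longlonglongrightarrow> 0"
    if "\<And>j. (\<lambda>k. visits (c k - j) - L k) \<longlonglongrightarrow> 0" for c :: "nat \<Rightarrow> int" and L :: "nat \<Rightarrow> real" and z
  proof (induction z rule: int_induct[where k=0])
    case (step1 z)
    have "V (c k) - V (c k - (z + 1)) - real_of_int (z + 1) * L k
        = (V (c k) - V (c k - z) - z * L k) + (visits (c k - z) - L k)" for k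
      using V[of "c k - z"] by (simp add: algebra_simps)
    then show ?case using tendsto_add[OF step1(2) that[of z]] by (simp only: add_0)
  next
    case (step2 z)
    have "V (c k) - V (c k - (z - 1)) - real_of_int (z - 1) * L k
        = (V (c k) - V (c k - z) - z * L k) - (visits (c k - (z - 1)) - L k)" for k
      using V[of "c k - (z - 1)"] by (simp add: algebra_simps)
    then show ?case using tendsto_diff[OF step2(2) that[of "z - 1"]] by (simp only: diff_0_right)
  qed simp
  \<comment> \<open>The expected net number of crossings from at most \<open>t\<close> to above
    \<open>t\<close>: the increment of \<open>V\<close> counts the visited sites from which a step
    \<open>z\<close> crosses, with negative sign for downward steps. It is 0 for negative
    \<open>t\<close> and 1 otherwise.\<close>
  define \<Phi> where "\<Phi> t = (\<integral>z. V t - V (t - z) \<partial>measure_pmf D)" for t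
  have int_abs: "integrable (measure_pmf D) (\<lambda>z. c * \<bar>real_of_int z\<bar>)" for c
    using integrable_D by simp
  have int_V: "integrable (measure_pmf D) (\<lambda>z. V t - V (t - z))" for t
    by (rule Bochner_Integration.integrable_bound[OF int_abs[of "2 * green_sup"]])
       (use V_lip order.trans[OF V_lip abs_ge_self] in auto)
  have \<Phi>_step: "\<Phi> t - \<Phi> (t - 1) = (if t = 0 then 1 else 0)" for t
  proof -
    have "\<Phi> t - \<Phi> (t - 1) = (\<integral>z. (V t - V (t - z)) - (V (t - 1) - V (t - 1 - z)) \<partial>measure_pmf D)"
      unfolding \<Phi>_def by (rule Bochner_Integration.integral_diff[symmetric]) (rule int_V)+
    also have "\<dots> = (\<integral>z. visits t - visits (t - z) \<partial>measure_pmf D)"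
    proof (rule Bochner_Integration.integral_cong[OF refl])
      fix z
      have "V (t - 1 - z) = V (t - z - 1)" by (rule arg_cong[where f=V]) simp
      then show "(V t - V (t - z)) - (V (t - 1) - V (t - 1 - z)) = visits t - visits (t - z)"
        using V[of t] V[of "t - z"] by linarith
    qed
    also have "\<dots> = (if t = 0 then 1 else 0)"
      using visits_eq[of t] integrable_pmf_bounded[OF abs_visits, of D "\<lambda>z. t - z"]
      by (simp add: measure_pmf.prob_space)
    finally show ?thesis .
  qed
  have \<Phi>_neg: "\<Phi> (- int (Suc k)) = \<Phi> (- 1)" for k
  proof (induction k)
    case (Suc k)
    have "- int (Suc k) - 1 = - int (Suc (Suc k))" by simp
    then show ?case using \<Phi>_step[of "- int (Suc k)"] Suc by (simp only:) simp
  qed simp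
  have "(\<lambda>k. \<Phi> (- int k)) \<longlonglongrightarrow> (\<integral>z. 0 \<partial>measure_pmf D)"
    unfolding \<Phi>_def
  proof (rule tendsto_integral_pmf[OF _ int_abs V_lip])
    fix z
    have "(\<lambda>k. visits (- int k - j) - 0) \<longlonglongrightarrow> 0" for j
    proof -
      have "filterlim (\<lambda>k. nat (int k + j)) at_top sequentially"
        by (rule filterlim_compose[OF filterlim_nat_sequentially top[of j]])
      from filterlim_compose[OF visits_at_minus_infinity this]
      have "(\<lambda>k. visits (- int (nat (int k + j)))) \<longlonglongrightarrow> 0" .
      then show ?thesis
      proof (rule Lim_transform_eventually)
        have "\<forall>\<^sub>F k in sequentially. 0 \<le> int k + j" using top[of j] by (simp add: filterlim_at_top)
        then show "\<forall>\<^sub>F k in sequentially. visits (- int (nat (int k + j))) = visits (- int k - j) - 0"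
        proof eventually_elim
          case (elim k)
          then have "- int (nat (int k + j)) = - int k - j" by simp
          then show ?case by simp
        qed
      qed
    qed
    from V_lim[OF this, of z] show "(\<lambda>k. V (- int k) - V (- int k - z)) \<longlonglongrightarrow> 0" by simp
  qed
  then have "(\<lambda>k. \<Phi> (- int (Suc k))) \<longlonglongrightarrow> 0" using LIMSEQ_Suc by fastforce
  then have "\<Phi> (- 1) = 0" unfolding \<Phi>_neg LIMSEQ_const_iff .
  then have \<Phi>_pos: "\<Phi> (int k) = 1" for k
  proof (induction k)
    case 0
    then show ?case using \<Phi>_step[of 0] by simp
  next
    case (Suc k)
    then show ?case using \<Phi>_step[of "int (Suc k)"] by simp
  qed
  have "(\<lambda>k. \<integral>z. V (int k) - V (int k - z) - z * visits (int k) \<partial>measure_pmf D) \<longlonglongrightarrow> (\<integral>z. 0 \<partial>measure_pmf D)"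
  proof (rule tendsto_integral_pmf)
    fix z
    show "(\<lambda>k. V (int k) - V (int k - z) - z * visits (int k)) \<longlonglongrightarrow> 0"
      by (rule V_lim) (rule filterlim_compose[OF d filterlim_int_sequentially])
    show "integrable (measure_pmf D) (\<lambda>z. (4 * green_sup) * \<bar>real_of_int z\<bar>)" by (rule int_abs)
    fix k
    have "\<bar>z * visits (int k)\<bar> \<le> 2 * green_sup * \<bar>real_of_int z\<bar>"
      using mult_right_mono[OF abs_visits[of "int k"], of "\<bar>real_of_int z\<bar>"] by (simp add: abs_mult mult_ac)
    then show "\<bar>V (int k) - V (int k - z) - z * visits (int k)\<bar> \<le> 4 * green_sup * \<bar>real_of_int z\<bar>"
      using V_lip[of "int k" z] by linarith
  qed
  moreover have "(\<integral>z. V (int k) - V (int k - z) - z * visits (int k) \<partial>measure_pmf D) = 1 - \<mu> * visits (int k)" for k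
    using int_V[of "int k"] integrable_D \<Phi>_pos[of k] by (simp add: \<Phi>_def mean_D)
  ultimately have "(\<lambda>k. 1 - \<mu> * visits (int k)) \<longlonglongrightarrow> 0" by simp
  then have "(\<lambda>k. (1 - (1 - \<mu> * visits (int k))) / \<mu>) \<longlonglongrightarrow> (1 - 0) / \<mu>"
    using mu_pos by (intro tendsto_intros) auto
  then show ?thesis using mu_pos by (intro tendsto_int_at_top) simp
qed

end

section \<open>One big jump\<close>

text \<open>Commutativity of the convolution, restricted by a weight on the first summand. It
  exchanges step and remainder, so that pointwise bounds on \<open>pmf D\<close> can be used for a
  large step.\<close>

lemma integral_pmf_swap:
  fixes g :: "int \<Rightarrow> real"
  assumes g: "\<And>y. 0 \<le> g y" "\<And>y. g y \<le> B"
  shows "(\<integral>y. g y * pmf W (t - y) \<partial>measure_pmf D) = (\<integral>z. g (t - z) * pmf D (t - z) \<partial>measure_pmf W)"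
proof -
  have "(\<integral>\<^sup>+y. ennreal (g y * pmf W (t - y)) \<partial>measure_pmf D)
      = (\<integral>\<^sup>+y. ennreal (pmf D y * g y * pmf W (t - y)) \<partial>count_space UNIV)"
    by (subst nn_integral_measure_pmf) (simp add: ennreal_mult g mult.assoc)
  also have "\<dots> = (\<integral>\<^sup>+z. ennreal (pmf D (t - z) * g (t - z) * pmf W z) \<partial>count_space UNIV)"
  proof -
    have "bij_betw (\<lambda>z. t - z) UNIV UNIV"
      by (rule bij_betw_byWitness[where f'="\<lambda>z. t - z"]) auto
    from nn_integral_bij_count_space[OF this,
        of "\<lambda>y. ennreal (pmf D y * g y * pmf W (t - y))"]
    show ?thesis by simp
  qed
  also have "\<dots> = (\<integral>\<^sup>+z. ennreal (g (t - z) * pmf D (t - z)) \<partial>measure_pmf W)"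
    by (subst nn_integral_measure_pmf) (simp add: ennreal_mult[symmetric] g mult_ac)
  finally show ?thesis
    using g by (simp add: integral_eq_nn_integral)
qed

lemma exp_minus_1_le: "exp u - 1 \<le> u * exp (u::real)"
proof -
  have "(1 - u) * exp u \<le> exp (- u) * exp u"
    using exp_ge_add_one_self[of "- u"] by (intro mult_right_mono) auto
  then show ?thesis by (simp add: algebra_simps flip: exp_add)
qed

text \<open>Either some step is at least \<open>Y\<close>, or an exponential Markov bound applies to the walk with steps
  below \<open>Y\<close>.\<close>

lemma pmf_walk_le_exp:
  fixes Y l :: real
  assumes s: "\<And>y. Y \<le> real_of_int y \<Longrightarrow> pmf D y \<le> s" "0 \<le> s" and l: "0 \<le> l"
  shows "pmf (walk D n) t
    \<le> n * s + exp (- l * t) * (\<integral>y. indicator {y. real_of_int y < Y} y * exp (l * y) \<partial>measure_pmf D) ^ n"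
proof (induction n arbitrary: t)
  case 0
  show ?case using l by (auto simp: indicator_def)
next
  case (Suc n)
  define A where "A = {y. real_of_int y < Y}"
  define \<Lambda> where "\<Lambda> = (\<integral>y. indicator A y * exp (l * real_of_int y) \<partial>measure_pmf D)"
  have int_e: "integrable (measure_pmf D) (\<lambda>y. indicator A y * exp (l * real_of_int y))"
    by (rule integrable_pmf_bounded[where B="exp (l * Y)"])
       (use l in \<open>auto simp: A_def indicator_def intro: mult_left_mono\<close>)
  have int_b: "integrable (measure_pmf D) (\<lambda>y. indicator B y * pmf (walk D n) (t - y))" for B
    by (rule integrable_pmf_bounded[where B=1]) (auto simp: indicator_def pmf_le_1)
  have "pmf (walk D (Suc n)) t = (\<integral>y. indicator (- A) y * pmf (walk D n) (t - y) + indicator A y * pmf (walk D n) (t - y) \<partial>measure_pmf D)"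
    unfolding pmf_walk_Suc by (rule Bochner_Integration.integral_cong) (auto simp: indicator_def)
  also have "\<dots> = (\<integral>y. indicator (- A) y * pmf (walk D n) (t - y) \<partial>measure_pmf D)
      + (\<integral>y. indicator A y * pmf (walk D n) (t - y) \<partial>measure_pmf D)"
    by (rule Bochner_Integration.integral_add) (rule int_b)+
  also have "(\<integral>y. indicator (- A) y * pmf (walk D n) (t - y) \<partial>measure_pmf D) \<le> s"
  proof -
    \<comment> \<open>After the swap the integrand is the mass of \<open>D\<close> at a single value
      of at least \<open>Y\<close>, hence at most \<open>s\<close> wherever the remaining walk
      ends.\<close>
    have "(\<integral>y. indicator (- A) y * pmf (walk D n) (t - y) \<partial>measure_pmf D)
        = (\<integral>z. indicator (- A) (t - z) * pmf D (t - z) \<partial>measure_pmf (walk D n))"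
      by (rule integral_pmf_swap[where B=1]) auto
    also have "\<dots> \<le> (\<integral>z. s \<partial>measure_pmf (walk D n))"
    proof (rule integral_mono)
      show "integrable (measure_pmf (walk D n)) (\<lambda>z. indicator (- A) (t - z) * pmf D (t - z))"
        by (rule integrable_pmf_bounded[where B=1]) (auto simp: indicator_def pmf_le_1)
      show "indicator (- A) (t - z) * pmf D (t - z) \<le> s" for z
        using s by (simp add: indicator_def A_def)
    qed simp
    also have "\<dots> = s" by (simp add: measure_pmf.prob_space)
    finally show ?thesis .
  qed
  also have "(\<integral>y. indicator A y * pmf (walk D n) (t - y) \<partial>measure_pmf D)
      \<le> (\<integral>y. n * s + (indicator A y * exp (l * y)) * (exp (- l * t) * \<Lambda> ^ n) \<partial>measure_pmf D)"
  proof (rule integral_mono[OF int_b])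
    show "integrable (measure_pmf D) (\<lambda>y. n * s + (indicator A y * exp (l * y)) * (exp (- l * t) * \<Lambda> ^ n))"
      by (intro Bochner_Integration.integrable_add integrable_mult_left int_e) simp
    fix y
    have "exp (- l * real_of_int (t - y)) = exp (l * y) * exp (- l * t)"
      by (simp add: algebra_simps flip: exp_add)
    then show "indicator A y * pmf (walk D n) (t - y) \<le> n * s + (indicator A y * exp (l * y)) * (exp (- l * t) * \<Lambda> ^ n)"
      using Suc.IH[of "t - y"] s(2) by (simp add: indicator_def \<Lambda>_def A_def mult.assoc)
  qed
  also have "\<dots> = n * s + \<Lambda> * (exp (- l * t) * \<Lambda> ^ n)"
    using int_e by (simp add: measure_pmf.prob_space flip: \<Lambda>_def)
  finally show ?case by (simp add: \<Lambda>_def A_def algebra_simps)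
qed

text \<open>What the one-big-jump estimates use of a regularly varying density. Long-tailedness
  gives the pointwise limits, almost monotonicity the domination and the bound for steps of order
  \<open>t\<close>. The polynomial lower bound absorbs the exponential error, and the positive
  moment of order above 1 controls the truncated exponential moment.\<close>

locale big_jump =
  fixes D :: "int pmf" and c0 \<epsilon> :: real
  assumes eps_pos: "0 < \<epsilon>" and c0_nonneg: "0 \<le> c0"
    and long_tailed: "\<And>y. ((\<lambda>t. pmf D (t - y) / pmf D t) \<longlongrightarrow> 1) at_top"
    and almost_decreasing: "\<And>\<eta>. 0 < \<eta> \<Longrightarrow>
      \<exists>C. \<forall>\<^sub>F t in at_top. \<forall>z. \<eta> * real_of_int t \<le> z \<longrightarrow> pmf D z \<le> C * pmf D t"
    and polynomial_lower: "\<forall>\<^sub>F t in at_top. real_of_int t powr - c0 \<le> pmf D t"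
    and positive_moment: "integrable (measure_pmf D) (\<lambda>y. max 0 (real_of_int y) powr (1 + \<epsilon>))"
begin

lemma pmf_pos: "\<forall>\<^sub>F t in at_top. 0 < pmf D t"
  using polynomial_lower eventually_gt_at_top[of 0]
  by eventually_elim (rule less_le_trans, auto)

lemma almost_decreasing_pos:
  assumes "0 < \<eta>"
  obtains C where "1 \<le> C" "\<forall>\<^sub>F t in at_top. \<forall>z. \<eta> * real_of_int t \<le> z \<longrightarrow> pmf D z \<le> C * pmf D t"
proof -
  obtain C where C: "\<forall>\<^sub>F t in at_top. \<forall>z. \<eta> * real_of_int t \<le> z \<longrightarrow> pmf D z \<le> C * pmf D t"
    using almost_decreasing[OF assms] by blast
  show ?thesis
  proof (rule that[of "max 1 C"])
    show "\<forall>\<^sub>F t in at_top. \<forall>z. \<eta> * real_of_int t \<le> z \<longrightarrow> pmf D z \<le> max 1 C * pmf D t"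
      using C by eventually_elim (meson max.cobounded2 mult_right_mono order.trans pmf_nonneg)
  qed simp
qed

text \<open>Split the first step at half of the target. A fixed small step \<open>y\<close> leaves
  the remaining \<open>n\<close> steps to reach the target minus \<open>y\<close>, with ratio
  tending to \<open>n\<close> by induction. A step beyond half is itself the big jump and, after the
  swap, contributes 1. In both parts the large factor sits at a point of at least half the target,
  where almost monotonicity dominates it.\<close>

lemma pmf_walk_ratio: "((\<lambda>t. pmf (walk D n) t / pmf D t) \<longlongrightarrow> n) at_top"
proof (induction n)
  case 0
  show ?case
  proof (rule Lim_transform_eventually[OF tendsto_const])
    show "\<forall>\<^sub>F t in at_top. real 0 = pmf (walk D 0) t / pmf D t"
      using eventually_gt_at_top[of 0] by eventually_elim (simp add: indicator_def)
  qed
next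
  case (Suc n)
  obtain C where C: "1 \<le> C" "\<forall>\<^sub>F t in at_top. \<forall>z. 1/2 * real_of_int t \<le> z \<longrightarrow> pmf D z \<le> C * pmf D t"
    by (rule almost_decreasing_pos[of "1/2"]) auto
  have top: "filterlim (\<lambda>k. int k + j) at_top sequentially" for j
    by (intro filterlim_int_shift filterlim_int_sequentially)
  have "\<forall>\<^sub>F t in at_top. pmf (walk D n) t / pmf D t < n + 1"
    by (rule order_tendstoD(2)[OF Suc.IH]) simp
  with pmf_pos have "\<forall>\<^sub>F t in at_top. 0 < pmf D t \<and> pmf (walk D n) t \<le> (n + 1) * pmf D t"
    by eventually_elim (auto simp: divide_simps)
  then obtain Z where Z: "\<And>t. t \<ge> Z \<Longrightarrow> 0 < pmf D t \<and> pmf (walk D n) t \<le> (n + 1) * pmf D t"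
    by (auto simp: eventually_at_top_linorder)
  obtain Z' where Z': "\<And>t z. t \<ge> Z' \<Longrightarrow> 1/2 * real_of_int t \<le> z \<Longrightarrow> pmf D z \<le> C * pmf D t"
    using C(2) by (auto simp: eventually_at_top_linorder)
  \<comment> \<open>The entry \<open>2 * Z\<close> ensures that every \<open>z\<close> of at least
    half of \<open>t\<close> lies above \<open>Z\<close>.\<close>
  define K where "K = max 0 (max (2 * Z) (max Z Z'))"
  have K: "0 < pmf D t" "1/2 * real_of_int t \<le> z \<Longrightarrow> pmf D z \<le> C * pmf D t"
      "1/2 * real_of_int t \<le> z \<Longrightarrow> pmf (walk D n) z \<le> (n + 1) * C * pmf D t" if "t \<ge> K" for t z
  proof -
    show "0 < pmf D t" using Z[of t] that by (simp add: K_def)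
    show *: "pmf D z \<le> C * pmf D t" if "1/2 * real_of_int t \<le> z"
      using Z'[OF _ that] \<open>t \<ge> K\<close> by (simp add: K_def)
    show "pmf (walk D n) z \<le> (n + 1) * C * pmf D t" if "1/2 * real_of_int t \<le> z"
    proof -
      have "real_of_int (2 * Z) \<le> real_of_int t" using \<open>t \<ge> K\<close> by (simp only: of_int_le_iff K_def)
      then have "z \<ge> Z" using that by simp
      then have "pmf (walk D n) z \<le> (n + 1) * pmf D z" using Z by blast
      also have "\<dots> \<le> (n + 1) * (C * pmf D t)" using *[OF that] by (intro mult_left_mono) auto
      finally show ?thesis by simp
    qed
  qed
  \<comment> \<open>\<open>a\<close> carries the first steps up to half of \<open>k\<close>, and
    \<open>b\<close> those beyond, with step and remainder exchanged. Both are 0 for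
    \<open>k\<close> below \<open>K\<close>, so the domination holds for every
    \<open>k\<close>.\<close>
  define a where "a k y = (if K \<le> int k then indicator {y. 2 * y \<le> int k} y * (pmf (walk D n) (int k - y) / pmf D (int k)) else 0)" for k y
  define b where "b k z = (if K \<le> int k then indicator {y. int k < 2 * y} (int k - z) * (pmf D (int k - z) / pmf D (int k)) else 0)" for k z
  have ev: "\<forall>\<^sub>F k in sequentially. K \<le> int k \<and> 2 * j < int k \<and> int k < 2 * (int k - j)" for j
  proof -
    have "\<forall>\<^sub>F k in sequentially. K \<le> int k" "\<forall>\<^sub>F k in sequentially. 2 * j < int k"
      using filterlim_int_sequentially
      by (auto intro: eventually_compose_filterlim[OF eventually_ge_at_top] eventually_compose_filterlim[OF eventually_gt_at_top])
    then show ?thesis by eventually_elim simp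
  qed
  have la: "(\<lambda>k. \<integral>y. a k y \<partial>measure_pmf D) \<longlonglongrightarrow> (\<integral>y. real n \<partial>measure_pmf D)"
  proof (rule tendsto_integral_pmf)
    fix y
    have "(\<lambda>k. pmf (walk D n) (int k - y) / pmf D (int k - y) * (pmf D (int k - y) / pmf D (int k))) \<longlonglongrightarrow> real n * 1"
      using filterlim_compose[OF Suc.IH top[of "- y"]] filterlim_compose[OF long_tailed filterlim_int_sequentially, of y]
      by (intro tendsto_mult) auto
    then have "(\<lambda>k. pmf (walk D n) (int k - y) / pmf D (int k - y) * (pmf D (int k - y) / pmf D (int k))) \<longlonglongrightarrow> real n"
      by (simp only: mult_1_right)
    then show "(\<lambda>k. a k y) \<longlonglongrightarrow> n"
    proof (rule Lim_transform_eventually)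
      have "\<forall>\<^sub>F k in sequentially. 0 < pmf D (int k - y)"
        using eventually_compose_filterlim[OF pmf_pos top[of "- y"]] by simp
      then show "\<forall>\<^sub>F k in sequentially. pmf (walk D n) (int k - y) / pmf D (int k - y) * (pmf D (int k - y) / pmf D (int k)) = a k y"
        using ev[of y] by eventually_elim (simp add: a_def)
    qed
    show "integrable (measure_pmf D) (\<lambda>_. (n + 1) * C)" by simp
    fix k
    show "\<bar>a k y\<bar> \<le> (n + 1) * C"
    proof (cases "K \<le> int k \<and> 2 * y \<le> int k")
      case True
      then have "real_of_int (2 * y) \<le> real_of_int (int k)" by (simp only: of_int_le_iff)
      then have "pmf (walk D n) (int k - y) \<le> (n + 1) * C * pmf D (int k)"
        using True by (intro K(3)) auto
      then show ?thesis using True K(1)[of "int k"] by (simp add: a_def divide_simps)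
    qed (use C(1) in \<open>auto simp: a_def\<close>)
  qed
  have lb: "(\<lambda>k. \<integral>z. b k z \<partial>measure_pmf (walk D n)) \<longlonglongrightarrow> (\<integral>z. 1 \<partial>measure_pmf (walk D n))"
  proof (rule tendsto_integral_pmf)
    fix z
    show "(\<lambda>k. b k z) \<longlonglongrightarrow> 1"
    proof (rule Lim_transform_eventually)
      show "(\<lambda>k. pmf D (int k - z) / pmf D (int k)) \<longlonglongrightarrow> 1"
        by (rule filterlim_compose[OF long_tailed filterlim_int_sequentially])
      show "\<forall>\<^sub>F k in sequentially. pmf D (int k - z) / pmf D (int k) = b k z"
        using ev[of z] by eventually_elim (simp add: b_def)
    qed
    show "integrable (measure_pmf (walk D n)) (\<lambda>_. C)" by simp
    fix k
    show "\<bar>b k z\<bar> \<le> C"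
    proof (cases "K \<le> int k \<and> int k < 2 * (int k - z)")
      case True
      then have "real_of_int (int k) \<le> real_of_int (2 * (int k - z))" unfolding of_int_le_iff by simp
      then have "pmf D (int k - z) \<le> C * pmf D (int k)"
        using True by (intro K(2)) auto
      then show ?thesis using True K(1)[of "int k"] by (simp add: b_def divide_simps)
    qed (use C(1) in \<open>auto simp: b_def\<close>)
  qed
  from tendsto_add[OF la lb]
  have "(\<lambda>k. (\<integral>y. a k y \<partial>measure_pmf D) + (\<integral>z. b k z \<partial>measure_pmf (walk D n))) \<longlonglongrightarrow> real (Suc n)"
    by (simp add: measure_pmf.prob_space add.commute)
  then have "(\<lambda>k. pmf (walk D (Suc n)) (int k) / pmf D (int k)) \<longlonglongrightarrow> real (Suc n)"
  proof (rule Lim_transform_eventually)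
    have *: "(\<integral>y. a k y \<partial>measure_pmf D) + (\<integral>z. b k z \<partial>measure_pmf (walk D n)) = pmf (walk D (Suc n)) (int k) / pmf D (int k)"
      if k: "K \<le> int k" for k
    proof -
      define A where "A = {y. int k < 2 * y}"
      have int: "integrable (measure_pmf D) (\<lambda>y. indicator B y * pmf (walk D n) (int k - y))" for B
        by (rule integrable_pmf_bounded[where B=1]) (auto simp: indicator_def pmf_le_1)
      have "pmf (walk D (Suc n)) (int k) = (\<integral>y. indicator (- A) y * pmf (walk D n) (int k - y) + indicator A y * pmf (walk D n) (int k - y) \<partial>measure_pmf D)"
        unfolding pmf_walk_Suc by (rule Bochner_Integration.integral_cong) (auto simp: indicator_def)
      also have "\<dots> = (\<integral>y. indicator (- A) y * pmf (walk D n) (int k - y) \<partial>measure_pmf D)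
          + (\<integral>y. indicator A y * pmf (walk D n) (int k - y) \<partial>measure_pmf D)"
        by (rule Bochner_Integration.integral_add) (rule int)+
      also have "(\<integral>y. indicator A y * pmf (walk D n) (int k - y) \<partial>measure_pmf D)
          = (\<integral>z. indicator A (int k - z) * pmf D (int k - z) \<partial>measure_pmf (walk D n))"
        by (rule integral_pmf_swap[where B=1]) auto
      finally show ?thesis
        using k by (simp add: a_def b_def A_def Compl_eq not_less add_divide_distrib)
    qed
    show "\<forall>\<^sub>F k in sequentially. (\<integral>y. a k y \<partial>measure_pmf D) + (\<integral>z. b k z \<partial>measure_pmf (walk D n)) = pmf (walk D (Suc n)) (int k) / pmf D (int k)"
      using ev[of 0] by eventually_elim (rule *, simp)
  qed
  then show ?case by (rule tendsto_int_at_top)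
qed

text \<open>With \<open>l = c ln t / t\<close>, the factor \<open>exp (l y)\<close> is at most of order \<open>y powr \<epsilon>\<close> for all \<open>1 \<le> y \<le> \<eta> t\<close>:
  it is bounded for \<open>y \<le> sqrt t\<close>, and \<open>ln t \<le> 2 ln y\<close> beyond.\<close>

lemma exp_le_powr:
  fixes t y c \<eta> :: real
  assumes t: "1 \<le> t" and c: "0 \<le> c" and \<eta>: "0 \<le> \<eta>" "2 * c * \<eta> \<le> \<epsilon>" and y: "1 \<le> y" "y \<le> \<eta> * t"
  shows "exp (c * ln t / t * y) \<le> exp (2 * c) * y powr \<epsilon>"
proof (cases "y \<le> sqrt t")
  case True
  have "ln t \<le> 2 * sqrt t"
    using ln_le_minus_one[of "sqrt t"] t by (simp add: ln_sqrt)
  then have "ln t * y \<le> (2 * sqrt t) * sqrt t" using True y t by (intro mult_mono) auto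
  also have "\<dots> = 2 * t" using t by simp
  finally have "c * (ln t * y) \<le> c * (2 * t)" using c by (rule mult_left_mono)
  then have "c * ln t / t * y \<le> 2 * c" using t by (simp add: divide_simps mult_ac)
  then have "exp (c * ln t / t * y) \<le> exp (2 * c) * 1" by simp
  also have "\<dots> \<le> exp (2 * c) * y powr \<epsilon>" using y eps_pos by (intro mult_left_mono ge_one_powr_ge_zero) auto
  finally show ?thesis .
next
  case False
  then have "ln (sqrt t) \<le> ln y" using t by (intro ln_mono) auto
  then have ln: "ln t \<le> 2 * ln y" using t by (simp add: ln_sqrt)
  have "c * ln t / t * y \<le> c * ln t / t * (\<eta> * t)" using y t c by (intro mult_left_mono) auto
  also have "\<dots> = c * \<eta> * ln t" using t by simp
  also have "\<dots> \<le> c * \<eta> * (2 * ln y)" using c \<eta> ln by (intro mult_left_mono) auto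
  also have "\<dots> = 2 * c * \<eta> * ln y" by simp
  also have "\<dots> \<le> \<epsilon> * ln y" using \<eta> y by (intro mult_right_mono) auto
  finally have "exp (c * ln t / t * y) \<le> 1 * y powr \<epsilon>" using y by (simp add: powr_def)
  also have "\<dots> \<le> exp (2 * c) * y powr \<epsilon>" using c by (intro mult_right_mono) auto
  finally show ?thesis .
qed

text \<open>The exponential bound with cut \<open>Y = \<eta> * t\<close> and
  \<open>l = c * ln t / t\<close>. Then \<open>exp (- l * t)\<close> is \<open>t powr - c\<close>,
  while the truncated exponential moment satisfies \<open>\<Lambda> ^ n \<le> t\<close> for
  \<open>n \<le> \<delta> * t\<close>. With \<open>c = c0 + 1\<close> the extra power pays for
  \<open>\<Lambda> ^ n\<close>, leaving \<open>t powr - c0 \<le> pmf D t\<close>. The value of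
  \<eta> is what \<open>exp_le_powr\<close> requires.\<close>

lemma pmf_walk_le:
  obtains \<delta> C where "0 < \<delta>" "0 < C"
    "\<forall>\<^sub>F t in at_top. \<forall>n. real n \<le> \<delta> * real_of_int t \<longrightarrow> pmf (walk D n) t \<le> C * n * pmf D t"
proof -
  define c where "c = c0 + 1"
  have c: "1 \<le> c" using c0_nonneg by (simp add: c_def)
  define \<eta> where "\<eta> = \<epsilon> / (2 * c)"
  have \<eta>: "0 < \<eta>" "2 * c * \<eta> \<le> \<epsilon>" using eps_pos c by (simp_all add: \<eta>_def)
  define M where "M = (\<integral>y. max 0 (real_of_int y) powr (1 + \<epsilon>) \<partial>measure_pmf D)"
  have M: "0 \<le> M" unfolding M_def by (rule Bochner_Integration.integral_nonneg) simp
  \<comment> \<open>Makes the exponent of \<open>\<Lambda> ^ n\<close> at most \<open>ln t\<close>;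
    \<open>M + 1\<close> keeps the denominator positive.\<close>
  define \<delta> where "\<delta> = 1 / (c * exp (2 * c) * (M + 1))"
  have \<delta>: "0 < \<delta>" "\<delta> * (c * exp (2 * c) * M) \<le> 1"
    using c M by (simp_all add: \<delta>_def)
  obtain C where C: "1 \<le> C" "\<forall>\<^sub>F t in at_top. \<forall>z. \<eta> * real_of_int t \<le> z \<longrightarrow> pmf D z \<le> C * pmf D t"
    by (rule almost_decreasing_pos[OF \<eta>(1)])
  show ?thesis
  proof (rule that[of \<delta> "C + 1"])
    show "\<forall>\<^sub>F t in at_top. \<forall>n. real n \<le> \<delta> * real_of_int t \<longrightarrow> pmf (walk D n) t \<le> (C + 1) * n * pmf D t"
      using C(2) polynomial_lower eventually_gt_at_top[of 1]
    proof eventually_elim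
      case (elim t)
      have t1: "1 \<le> real_of_int t" using elim by simp
      define l where "l = c * ln (real_of_int t) / t"
      have l: "0 \<le> l" using t1 c by (simp add: l_def)
      define \<Lambda> where "\<Lambda> = (\<integral>y. indicator {y. real_of_int y < \<eta> * t} y * exp (l * y) \<partial>measure_pmf D)"
      have \<Lambda>0: "0 \<le> \<Lambda>" unfolding \<Lambda>_def by (rule Bochner_Integration.integral_nonneg) simp
      have "\<Lambda> \<le> (\<integral>y. 1 + (l * exp (2 * c)) * (max 0 (real_of_int y) powr (1 + \<epsilon>)) \<partial>measure_pmf D)"
        unfolding \<Lambda>_def
      proof (rule integral_mono)
        show "integrable (measure_pmf D) (\<lambda>y. indicator {y. real_of_int y < \<eta> * t} y * exp (l * y))"
          by (rule integrable_pmf_bounded[where B="exp (l * (\<eta> * t))"])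
             (use l in \<open>auto simp: indicator_def intro!: mult_left_mono\<close>)
        show "integrable (measure_pmf D) (\<lambda>y. 1 + (l * exp (2 * c)) * (max 0 (real_of_int y) powr (1 + \<epsilon>)))"
          using positive_moment by simp
        fix y
        show "indicator {y. real_of_int y < \<eta> * t} y * exp (l * y) \<le> 1 + (l * exp (2 * c)) * (max 0 (real_of_int y) powr (1 + \<epsilon>))"
        proof (cases "real_of_int y < \<eta> * t \<and> y \<ge> 1")
          case True
          then have y1: "1 \<le> real_of_int y" by simp
          \<comment> \<open>Extracting the factor \<open>l * y\<close> before bounding the
            exponential keeps \<open>\<Lambda> - 1\<close> of order \<open>l\<close>, small enough
            to be raised to the power \<open>n\<close>. It also costs one power of \<open>y\<close>,
            hence the moment of order \<open>1 + \<epsilon>\<close>.\<close>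
          have "exp (l * y) \<le> 1 + (l * y) * exp (l * y)" using exp_minus_1_le[of "l * y"] by simp
          also have "exp (l * y) \<le> exp (2 * c) * y powr \<epsilon>"
            unfolding l_def using True y1 t1 c \<eta> by (intro exp_le_powr) auto
          also have "(l * y) * (exp (2 * c) * y powr \<epsilon>) = l * exp (2 * c) * (y powr (1 + \<epsilon>))"
            using y1 by (simp add: powr_add)
          finally show ?thesis using True y1 l by (simp add: mult_left_mono)
        next
          case False
          have "0 \<le> (l * exp (2 * c)) * (max 0 (real_of_int y) powr (1 + \<epsilon>))" using l by simp
          moreover have "exp (l * real_of_int y) \<le> 1" if "y \<le> 0"
            using that l by (simp add: mult_nonneg_nonpos)
          ultimately show ?thesis using False by (auto simp: indicator_def not_le intro: order.trans)
        qed
      qed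
      also have "\<dots> = 1 + l * exp (2 * c) * M"
        using positive_moment by (simp add: M_def measure_pmf.prob_space)
      also have "\<dots> \<le> exp (l * exp (2 * c) * M)" by (rule exp_ge_add_one_self)
      finally have \<Lambda>: "\<Lambda> \<le> exp (l * exp (2 * c) * M)" .
      show ?case
      proof (intro allI impI)
        fix n assume n: "real n \<le> \<delta> * t"
        show "pmf (walk D n) t \<le> (C + 1) * n * pmf D t"
        proof (cases "n = 0")
          case True
          then show ?thesis using elim by (simp add: indicator_def)
        next
          case False
          have "pmf (walk D n) t \<le> n * (C * pmf D t) + exp (- l * t) * \<Lambda> ^ n"
            unfolding \<Lambda>_def using elim(1) C(1) l by (intro pmf_walk_le_exp) auto
          also have "\<Lambda> ^ n \<le> real_of_int t powr 1"
          proof -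
            have "\<Lambda> ^ n \<le> exp (l * exp (2 * c) * M) ^ n" using \<Lambda> \<Lambda>0 by (rule power_mono)
            also have "\<dots> = exp (n * (l * exp (2 * c) * M))" by (rule exp_of_nat_mult[symmetric])
            also have "n * (l * exp (2 * c) * M) \<le> (\<delta> * t) * (l * exp (2 * c) * M)"
              using n l M by (intro mult_right_mono) auto
            also have "\<dots> = \<delta> * (c * exp (2 * c) * M) * ln t" using t1 by (simp add: l_def)
            also have "\<dots> \<le> 1 * ln t" using \<delta>(2) t1 by (intro mult_right_mono) auto
            finally show ?thesis using t1 by (simp add: powr_def)
          qed
          also have "exp (- l * t) = real_of_int t powr - c" using t1 by (simp add: l_def powr_def)
          also have "real_of_int t powr - c * real_of_int t powr 1 = real_of_int t powr - c0"
            by (subst powr_add[symmetric]) (simp add: c_def)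
          also have "\<dots> \<le> n * pmf D t"
          proof -
            have "1 * pmf D t \<le> n * pmf D t" using False by (intro mult_right_mono) auto
            then show ?thesis using elim(2) by simp
          qed
          finally show ?thesis by (simp add: algebra_simps)
        qed
      qed
    qed
  qed (use \<delta> C in auto)
qed

end

section \<open>Slow variation\<close>

text \<open>Uniform convergence theorem for \<open>h x = ln (L (exp x))\<close>. Averaging
  \<open>h (x + u) - h x = (h (x + u + v) - h x) - (h (x + u + v) - h (x + u))\<close> over \<open>v\<close> in \<open>[0, 1]\<close>
  reduces uniformity to two integrals that tend to 0 by dominated convergence.\<close>

lemma additive_uniform_convergence:
  fixes h :: "real \<Rightarrow> real"
  assumes meas [measurable]: "h \<in> borel_measurable borel"
    and lim: "\<And>u. ((\<lambda>x. h (x + u) - h x) \<longlongrightarrow> 0) at_top"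
    and A: "0 \<le> A" and e: "0 < e"
  shows "\<forall>\<^sub>F x in at_top. \<forall>u\<in>{0..A}. \<bar>h (x + u) - h x\<bar> < e"
proof -
  \<comment> \<open>The cap at 1 supplies the integrable majorant for dominated convergence on
    bounded intervals.\<close>
  define g where "g x v = min 1 \<bar>h (x + v) - h x\<bar>" for x v
  define I where "I B x = (\<integral>v. indicator {0..B} v * g x v \<partial>lborel)" for B x :: real
  have [measurable]: "g x \<in> borel_measurable borel" for x unfolding g_def by measurable
  have g01: "0 \<le> g x v" "g x v \<le> 1" for x v by (simp_all add: g_def)
  have int_ind: "integrable lborel (indicator {a..b} :: real \<Rightarrow> real)" for a b :: real
    by (simp add: integrable_indicator_iff emeasure_lborel_Icc_eq)
  have int_g: "integrable lborel (\<lambda>v. indicator {a..b} v * g x (c + v))" for a b c x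
    by (rule Bochner_Integration.integrable_bound[OF int_ind[of a b]])
       (use g01 in \<open>auto simp: indicator_def\<close>)
  have I_lim: "(I B \<longlongrightarrow> 0) at_top" for B
  proof -
    have "((\<lambda>x. \<integral>v. indicator {0..B} v * g x v \<partial>lborel) \<longlongrightarrow> (\<integral>v. 0 \<partial>(lborel :: real measure))) at_top"
    proof (rule integral_dominated_convergence_at_top[where w="indicator {0..B}"])
      show "AE v in lborel. ((\<lambda>x. indicator {0..B} v * g x v) \<longlongrightarrow> 0) at_top"
      proof (rule AE_I2)
        fix v :: real
        have "((\<lambda>x. indicator {0..B} v * min 1 \<bar>h (x + v) - h x\<bar>) \<longlongrightarrow> indicator {0..B} v * min 1 \<bar>0\<bar>) at_top"
          by (intro tendsto_intros lim)
        then show "((\<lambda>x. indicator {0..B} v * g x v) \<longlongrightarrow> 0) at_top" by (simp add: g_def)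
      qed
      show "\<forall>\<^sub>F x in at_top. AE v in lborel. norm (indicator {0..B} v * g x v) \<le> indicator {0..B} v"
        using g01 by (intro always_eventually allI AE_I2) (auto simp: indicator_def)
    qed (use int_ind in auto)
    then show ?thesis by (simp add: I_def[abs_def])
  qed
  have key: "min 1 \<bar>h (x + u) - h x\<bar> \<le> I (A + 1) x + I 1 (x + u)" if u: "u \<in> {0..A}" for x u
  proof -
    have "min 1 \<bar>h (x + u) - h x\<bar> = (\<integral>v. indicator {0..1::real} v * min 1 \<bar>h (x + u) - h x\<bar> \<partial>lborel)"
      by simp
    also have "\<dots> \<le> (\<integral>v. indicator {0..1} v * g x (u + v) + indicator {0..1} v * g (x + u) (0 + v) \<partial>lborel)"
    proof (rule integral_mono)
      show "integrable lborel (\<lambda>v. indicator {0..1::real} v * min 1 \<bar>h (x + u) - h x\<bar>)"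
        by (intro integrable_mult_left int_ind)
      show "integrable lborel (\<lambda>v. indicator {0..1} v * g x (u + v) + indicator {0..1} v * g (x + u) (0 + v))"
        by (intro Bochner_Integration.integrable_add int_g)
      fix v :: real
      have "min 1 \<bar>h (x + u) - h x\<bar> \<le> g x (u + v) + g (x + u) (0 + v)"
        unfolding g_def by (simp add: add.assoc min_def abs_if)
      then show "indicator {0..1} v * min 1 \<bar>h (x + u) - h x\<bar> \<le> indicator {0..1} v * g x (u + v) + indicator {0..1} v * g (x + u) (0 + v)"
        by (simp add: indicator_def)
    qed
    also have "\<dots> = (\<integral>v. indicator {0..1} v * g x (u + v) \<partial>lborel) + I 1 (x + u)"
      using int_g[of 0 1 x u] int_g[of 0 1 "x + u" 0] by (simp add: I_def)
    also have "(\<integral>v. indicator {0..1} v * g x (u + v) \<partial>lborel) \<le> (\<integral>v. indicator {0..A+1} (u + v) * g x (u + v) \<partial>lborel)"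
    proof (rule integral_mono[OF int_g])
      have "integrable lborel (\<lambda>v. indicator {-u..A+1-u} v * g x (u + v))" by (rule int_g)
      also have "(\<lambda>v. indicator {-u..A+1-u} v * g x (u + v)) = (\<lambda>v. indicator {0..A+1} (u + v) * g x (u + v))"
        by (auto simp: indicator_def fun_eq_iff)
      finally show "integrable lborel (\<lambda>v. indicator {0..A+1} (u + v) * g x (u + v))" .
      show "indicator {0..1} v * g x (u + v) \<le> indicator {0..A+1} (u + v) * g x (u + v)" for v
        using u g01[of x "u + v"] by (auto simp: indicator_def)
    qed
    also have "\<dots> = I (A + 1) x"
      unfolding I_def using lborel_integral_real_affine[of 1 "\<lambda>v. indicator {0..A+1} v * g x v" u] by simp
    finally show ?thesis by simp
  qed
  \<comment> \<open>Half of \<open>e\<close> for each integral. The cap at 1/2 keeps the sum at most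
    1, so that the truncation in \<open>g\<close> can be undone.\<close>
  define e' where "e' = min (e / 2) (1 / 2)"
  have e': "0 < e'" "e' + e' \<le> e" "e' + e' \<le> 1" using e by (auto simp: e'_def)
  obtain X where X: "\<And>x. x \<ge> X \<Longrightarrow> I (A + 1) x < e' \<and> I 1 x < e'"
    using eventually_conj[OF order_tendstoD(2)[OF I_lim[of "A + 1"] e'(1)] order_tendstoD(2)[OF I_lim[of 1] e'(1)]]
    by (auto simp: eventually_at_top_linorder)
  show ?thesis
    unfolding eventually_at_top_linorder
  proof (intro exI[of _ X] allI impI ballI)
    fix x u assume x: "x \<ge> X" and u: "u \<in> {0..A}"
    have "min 1 \<bar>h (x + u) - h x\<bar> < e' + e'"
      using key[OF u, of x] X[OF x] X[of "x + u"] x u by auto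
    then show "\<bar>h (x + u) - h x\<bar> < e" using e' by (simp add: min_def split: if_splits)
  qed
qed

text \<open>Logarithms turn scaling into translation: the interval from \<open>x\<close> to
  \<open>2 * x\<close> becomes a shift by at most \<open>ln 2\<close>, to which the additive theorem
  applies.\<close>

lemma slowly_varying_uniform:
  assumes L: "slowly_varying L" and e: "0 < e"
  shows "\<forall>\<^sub>F x in at_top. \<forall>y\<in>{x..2*x}. \<bar>ln (L y) - ln (L x)\<bar> < e"
proof -
  have [measurable]: "L \<in> borel_measurable borel" and pos: "\<forall>\<^sub>F x in at_top. L x > 0"
    and lim: "\<And>c. c > 0 \<Longrightarrow> ((\<lambda>x. L (c * x) / L x) \<longlongrightarrow> 1) at_top"
    using L by (auto simp: slowly_varying_def)
  define h where "h x = ln (L (exp x))" for x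
  have "((\<lambda>x. h (x + u) - h x) \<longlongrightarrow> 0) at_top" for u
  proof -
    have "((\<lambda>x. ln (L (exp u * exp x) / L (exp x))) \<longlongrightarrow> ln 1) at_top"
      by (intro tendsto_ln filterlim_compose[OF lim exp_at_top]) auto
    moreover have "\<forall>\<^sub>F x in at_top. ln (L (exp u * exp x) / L (exp x)) = h (x + u) - h x"
    proof -
      have "filterlim (\<lambda>x::real. exp (x + u)) at_top at_top" by real_asymp
      then have "\<forall>\<^sub>F x in at_top. L (exp (x + u)) > 0" "\<forall>\<^sub>F x in at_top. L (exp x) > 0"
        using eventually_compose_filterlim[OF pos] exp_at_top by blast+
      then show ?thesis
        by eventually_elim (simp add: h_def ln_div exp_add mult.commute)
    qed
    ultimately show ?thesis by (simp add: Lim_transform_eventually)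
  qed
  then have "\<forall>\<^sub>F x in at_top. \<forall>u\<in>{0..ln 2}. \<bar>h (x + u) - h x\<bar> < e"
    by (intro additive_uniform_convergence e) (simp_all add: h_def[abs_def])
  then have "\<forall>\<^sub>F x in at_top. \<forall>u\<in>{0..ln 2}. \<bar>h (ln x + u) - h (ln x)\<bar> < e"
    by (rule eventually_compose_filterlim[OF _ ln_at_top])
  then show ?thesis using eventually_gt_at_top[of 0]
  proof eventually_elim
    case (elim x)
    show ?case
    proof
      fix y assume y: "y \<in> {x..2*x}"
      then have "ln x \<le> ln y" "ln y \<le> ln (2 * x)" using elim(2) by (auto intro!: ln_mono)
      then have "ln y - ln x \<in> {0..ln 2}" using elim(2) by (simp add: ln_mult)
      then have "\<bar>h (ln x + (ln y - ln x)) - h (ln x)\<bar> < e" using elim(1) by blast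
      then show "\<bar>ln (L y) - ln (L x)\<bar> < e" using elim(2) y by (simp add: h_def)
    qed
  qed
qed

text \<open>Beyond \<open>X\<close> each doubling changes \<open>ln (L x)\<close> by less than
  \<open>d = e * ln 2\<close>. Passing from \<open>x\<close> to \<open>y\<close> takes at most
  \<open>log 2 (y / x) + 1\<close> doublings, at a total cost of \<open>e * ln (y / x) + d\<close>,
  and \<open>d \<le> e\<close>.\<close>

lemma potter_bound:
  assumes L: "slowly_varying L" and e: "0 < e"
  obtains X where "0 < X" "\<And>x. X \<le> x \<Longrightarrow> 0 < L x"
    "\<And>x y. X \<le> x \<Longrightarrow> x \<le> y \<Longrightarrow> L y \<le> exp e * (y / x) powr e * L x"
    "\<And>x y. X \<le> x \<Longrightarrow> x \<le> y \<Longrightarrow> L x \<le> exp e * (y / x) powr e * L y"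
proof -
  define d where "d = e * ln 2"
  have d: "0 < d" "d \<le> e" using e ln_2_less_1 by (simp_all add: d_def)
  have "\<forall>\<^sub>F x in at_top. L x > 0" using L by (simp add: slowly_varying_def)
  from eventually_conj[OF eventually_conj[OF this slowly_varying_uniform[OF L d(1)]] eventually_gt_at_top[of 0]]
  obtain X where X: "\<And>x. X \<le> x \<Longrightarrow> 0 < L x \<and> 0 < x \<and> (\<forall>y\<in>{x..2*x}. \<bar>ln (L y) - ln (L x)\<bar> < d)"
    by (auto simp: eventually_at_top_linorder)
  have step: "\<bar>ln (L y) - ln (L x)\<bar> \<le> k * d" if "X \<le> x" "x \<le> y" "y \<le> 2 ^ k * x" for x y and k :: nat
    using that
  proof (induction k arbitrary: y)
    case 0
    then show ?case by simp
  next
    case (Suc k)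
    show ?case
    proof (cases "y \<le> 2 * x")
      case True
      then have "\<bar>ln (L y) - ln (L x)\<bar> < d" using X[OF Suc.prems(1)] Suc.prems by simp
      moreover have "0 \<le> k * d" using d(1) by simp
      ultimately show ?thesis by (simp only: of_nat_Suc distrib_right mult_1)
    next
      case False
      have "\<bar>ln (L (y / 2)) - ln (L x)\<bar> \<le> k * d" using False Suc.prems by (intro Suc.IH) auto
      moreover have "\<bar>ln (L y) - ln (L (y / 2))\<bar> < d"
        using X[of "y / 2"] False Suc.prems by auto
      ultimately show ?thesis by (simp add: algebra_simps)
    qed
  qed
  have bound: "\<bar>ln (L y) - ln (L x)\<bar> \<le> e + e * ln (y / x)" if xy: "X \<le> x" "x \<le> y" for x y
  proof -
    have x0: "0 < x" using X[OF xy(1)] by simp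
    define r where "r = log 2 (y / x)"
    have r0: "0 \<le> r" unfolding r_def using x0 xy by (simp add: divide_simps)
    define k where "k = nat \<lceil>r\<rceil>"
    have k: "r \<le> k" "k \<le> r + 1" using r0 by (simp_all add: k_def of_nat_ceiling)
    have "y / x = 2 powr r" using x0 xy by (simp add: r_def)
    also have "\<dots> \<le> 2 powr k" using k by (intro powr_mono) auto
    finally have "y \<le> 2 ^ k * x" using x0 by (simp add: powr_realpow divide_simps)
    then have "\<bar>ln (L y) - ln (L x)\<bar> \<le> k * d" using xy by (intro step)
    also have "\<dots> \<le> (r + 1) * d" using k d by (intro mult_right_mono) auto
    also have "\<dots> = d + e * ln (y / x)" by (simp add: r_def d_def log_def algebra_simps)
    finally show ?thesis using d by simp
  qed
  have upper: "L b \<le> exp e * (y / x) powr e * L a"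
    if xy: "X \<le> x" "x \<le> y" and ab: "{a, b} \<subseteq> {x, y}" for x y a b
  proof -
    have pos: "0 < L a" "0 < L b" "0 < x" using X xy ab by (auto intro: order.trans)
    have "ln (L b) - ln (L a) \<le> e + e * ln (y / x)"
      using bound[OF xy] bound[of x x] xy pos ab e by (auto simp: abs_le_iff)
    then have "ln (L b) \<le> e + e * ln (y / x) + ln (L a)" by simp
    then have "exp (ln (L b)) \<le> exp (e + e * ln (y / x) + ln (L a))" by simp
    then show ?thesis using pos xy by (simp add: exp_add powr_def)
  qed
  show ?thesis
  proof (rule that[of X])
    show "L y \<le> exp e * (y / x) powr e * L x" if "X \<le> x" "x \<le> y" for x y
      by (rule upper[OF that]) simp
    show "L x \<le> exp e * (y / x) powr e * L y" if "X \<le> x" "x \<le> y" for x y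
      by (rule upper[OF that]) simp
  qed (use X in auto)
qed

text \<open>A shift by \<open>c\<close> corresponds to a factor that varies with \<open>x\<close>,
  so the pointwise definition does not apply directly. For large \<open>x\<close> both points lie
  within a factor 2, where the convergence is uniform.\<close>

lemma slowly_varying_shift:
  assumes L: "slowly_varying L"
  shows "((\<lambda>x. L (x - c) / L x) \<longlongrightarrow> 1) at_top"
proof -
  have pos: "\<forall>\<^sub>F x in at_top. L x > 0" using L by (simp add: slowly_varying_def)
  have sh: "filterlim (\<lambda>x::real. x - c) at_top at_top" by real_asymp
  have "((\<lambda>x. ln (L (x - c)) - ln (L x)) \<longlongrightarrow> 0) at_top"
  proof (rule tendstoI)
    fix e :: real assume "e > 0"
    note U = slowly_varying_uniform[OF L this]
    show "\<forall>\<^sub>F x in at_top. dist (ln (L (x - c)) - ln (L x)) 0 < e"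
      using U eventually_compose_filterlim[OF U sh] eventually_gt_at_top[of "2 * \<bar>c\<bar>"]
    proof eventually_elim
      case (elim x)
      show ?case
      proof (cases "c \<le> 0")
        case True
        then have "x - c \<in> {x..2*x}" using elim(3) by auto
        then have "\<bar>ln (L (x - c)) - ln (L x)\<bar> < e" using elim(1) by blast
        then show ?thesis by simp
      next
        case False
        then have "x \<in> {x - c..2*(x - c)}" using elim(3) by auto
        then have "\<bar>ln (L x) - ln (L (x - c))\<bar> < e" using elim(2) by blast
        then show ?thesis by (simp add: abs_minus_commute)
      qed
    qed
  qed
  from tendsto_exp[OF this]
  have "((\<lambda>x. exp (ln (L (x - c)) - ln (L x))) \<longlongrightarrow> 1) at_top" by simp
  then show ?thesis
  proof (rule Lim_transform_eventually)
    show "\<forall>\<^sub>F x in at_top. exp (ln (L (x - c)) - ln (L x)) = L (x - c) / L x"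
      using pos eventually_compose_filterlim[OF pos sh] by eventually_elim (simp add: exp_diff)
  qed
qed

section \<open>Moments and tails\<close>

text \<open>Monotone convergence along finite sets: integrability and the bound on the integral both
  follow from a uniform bound on finite sums.\<close>

lemma integrable_pmf_exhaust:
  fixes g :: "'b \<Rightarrow> real" and A :: "nat \<Rightarrow> 'b set"
  assumes fin: "\<And>k. finite (A k)" and mono: "incseq A" and cover: "(\<Union>k. A k) = UNIV"
    and g0: "\<And>y. 0 \<le> g y" and bound: "\<And>k. (\<Sum>y\<in>A k. pmf D y * g y) \<le> B"
  shows "integrable (measure_pmf D) g" "(\<integral>y. g y \<partial>measure_pmf D) \<le> B"
proof -
  define G where "G k y = indicator (A k) y * g y" for k y
  have int: "integrable (measure_pmf D) (G k)" for k
  proof -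
    have "integrable (measure_pmf D) (\<lambda>y. \<Sum>z\<in>A k. indicator {z} y * g z)"
      by (intro Bochner_Integration.integrable_sum integrable_mult_left integrable_pmf_bounded[where B=1])
         (simp add: indicator_def)
    also have "(\<lambda>y. \<Sum>z\<in>A k. indicator {z} y * g z) = G k"
    proof
      fix y
      have "(\<Sum>z\<in>A k. indicator {z} y * g z) = (\<Sum>z\<in>A k. if y = z then g z else 0)"
        by (rule sum.cong) (auto simp: indicator_def)
      then show "(\<Sum>z\<in>A k. indicator {z} y * g z) = G k y"
        using fin[of k] by (simp add: G_def indicator_def)
    qed
    finally show ?thesis .
  qed
  have G_sum: "(\<integral>y. G k y \<partial>measure_pmf D) = (\<Sum>y\<in>A k. pmf D y * g y)" for k
    using integral_measure_pmf[OF fin[of k], of D "G k"] by (simp add: G_def indicator_def)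
  have mono_sum: "incseq (\<lambda>k. \<Sum>y\<in>A k. pmf D y * g y)"
    using mono fin g0 by (intro monoI sum_mono2) (auto dest: monoD)
  obtain S where S: "(\<lambda>k. \<Sum>y\<in>A k. pmf D y * g y) \<longlonglongrightarrow> S"
    using incseq_convergent[OF mono_sum] bound by metis
  have G_lim: "(\<lambda>k. G k y) \<longlonglongrightarrow> g y" for y
  proof (rule tendsto_eventually)
    obtain k where "y \<in> A k" using cover by blast
    then show "\<forall>\<^sub>F k in sequentially. G k y = g y"
      using mono by (auto simp: eventually_sequentially G_def monoD subset_eq intro!: exI[of _ k])
        (metis indicator_simps(1) mult_1 monoD subsetD)
  qed
  have G_mono: "mono (\<lambda>k. G k y)" for y
    using mono g0[of y] by (intro monoI) (auto simp: G_def indicator_def dest: monoD)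
  show "integrable (measure_pmf D) g"
    by (rule integrable_monotone_convergence[OF int AE_I2[OF G_mono] AE_I2[OF G_lim]])
       (use S G_sum in auto)
  have "(\<integral>y. g y \<partial>measure_pmf D) = S"
    by (rule integral_monotone_convergence[OF int AE_I2[OF G_mono] AE_I2[OF G_lim]])
       (use S G_sum in auto)
  also have "S \<le> B" using LIMSEQ_le_const2[OF S] bound by blast
  finally show "(\<integral>y. g y \<partial>measure_pmf D) \<le> B" .
qed

text \<open>Where \<open>g\<close> is nonzero, a single term of the series of \<open>c j\<close>
  times the indicator of \<open>A j\<close> already dominates it. Integrating the series term by
  term gives \<open>S\<close>; the sets need not be disjoint.\<close>

lemma integrable_pmf_cover:
  fixes g :: "'b \<Rightarrow> real" and c s :: "nat \<Rightarrow> real"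
  assumes g0: "\<And>y. 0 \<le> g y" and c0: "\<And>j. 0 \<le> c j"
    and cover: "\<And>y. g y = 0 \<or> (\<exists>j. y \<in> A j \<and> g y \<le> c j)"
    and s: "\<And>j. c j * measure_pmf.prob D (A j) \<le> s j" "s sums S"
  shows "integrable (measure_pmf D) g \<and> (\<integral>y. g y \<partial>measure_pmf D) \<le> S"
proof -
  have s0: "0 \<le> s j" for j by (rule order.trans[OF _ s(1)]) (simp add: c0)
  then have S0: "0 \<le> S" using s(2) by (metis suminf_nonneg sums_iff)
  have "(\<integral>\<^sup>+y. ennreal (g y) \<partial>measure_pmf D) \<le> (\<integral>\<^sup>+y. (\<Sum>j. ennreal (c j) * indicator (A j) y) \<partial>measure_pmf D)"
  proof (rule nn_integral_mono)
    fix y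
    show "ennreal (g y) \<le> (\<Sum>j. ennreal (c j) * indicator (A j) y)"
      using cover[of y]
    proof
      assume "\<exists>j. y \<in> A j \<and> g y \<le> c j"
      then obtain j where j: "y \<in> A j" "g y \<le> c j" by blast
      have "ennreal (g y) \<le> (\<Sum>i\<in>{j}. ennreal (c i) * indicator (A i) y)"
        using j by (simp add: ennreal_leI)
      also have "\<dots> \<le> (\<Sum>j. ennreal (c j) * indicator (A j) y)"
        by (rule sum_le_suminf) auto
      finally show ?thesis .
    qed simp
  qed
  also have "\<dots> = (\<Sum>j. ennreal (c j) * emeasure (measure_pmf D) (A j))"
    by (subst nn_integral_suminf) (auto simp: nn_integral_cmult_indicator)
  also have "\<dots> \<le> (\<Sum>j. ennreal (s j))"
    using s(1) c0 by (intro suminf_le)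
      (auto simp: measure_pmf.emeasure_eq_measure ennreal_mult[symmetric] intro!: ennreal_leI)
  also have "\<dots> = ennreal S" using s(2) s0 by (intro suminf_ennreal_eq) auto
  finally have nn: "(\<integral>\<^sup>+y. ennreal (g y) \<partial>measure_pmf D) \<le> ennreal S" .
  have int: "integrable (measure_pmf D) g"
    using g0 nn by (intro integrableI_nonneg) (auto intro: le_less_trans)
  have "ennreal (\<integral>y. g y \<partial>measure_pmf D) \<le> ennreal S"
    using nn nn_integral_eq_integral[OF int] g0 by simp
  then show ?thesis using S0 int by simp
qed

section \<open>Truncated moments from tail bounds\<close>

lemma dyadic_above:
  assumes "1 < (a :: real)"
  obtains j :: nat where "2 ^ j < a" "a \<le> 2 ^ Suc j"
proof -
  obtain n where n: "a \<le> 2 ^ n"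
    using real_arch_pow[of 2 a] by (auto intro: less_imp_le)
  define m where "m = (LEAST n. a \<le> 2 ^ n)"
  have m: "a \<le> 2 ^ m" unfolding m_def by (rule LeastI[of _ n]) (rule n)
  have "m \<noteq> 0" using m assms by (cases m) auto
  then obtain j where j: "m = Suc j" by (cases m) auto
  have "2 ^ j < a" using not_less_Least[of j "\<lambda>n. a \<le> 2 ^ n"] by (simp add: j[unfolded m_def])
  then show ?thesis using that m j by simp
qed

text \<open>Dyadic levels on both sides of \<open>x\<close>. Above, \<open>\<bar>y\<bar> / x\<close>
  is at most \<open>2 ^ Suc j\<close> on a set of probability of order
  \<open>(2 ^ j * x) powr - \<beta>\<close>, a geometric series of ratio
  \<open>2 powr (1 - \<beta>)\<close>. Below, the squares give the ratio
  \<open>2 powr (\<beta> - 2)\<close>. The two series converge because 1 < \<beta> < 2.\<close>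

lemma truncated_moment_of_tail:
  fixes D :: "int pmf"
  assumes beta: "1 < \<beta>" "\<beta> < 2" and C: "0 \<le> C"
    and tail: "\<And>x. 0 < x \<Longrightarrow> measure_pmf.prob D {y. x < \<bar>real_of_int y\<bar>} \<le> C * x powr - \<beta>"
  shows "\<exists>K. \<forall>x>0. (\<integral>y. min ((real_of_int y / x)\<^sup>2) (\<bar>real_of_int y\<bar> / x) \<partial>measure_pmf D) \<le> K * x powr - \<beta>"
proof -
  define r where "r = (2::real) powr (1 - \<beta>)"
  define q where "q = (2::real) powr (\<beta> - 2)"
  have r: "0 < r" "r < 1" "0 < q" "q < 1" using beta by (simp_all add: r_def q_def powr_less_one)
  have "(\<integral>y. min ((real_of_int y / x)\<^sup>2) (\<bar>real_of_int y\<bar> / x) \<partial>measure_pmf D)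
      \<le> (2 * C * (1 / (1 - r)) + 4 * 2 powr \<beta> * C * (1 / (1 - q))) * x powr - \<beta>" if x: "0 < x" for x
  proof -
    define g1 where "g1 y = (if x < \<bar>real_of_int y\<bar> then \<bar>real_of_int y\<bar> / x else 0)" for y
    define g2 where "g2 y = (if \<bar>real_of_int y\<bar> \<le> x then (real_of_int y / x)\<^sup>2 else 0)" for y
    have 1: "integrable (measure_pmf D) g1 \<and> (\<integral>y. g1 y \<partial>measure_pmf D) \<le> (2 * C * x powr - \<beta>) * (1 / (1 - r))"
    proof (rule integrable_pmf_cover[where c="\<lambda>j. 2 ^ Suc j" and A="\<lambda>j. {y. 2 ^ j * x < \<bar>real_of_int y\<bar>}" and s="\<lambda>j. (2 * C * x powr - \<beta>) * r ^ j"])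
      fix y
      show "g1 y = 0 \<or> (\<exists>j. y \<in> {y. 2 ^ j * x < \<bar>real_of_int y\<bar>} \<and> g1 y \<le> 2 ^ Suc j)"
      proof (cases "x < \<bar>real_of_int y\<bar>")
        case True
        then obtain j where "2 ^ j < \<bar>real_of_int y\<bar> / x" "\<bar>real_of_int y\<bar> / x \<le> 2 ^ Suc j"
          using dyadic_above[of "\<bar>real_of_int y\<bar> / x"] x by auto
        then show ?thesis using True x by (auto simp: g1_def field_simps)
      qed (simp add: g1_def)
    next
      fix j
      have "2 ^ Suc j * measure_pmf.prob D {y. 2 ^ j * x < \<bar>real_of_int y\<bar>} \<le> 2 ^ Suc j * (C * (2 ^ j * x) powr - \<beta>)"
        using x by (intro mult_left_mono tail) auto
      also have "\<dots> = (2 * C * x powr - \<beta>) * (2 ^ j * (2 ^ j) powr - \<beta>)"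
        using x by (simp add: powr_mult)
      also have "2 ^ j * ((2::real) ^ j) powr - \<beta> = r ^ j"
      proof -
        have "2 ^ j * ((2::real) ^ j) powr - \<beta> = 2 powr real j * 2 powr (real j * - \<beta>)"
          by (simp add: powr_powr flip: powr_realpow)
        also have "\<dots> = r ^ j" unfolding r_def powr_add[symmetric]
          by (simp add: powr_powr algebra_simps flip: powr_realpow)
        finally show ?thesis .
      qed
      finally show "2 ^ Suc j * measure_pmf.prob D {y. 2 ^ j * x < \<bar>real_of_int y\<bar>} \<le> (2 * C * x powr - \<beta>) * r ^ j" .
    next
      show "(\<lambda>j. (2 * C * x powr - \<beta>) * r ^ j) sums ((2 * C * x powr - \<beta>) * (1 / (1 - r)))"
        using r by (intro sums_mult geometric_sums) auto
    qed (use x in \<open>auto simp: g1_def\<close>)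
    have 2: "integrable (measure_pmf D) g2 \<and> (\<integral>y. g2 y \<partial>measure_pmf D) \<le> (4 * 2 powr \<beta> * C * x powr - \<beta>) * (1 / (1 - q))"
    proof (rule integrable_pmf_cover[where c="\<lambda>j. 4 * (1/4) ^ j" and A="\<lambda>j. {y. x / 2 ^ Suc j < \<bar>real_of_int y\<bar>}" and s="\<lambda>j. (4 * 2 powr \<beta> * C * x powr - \<beta>) * q ^ j"])
      fix y
      show "g2 y = 0 \<or> (\<exists>j. y \<in> {y. x / 2 ^ Suc j < \<bar>real_of_int y\<bar>} \<and> g2 y \<le> 4 * (1/4) ^ j)"
      proof (cases "y \<noteq> 0 \<and> \<bar>real_of_int y\<bar> \<le> x")
        case True
        define b where "b = \<bar>real_of_int y\<bar>"
        have b: "0 < b" "b \<le> x" using True by (auto simp: b_def)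
        then have "1 < 2 * x / b" by (simp add: field_simps)
        then obtain j where j: "2 ^ j < 2 * x / b" "2 * x / b \<le> 2 ^ Suc j" by (rule dyadic_above)
        have "x / 2 ^ Suc j < b" using j b x by (simp add: field_simps)
        moreover have "b / x \<le> 2 * (1/2) ^ j" using j(1) b x by (simp add: power_one_over field_simps)
        then have "(b / x)\<^sup>2 \<le> (2 * (1/2) ^ j)\<^sup>2" using b x by (intro power_mono) auto
        moreover have "(2 * (1/2) ^ j)\<^sup>2 = 4 * (1/4 :: real) ^ j"
          by (simp add: power2_eq_square power_mult_distrib[symmetric])
        moreover have "g2 y = (b / x)\<^sup>2" using True by (simp add: g2_def b_def power_divide)
        ultimately show ?thesis by (auto simp: b_def)
      qed (auto simp: g2_def)
    next
      fix j
      have "4 * (1/4) ^ j * measure_pmf.prob D {y. x / 2 ^ Suc j < \<bar>real_of_int y\<bar>} \<le> 4 * (1/4) ^ j * (C * (x / 2 ^ Suc j) powr - \<beta>)"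
        using x by (intro mult_left_mono tail) auto
      also have "\<dots> = (4 * C * x powr - \<beta>) * ((1/4) ^ j * (2 ^ Suc j) powr \<beta>)"
        using x by (simp add: powr_divide powr_minus field_simps)
      also have "(1/4) ^ j * ((2::real) ^ Suc j) powr \<beta> = 2 powr \<beta> * q ^ j"
      proof -
        have "(1/4::real) ^ j = 2 powr (- 2 * real j)"
          by (simp add: powr_minus powr_powr[symmetric] power_one_over powr_realpow divide_simps flip: powr_realpow)
        moreover have "((2::real) ^ Suc j) powr \<beta> = 2 powr (real (Suc j) * \<beta>)"
          by (simp only: powr_powr flip: powr_realpow[of 2])
        moreover have "q ^ j = 2 powr ((\<beta> - 2) * real j)"
          by (simp add: q_def powr_powr flip: powr_realpow)
        ultimately show ?thesis
          by (simp add: algebra_simps flip: powr_add)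
      qed
      finally show "4 * (1/4) ^ j * measure_pmf.prob D {y. x / 2 ^ Suc j < \<bar>real_of_int y\<bar>} \<le> (4 * 2 powr \<beta> * C * x powr - \<beta>) * q ^ j"
        by (simp add: mult_ac)
    next
      show "(\<lambda>j. (4 * 2 powr \<beta> * C * x powr - \<beta>) * q ^ j) sums ((4 * 2 powr \<beta> * C * x powr - \<beta>) * (1 / (1 - q)))"
        using r by (intro sums_mult geometric_sums) auto
    qed (use x in \<open>auto simp: g2_def\<close>)
    have "(\<integral>y. min ((real_of_int y / x)\<^sup>2) (\<bar>real_of_int y\<bar> / x) \<partial>measure_pmf D) \<le> (\<integral>y. g1 y + g2 y \<partial>measure_pmf D)"
    proof (rule integral_mono')
      show "integrable (measure_pmf D) (\<lambda>y. g1 y + g2 y)" using 1 2 by simp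
      show "min ((real_of_int y / x)\<^sup>2) (\<bar>real_of_int y\<bar> / x) \<le> g1 y + g2 y" for y
        by (simp add: g1_def g2_def)
      show "0 \<le> g1 y + g2 y" for y using x by (simp add: g1_def g2_def)
    qed
    also have "\<dots> = (\<integral>y. g1 y \<partial>measure_pmf D) + (\<integral>y. g2 y \<partial>measure_pmf D)" using 1 2 by simp
    finally show ?thesis using 1 2 by (simp add: algebra_simps)
  qed
  then show ?thesis by blast
qed

section \<open>Positive moments and right tails from pointwise bounds\<close>

lemma sum_int_positive:
  fixes h :: "int \<Rightarrow> real"
  assumes "\<And>y. y \<le> 0 \<Longrightarrow> h y = 0"
  shows "(\<Sum>y\<in>{- int k..int k}. h y) = (\<Sum>n\<in>{1..k}. h (int n))"
proof -
  have "(\<Sum>y\<in>{- int k..int k}. h y) = (\<Sum>y\<in>{1..int k}. h y)"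
    using assms by (intro sum.mono_neutral_right) (auto simp: not_le)
  also have "{1..int k} = int ` {1..k}" by (simp add: image_int_atLeastAtMost)
  also have "(\<Sum>y\<in>int ` {1..k}. h y) = (\<Sum>n\<in>{1..k}. h (int n))" by (simp add: sum.reindex)
  finally show ?thesis .
qed

lemma incseq_symmetric_intervals: "incseq (\<lambda>k. {- int k..int k})"
  by (auto intro!: monoI)

lemma Union_symmetric_intervals: "(\<Union>k. {- int k..int k}) = UNIV"
proof -
  have "y \<in> {- int (nat \<bar>y\<bar>)..int (nat \<bar>y\<bar>)}" for y by (cases "0 \<le> y") auto
  then show ?thesis by blast
qed

lemma integrable_positive_powr:
  fixes D :: "int pmf"
  assumes C: "\<And>n. 1 \<le> n \<Longrightarrow> pmf D (int n) \<le> C * real n powr - a" and r: "r - a < - 1"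
  shows "integrable (measure_pmf D) (\<lambda>y. max 0 (real_of_int y) powr r)"
proof (rule integrable_pmf_exhaust(1)[OF _ incseq_symmetric_intervals Union_symmetric_intervals])
  have sm: "summable (\<lambda>n. C * real n powr (r - a))"
    using r by (intro summable_mult) (subst summable_real_powr_iff)
  have C0: "0 \<le> C" using C[of 1] by (simp add: order.trans[OF pmf_nonneg])
  show "(\<Sum>y\<in>{- int k..int k}. pmf D y * max 0 (real_of_int y) powr r) \<le> (\<Sum>n. C * real n powr (r - a))" for k
  proof -
    have "(\<Sum>y\<in>{- int k..int k}. pmf D y * max 0 (real_of_int y) powr r) = (\<Sum>n\<in>{1..k}. pmf D (int n) * max 0 (real_of_int (int n)) powr r)"
      by (rule sum_int_positive) simp
    also have "\<dots> \<le> (\<Sum>n\<in>{1..k}. C * real n powr (r - a))"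
    proof (rule sum_mono)
      fix n assume n: "n \<in> {1..k}"
      have "pmf D (int n) * real n powr r \<le> (C * real n powr - a) * real n powr r"
        using n by (intro mult_right_mono C) auto
      also have "\<dots> = C * real n powr (r - a)" using n by (simp add: powr_diff powr_minus divide_simps)
      finally show "pmf D (int n) * max 0 (real_of_int (int n)) powr r \<le> C * real n powr (r - a)" by simp
    qed
    also have "\<dots> \<le> (\<Sum>n. C * real n powr (r - a))"
      using C0 by (intro sum_le_suminf sm) auto
    finally show ?thesis .
  qed
qed auto

text \<open>The increment of \<open>- n powr (- b) / b\<close> dominates \<open>n powr (- b - 1)\<close>, so the tail sum telescopes.\<close>

lemma powr_le_increment:
  assumes b: "0 < b" and n: "1 \<le> n"
  shows "real (Suc n) powr (- b - 1) \<le> (real n powr - b - real (Suc n) powr - b) / b"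
proof -
  define m where "m = real (Suc n)"
  have m: "0 < m" "1 < m" using n by (simp_all add: m_def)
  have "ln (1 - 1 / m) \<le> - (1 / m)" using ln_le_minus_one[of "1 - 1 / m"] m by (simp add: field_simps)
  then have "b * (1 / m) \<le> b * - ln (1 - 1 / m)" using b by (intro mult_left_mono) auto
  then have "exp (b * (1 / m)) \<le> exp (- b * ln (1 - 1 / m))" by simp
  with exp_ge_add_one_self[of "b * (1 / m)"] have "1 + b * (1 / m) \<le> exp (- b * ln (1 - 1 / m))" by linarith
  then have "1 + b / m \<le> exp (- b * ln (1 - 1 / m))" by simp
  also have "\<dots> = (real n / m) powr - b"
    using n m by (simp add: powr_def m_def field_simps)
  also have "\<dots> = real n powr - b / m powr - b" using m by (simp add: powr_divide)
  finally have "(1 + b / m) * m powr - b \<le> real n powr - b" using m by (simp add: field_simps)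
  then have "b * (m powr - b / m) \<le> real n powr - b - m powr - b" by (simp add: algebra_simps)
  moreover have "m powr (- b - 1) = m powr - b / m" using m by (simp add: powr_diff)
  ultimately show ?thesis using b unfolding m_def[symmetric] by (simp add: field_simps)
qed

text \<open>Finite pieces of the tail telescope by \<open>powr_le_increment\<close>; the negative
  end term is dropped.\<close>

lemma right_tail_le:
  fixes D :: "int pmf"
  assumes b: "0 < b" and C: "\<And>n. 1 \<le> n \<Longrightarrow> pmf D (int n) \<le> C * real n powr (- b - 1)" and t: "1 \<le> t"
  shows "measure_pmf.prob D {y. int t < y} \<le> C / b * real t powr - b"
proof -
  have C0: "0 \<le> C" using C[of 1] by (simp add: order.trans[OF pmf_nonneg])
  have sum: "(\<Sum>n\<in>{t<..t+k}. pmf D (int n)) \<le> C / b * (real t powr - b - real (t + k) powr - b)" for k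
  proof (induction k)
    case (Suc k)
    have "{t<..t + Suc k} = insert (Suc (t + k)) {t<..t+k}" by auto
    then have "(\<Sum>n\<in>{t<..t+Suc k}. pmf D (int n)) = pmf D (int (Suc (t + k))) + (\<Sum>n\<in>{t<..t+k}. pmf D (int n))"
      by simp
    also have "\<dots> \<le> C * ((real (t + k) powr - b - real (Suc (t + k)) powr - b) / b)
        + C / b * (real t powr - b - real (t + k) powr - b)"
      using t by (intro add_mono Suc order.trans[OF C] mult_left_mono powr_le_increment b C0) auto
    also have "\<dots> = C / b * (real t powr - b - real (t + Suc k) powr - b)"
      using b by (simp add: field_simps)
    finally show ?case .
  qed simp
  have "(\<integral>y. indicator {y. int t < y} y \<partial>measure_pmf D) \<le> C / b * real t powr - b"
  proof (rule integrable_pmf_exhaust(2)[OF _ incseq_symmetric_intervals Union_symmetric_intervals])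
    fix k
    have "(\<Sum>y\<in>{- int k..int k}. pmf D y * indicator {y. int t < y} y) = (\<Sum>n\<in>{1..k}. pmf D (int n) * indicator {y. int t < y} (int n))"
      using t by (intro sum_int_positive) auto
    also have "\<dots> = (\<Sum>n\<in>{1..k} \<inter> {t<..}. pmf D (int n))"
      unfolding sum.inter_restrict[OF finite_atLeastAtMost] by (rule sum.cong) (auto simp: indicator_def)
    also have "\<dots> \<le> (\<Sum>n\<in>{t<..t+k}. pmf D (int n))"
      by (rule sum_mono2) auto
    also have "\<dots> \<le> C / b * (real t powr - b - real (t + k) powr - b)" by (rule sum)
    also have "\<dots> \<le> C / b * real t powr - b" using b C0 by (intro mult_left_mono) auto
    finally show "(\<Sum>y\<in>{- int k..int k}. pmf D y * indicator {y. int t < y} y) \<le> C / b * real t powr - b" .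
  qed auto
  then show ?thesis by simp
qed

text \<open>For small \<open>x\<close> the trivial bound 1 is at most
  \<open>(T' / x) powr b\<close>. For \<open>x\<close> above \<open>T' = T + 2\<close> the integer
  part of \<open>x\<close> is at least \<open>T\<close> and at least \<open>x / 2\<close>, which
  costs \<open>2 powr b\<close>.\<close>

lemma tail_le_powr_real:
  fixes D :: "int pmf"
  assumes b: "0 < b" and tail: "\<forall>\<^sub>F t in sequentially. measure_pmf.prob D {y. int t < \<bar>y\<bar>} \<le> C * real t powr - b"
  obtains C' where "0 \<le> C'" "\<And>x. 0 < x \<Longrightarrow> measure_pmf.prob D {y. x < \<bar>real_of_int y\<bar>} \<le> C' * x powr - b"
proof -
  obtain T where T: "\<And>t. t \<ge> T \<Longrightarrow> measure_pmf.prob D {y. int t < \<bar>y\<bar>} \<le> C * real t powr - b"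
    using tail by (auto simp: eventually_sequentially)
  define T' where "T' = real T + 2"
  have "measure_pmf.prob D {y. x < \<bar>real_of_int y\<bar>} \<le> (T' powr b + \<bar>C\<bar> * 2 powr b) * x powr - b" if x: "0 < x" for x
  proof (cases "x \<le> T'")
    case True
    have "measure_pmf.prob D {y. x < \<bar>real_of_int y\<bar>} \<le> 1" by simp
    also have "1 \<le> (T' / x) powr b" using True x b by (intro ge_one_powr_ge_zero) auto
    also have "\<dots> = T' powr b * x powr - b" using x by (simp add: T'_def powr_divide powr_minus field_simps)
    also have "\<dots> \<le> (T' powr b + \<bar>C\<bar> * 2 powr b) * x powr - b" by (intro mult_right_mono) auto
    finally show ?thesis .
  next
    case False
    define t where "t = nat \<lfloor>x\<rfloor>"
    have t: "real t \<le> x" "x < real t + 1" using x by (simp_all add: t_def)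
    then have "T \<le> t" using False by (simp add: T'_def)
    have "measure_pmf.prob D {y. x < \<bar>real_of_int y\<bar>} \<le> measure_pmf.prob D {y. int t < \<bar>y\<bar>}"
      using t by (intro measure_pmf.finite_measure_mono) auto
    also have "\<dots> \<le> C * real t powr - b" by (rule T[OF \<open>T \<le> t\<close>])
    also have "\<dots> \<le> \<bar>C\<bar> * (x / 2) powr - b"
      using t False b by (intro mult_mono powr_mono2') (auto simp: T'_def)
    also have "\<dots> = \<bar>C\<bar> * 2 powr b * x powr - b" using x by (simp add: powr_divide powr_minus field_simps)
    also have "\<dots> \<le> (T' powr b + \<bar>C\<bar> * 2 powr b) * x powr - b" by (intro mult_right_mono) auto
    finally show ?thesis .
  qed
  moreover have "0 \<le> T' powr b + \<bar>C\<bar> * 2 powr b" by simp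
  ultimately show ?thesis using that by blast
qed

text \<open>Potter's bound with its lower point fixed at \<open>X\<close>; arguments below
  \<open>X\<close> are covered by \<open>f t \<le> 1\<close>.\<close>

lemma regularly_varying_upper:
  fixes f :: "nat \<Rightarrow> real"
  assumes L: "slowly_varying L" and e: "0 < e" "e \<le> \<alpha>"
    and f: "\<And>t. 1 \<le> t \<Longrightarrow> f t = real t powr - \<alpha> * L (real t)" and f1: "\<And>t. f t \<le> 1"
  obtains C where "0 \<le> C" "\<And>t. 1 \<le> t \<Longrightarrow> f t \<le> C * real t powr - (\<alpha> - e)"
proof -
  obtain X where X: "0 < X" "\<And>x. X \<le> x \<Longrightarrow> 0 < L x"
    "\<And>x y. X \<le> x \<Longrightarrow> x \<le> y \<Longrightarrow> L y \<le> exp e * (y / x) powr e * L x"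
    using potter_bound[OF L e(1)] by metis
  define A where "A = X powr (\<alpha> - e)"
  define B where "B = exp e * (1 / X) powr e * L X"
  have AB: "0 \<le> A" "0 \<le> B" using X(2)[of X] by (simp_all add: A_def B_def)
  show ?thesis
  proof (rule that[of "A + B"])
    fix t :: nat assume t: "1 \<le> t"
    show "f t \<le> (A + B) * real t powr - (\<alpha> - e)"
    proof (cases "real t < X")
      case True
      have "f t \<le> 1" by (rule f1)
      also have "1 \<le> (X / t) powr (\<alpha> - e)" using True t e by (intro ge_one_powr_ge_zero) auto
      also have "\<dots> = A * real t powr - (\<alpha> - e)" using t X(1) by (simp add: A_def powr_divide powr_minus[of _ "\<alpha> - e"] field_simps del: minus_diff_eq)
      also have "\<dots> \<le> (A + B) * real t powr - (\<alpha> - e)" using AB by (intro mult_right_mono) auto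
      finally show ?thesis .
    next
      case False
      then have "f t \<le> real t powr - \<alpha> * (exp e * (t / X) powr e * L X)"
        unfolding f[OF t] using t X by (intro mult_left_mono) auto
      also have "(t / X) powr e = (1 / X) powr e * t powr e" using X t by (simp flip: powr_mult)
      also have "real t powr - \<alpha> * (exp e * ((1 / X) powr e * t powr e) * L X) = B * (real t powr - \<alpha> * real t powr e)"
        by (simp add: B_def)
      also have "real t powr - \<alpha> * real t powr e = real t powr - (\<alpha> - e)" by (simp flip: powr_add)
      also have "B * real t powr - (\<alpha> - e) \<le> (A + B) * real t powr - (\<alpha> - e)" using AB by (intro mult_right_mono) auto
      finally show ?thesis .
    qed
  qed (use AB in simp)
qed

text \<open>The moment order \<open>1 + (\<alpha> - 2) / 2\<close> is \<open>\<alpha> / 2\<close>,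
  below the critical order \<open>\<alpha> - 1\<close> because \<alpha> > 2. The exponent
  \<open>\<alpha> + 1\<close> leaves a full power of \<open>t\<close> to absorb a decay of
  \<open>L\<close>. Potter's bound with exponent 1/2 is enough throughout.\<close>

lemma big_jump_of_slowly_varying:
  assumes \<alpha>: "2 < \<alpha>" and L: "slowly_varying L"
    and f: "\<And>t. 1 \<le> t \<Longrightarrow> pmf D (int t) = real t powr - \<alpha> * L (real t)"
  shows "big_jump D (\<alpha> + 1) ((\<alpha> - 2) / 2)"
proof
  have f': "pmf D t = real_of_int t powr - \<alpha> * L (real_of_int t)" if "1 \<le> t" for t
    using f[of "nat t"] that by simp
  have top: "filterlim real_of_int at_top at_top" by (rule filterlim_real_of_int_at_top)
  show "0 < (\<alpha> - 2) / 2" "0 \<le> \<alpha> + 1" using \<alpha> by simp_all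
  obtain X where X: "0 < X" "\<And>x. X \<le> x \<Longrightarrow> 0 < L x"
    "\<And>x y. X \<le> x \<Longrightarrow> x \<le> y \<Longrightarrow> L y \<le> exp (1/2) * (y / x) powr (1/2) * L x"
    "\<And>x y. X \<le> x \<Longrightarrow> x \<le> y \<Longrightarrow> L x \<le> exp (1/2) * (y / x) powr (1/2) * L y"
    using potter_bound[OF L, of "1/2"] by (metis half_gt_zero_iff zero_less_one)
  show "((\<lambda>t. pmf D (t - y) / pmf D t) \<longlongrightarrow> 1) at_top" for y
  proof -
    have "((\<lambda>x::real. ((x - y) powr - \<alpha> / x powr - \<alpha>) * (L (x - y) / L x)) \<longlongrightarrow> 1 * 1) at_top"
      by (intro tendsto_mult slowly_varying_shift[OF L]) real_asymp
    then have "((\<lambda>x::real. ((x - y) powr - \<alpha> / x powr - \<alpha>) * (L (x - y) / L x)) \<longlongrightarrow> 1) at_top" by simp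
    from filterlim_compose[OF this top] show ?thesis
    proof (rule Lim_transform_eventually)
      show "\<forall>\<^sub>F t in at_top. ((real_of_int t - y) powr - \<alpha> / real_of_int t powr - \<alpha>) * (L (real_of_int t - y) / L (real_of_int t)) = pmf D (t - y) / pmf D t"
        using eventually_ge_at_top[of 1] eventually_ge_at_top[of "1 + y"]
        by eventually_elim (simp add: f')
    qed
  qed
  show "\<exists>C. \<forall>\<^sub>F t in at_top. \<forall>z. \<eta> * real_of_int t \<le> z \<longrightarrow> pmf D z \<le> C * pmf D t" if \<eta>: "0 < \<eta>" for \<eta>
  proof (intro exI)
    \<comment> \<open>The summand 1 serves \<open>z \<ge> t\<close>, where the power decay beats the
      growth of \<open>L\<close>; the other serves \<open>z\<close> between
      \<open>\<eta> * t\<close> and \<open>t\<close>.\<close>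
    define C where "C = exp (1/2) * (1 + \<eta> powr (- \<alpha> - 1/2))"
    have "\<forall>\<^sub>F t in at_top. max (X / \<eta>) (1 / \<eta>) \<le> real_of_int t" "\<forall>\<^sub>F t in at_top. X \<le> real_of_int t"
      by (rule eventually_compose_filterlim[OF eventually_ge_at_top top])+
    then show "\<forall>\<^sub>F t in at_top. \<forall>z. \<eta> * real_of_int t \<le> z \<longrightarrow> pmf D z \<le> C * pmf D t"
      using eventually_ge_at_top[of 1]
    proof eventually_elim
      case (elim t)
      show ?case
      proof (intro allI impI)
        fix z assume z: "\<eta> * real_of_int t \<le> real_of_int z"
        have z1: "X \<le> z" "1 \<le> real_of_int z" using elim(1) z \<eta> by (auto simp: field_simps)
        then have z1': "1 \<le> z" by simp
        have t0: "0 < real_of_int t" using elim by simp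
        have Lt: "0 < L t" using X(2) elim by simp
        show "pmf D z \<le> C * pmf D t"
        proof (cases "t \<le> z")
          case True
          have "pmf D z \<le> z powr - \<alpha> * (exp (1/2) * (z / t) powr (1/2) * L t)"
            unfolding f'[OF z1'] using X(3)[OF elim(2), of z] True by (intro mult_left_mono) auto
          also have "\<dots> = exp (1/2) * (t powr - \<alpha> * L t) * ((z / t) powr - \<alpha> * (z / t) powr (1/2))"
            using t0 z1 by (simp add: powr_divide)
          also have "(z / t) powr - \<alpha> * (z / t) powr (1/2) = (z / t) powr (1/2 - \<alpha>)"
            by (simp flip: powr_add)
          also have "\<dots> \<le> 1"
            using True t0 \<alpha> powr_mono[of "1/2 - \<alpha>" 0 "z / t"] by simp
          finally have "pmf D z \<le> exp (1/2) * pmf D t"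
            using Lt t0 elim(3) by (simp add: f' mult_left_mono)
          also have "\<dots> \<le> C * pmf D t" by (intro mult_right_mono) (simp_all add: C_def)
          finally show ?thesis .
        next
          case False
          have "pmf D z \<le> z powr - \<alpha> * (exp (1/2) * (t / z) powr (1/2) * L t)"
            unfolding f'[OF z1'] using X(4)[OF z1(1), of t] False by (intro mult_left_mono) auto
          also have "\<dots> = exp (1/2) * (t powr - \<alpha> * L t) * ((z / t) powr - \<alpha> * (z / t) powr - (1/2))"
            using t0 z1 by (simp add: powr_divide powr_minus field_simps)
          also have "(z / t) powr - \<alpha> * (z / t) powr - (1/2) = (z / t) powr (- \<alpha> - 1/2)"
            by (simp flip: powr_add)
          also have "\<dots> \<le> \<eta> powr (- \<alpha> - 1/2)"
            using \<eta> z t0 \<alpha> by (intro powr_mono2') (auto simp: field_simps)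
          finally have "pmf D z \<le> exp (1/2) * \<eta> powr (- \<alpha> - 1/2) * pmf D t"
            using Lt t0 elim(3) by (simp add: f' mult_left_mono mult_ac)
          also have "\<dots> \<le> C * pmf D t" by (intro mult_right_mono) (simp_all add: C_def algebra_simps)
          finally show ?thesis .
        qed
      qed
    qed
  qed
  show "\<forall>\<^sub>F t in at_top. real_of_int t powr - (\<alpha> + 1) \<le> pmf D t"
  proof -
    \<comment> \<open>Potter's bound from \<open>X\<close> gives
      \<open>L t \<ge> c * t powr - (1/2)\<close>, which eventually exceeds
      \<open>1 / t\<close>.\<close>
    define c where "c = L X * X powr (1/2) / exp (1/2)"
    have c: "0 < c" using X(1) X(2)[of X] by (simp add: c_def)
    have "((\<lambda>x::real. x powr - (1/2)) \<longlongrightarrow> 0) at_top" by real_asymp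
    from order_tendstoD(2)[OF this c]
    have "\<forall>\<^sub>F x::real in at_top. x powr - (1/2) < c" .
    then have "\<forall>\<^sub>F t in at_top. real_of_int t powr - (1/2) < c" "\<forall>\<^sub>F t in at_top. X \<le> real_of_int t"
      using eventually_compose_filterlim[OF _ top] eventually_ge_at_top by blast+
    then show ?thesis using eventually_ge_at_top[of 1]
    proof eventually_elim
      case (elim t)
      have t0: "0 < real_of_int t" using elim by simp
      have "L X \<le> exp (1/2) * (t / X) powr (1/2) * L t" using X(4)[OF order.refl elim(2)] .
      then have "c \<le> t powr (1/2) * L t" using X(1) t0 by (simp add: c_def powr_divide field_simps)
      then have "t powr - (1/2) \<le> t powr (1/2) * L t" using elim(1) by simp
      then have "t powr - (1/2) * t powr - (1/2) \<le> t powr - (1/2) * (t powr (1/2) * L t)" by (rule mult_left_mono) simp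
      moreover have "real_of_int t powr - (1/2) * real_of_int t powr - (1/2) = real_of_int t powr - 1"
        by (subst powr_add[symmetric]) simp
      moreover have "t powr - (1/2) * (t powr (1/2) * L t) = L t"
        using t0 by (simp add: powr_minus)
      ultimately have "t powr - 1 \<le> L t" by simp
      then have "t powr - \<alpha> * t powr - 1 \<le> t powr - \<alpha> * L t" by (rule mult_left_mono) simp
      then show ?case using elim(3) by (simp add: f' powr_diff)
    qed
  qed
  \<comment> \<open>Giving up \<open>(\<alpha> - 2) / 4\<close> of the index leaves the terms of the
    moment series of order \<open>-1 - (\<alpha> - 2) / 4\<close>, still summable.\<close>
  obtain C where "0 \<le> C" and C: "\<And>t. 1 \<le> t \<Longrightarrow> pmf D (int t) \<le> C * real t powr - (\<alpha> - (\<alpha> - 2) / 4)"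
    by (rule regularly_varying_upper[OF L _ _ f pmf_le_1, of "(\<alpha> - 2) / 4"]) (use \<alpha> in auto)
  show "integrable (measure_pmf D) (\<lambda>y. max 0 (real_of_int y) powr (1 + (\<alpha> - 2) / 2))"
    by (rule integrable_positive_powr[OF C]) (use \<alpha> in \<open>simp_all add: field_simps\<close>)
qed

lemma drift_walk_of_square_integrable:
  assumes "integrable (measure_pmf D) real_of_int" "(\<integral>y. real_of_int y \<partial>measure_pmf D) = \<mu>" "0 < \<mu>"
    and sq: "integrable (measure_pmf D) (\<lambda>y. (real_of_int y)\<^sup>2)"
  shows "\<exists>K. drift_walk D \<mu> 2 K"
proof (rule exI, unfold_locales)
  fix x :: real assume x: "0 < x"
  have "(\<integral>y. min ((real_of_int y / x)\<^sup>2) (\<bar>real_of_int y\<bar> / x) \<partial>measure_pmf D) \<le> (\<integral>y. (real_of_int y)\<^sup>2 * (1 / x\<^sup>2) \<partial>measure_pmf D)"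
    using sq x by (intro integral_mono') (auto simp: power_divide)
  also have "\<dots> = (\<integral>y. (real_of_int y)\<^sup>2 \<partial>measure_pmf D) * x powr - 2"
    using x by (simp add: powr_minus_divide)
  finally show "(\<integral>y. min ((real_of_int y / x)\<^sup>2) (\<bar>real_of_int y\<bar> / x) \<partial>measure_pmf D) \<le> (\<integral>y. (real_of_int y)\<^sup>2 \<partial>measure_pmf D) * x powr - 2" .
qed (use assms in auto)

lemma drift_walk_of_tail:
  assumes "integrable (measure_pmf D) real_of_int" "(\<integral>y. real_of_int y \<partial>measure_pmf D) = \<mu>" "0 < \<mu>"
    and beta: "1 < \<beta>" "\<beta> < 2"
    and tail: "\<forall>\<^sub>F t in sequentially. measure_pmf.prob D {y. int t < \<bar>y\<bar>} \<le> C * real t powr - \<beta>"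
  shows "\<exists>K. drift_walk D \<mu> \<beta> K"
proof -
  obtain C' where C': "0 \<le> C'" "\<And>x. 0 < x \<Longrightarrow> measure_pmf.prob D {y. x < \<bar>real_of_int y\<bar>} \<le> C' * x powr - \<beta>"
    by (rule tail_le_powr_real[OF _ tail]) (use beta in auto)
  obtain K where "\<And>x. 0 < x \<Longrightarrow> (\<integral>y. min ((real_of_int y / x)\<^sup>2) (\<bar>real_of_int y\<bar> / x) \<partial>measure_pmf D) \<le> K * x powr - \<beta>"
    using truncated_moment_of_tail[OF beta C'] by blast
  then show ?thesis using assms by (intro exI, unfold_locales) auto
qed

text \<open>The step law has tails of index \<open>\<alpha> - 1\<close> between 1 and 2: summing the
  density gives the right tail, and the finite limit \<open>l\<close> transfers its order to the
  left tail. A density equivalent to a power is \<open>t powr - \<alpha>\<close> times a function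
  with a positive limit, so it also fits the regularly varying framework.\<close>

lemma stable_case:
  assumes \<alpha>: "2 < \<alpha>" "\<alpha> < 3" and a: "0 < a"
    and f: "(\<lambda>t::nat. pmf D (int t)) \<sim>[at_top] (\<lambda>t. a * real t powr (-\<alpha>))"
    and left: "(\<lambda>t::nat. measure_pmf.prob D {y. y < - int t} / measure_pmf.prob D {y. int t < y}) \<longlonglongrightarrow> l"
    and mean: "integrable (measure_pmf D) real_of_int" "(\<integral>y. real_of_int y \<partial>measure_pmf D) = \<mu>" "0 < \<mu>"
  shows "\<exists>K. drift_walk D \<mu> (\<alpha> - 1) K" "\<exists>L. slowly_varying L \<and> (\<forall>t\<ge>1. pmf D (int t) = real t powr - \<alpha> * L (real t))"
    "\<forall>\<^sub>F t in sequentially. a / 2 * real t powr - \<alpha> \<le> pmf D (int t)"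
proof -
  define h where "h i = pmf D i * real_of_int i powr \<alpha>" for i
  have h_lim: "(\<lambda>t::nat. h (int t)) \<longlonglongrightarrow> a"
  proof -
    have "(\<lambda>t::nat. a * (pmf D (int t) / (a * real t powr (-\<alpha>)))) \<longlonglongrightarrow> a * 1"
      by (intro tendsto_mult tendsto_const asymp_equivD_strong[OF f])
         (use a in \<open>auto intro!: eventually_mono[OF eventually_gt_at_top[of 0]]\<close>)
    then have "(\<lambda>t::nat. a * (pmf D (int t) / (a * real t powr (-\<alpha>)))) \<longlonglongrightarrow> a" by simp
    then show ?thesis
    proof (rule Lim_transform_eventually)
      show "\<forall>\<^sub>F t in sequentially. a * (pmf D (int t) / (a * real t powr (-\<alpha>))) = h (int t)"
        using eventually_gt_at_top[of 0]
        by eventually_elim (use a in \<open>simp add: h_def powr_minus field_simps\<close>)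
    qed
  qed
  \<comment> \<open>Slow variation concerns functions on the reals; composing with the floor extends
    \<open>h\<close> without changing its values at integers.\<close>
  define L where "L x = h \<lfloor>x\<rfloor>" for x :: real
  have L_lim: "(L \<longlongrightarrow> a) at_top"
    unfolding L_def by (rule filterlim_compose[OF tendsto_int_at_top[OF h_lim] filterlim_floor_sequentially])
  have [measurable]: "L \<in> borel_measurable borel"
    unfolding L_def by measurable
  have "slowly_varying L"
    unfolding slowly_varying_def
  proof (intro conjI allI impI)
    show "\<forall>\<^sub>F x in at_top. 0 < L x" using order_tendstoD(1)[OF L_lim a] .
    fix c :: real assume c: "c > 0"
    then have "filterlim (\<lambda>x. c * x) at_top at_top"
      by (intro filterlim_tendsto_pos_mult_at_top[OF tendsto_const] filterlim_ident)
    from tendsto_divide[OF filterlim_compose[OF L_lim this] L_lim] a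
    show "((\<lambda>x. L (c * x) / L x) \<longlongrightarrow> 1) at_top" by simp
  qed measurable
  then show "\<exists>L. slowly_varying L \<and> (\<forall>t\<ge>1. pmf D (int t) = real t powr - \<alpha> * L (real t))"
    by (intro exI[of _ L]) (auto simp: L_def h_def powr_minus field_simps)
  have "\<forall>\<^sub>F t in sequentially. a / 2 < h (int t)" using h_lim a by (intro order_tendstoD(1)) auto
  then show lower: "\<forall>\<^sub>F t in sequentially. a / 2 * real t powr - \<alpha> \<le> pmf D (int t)"
    using eventually_gt_at_top[of 0]
    by eventually_elim (simp add: h_def powr_minus field_simps)
  have "bounded (range (\<lambda>t. h (int t)))" by (rule convergent_imp_bounded[OF h_lim])
  then obtain C where C: "\<And>t::nat. h (int t) \<le> C"
    unfolding bounded_iff by (metis abs_le_D1 rangeI real_norm_def)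
  have upper: "pmf D (int n) \<le> C * real n powr (- (\<alpha> - 1) - 1)" if "1 \<le> n" for n
    using C[of n] that by (simp add: h_def powr_minus field_simps)
  have right: "measure_pmf.prob D {y. int t < y} \<le> C / (\<alpha> - 1) * real t powr - (\<alpha> - 1)" if "1 \<le> t" for t
    by (rule right_tail_le[OF _ upper that]) (use \<alpha> in auto)
  have tail: "\<forall>\<^sub>F t in sequentially. measure_pmf.prob D {y. int t < \<bar>y\<bar>} \<le> ((\<bar>l\<bar> + 2) * (C / (\<alpha> - 1))) * real t powr - (\<alpha> - 1)"
  proof -
    have l: "l < \<bar>l\<bar> + 1" by simp
    \<comment> \<open>A right tail of probability 0 would make the quotient 0 and the limit
      uninformative; an atom at \<open>t + 1\<close> excludes this.\<close>
    have pos: "\<forall>\<^sub>F t in sequentially. 0 < pmf D (int t + 1)"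
    proof -
      have "\<forall>\<^sub>F t in sequentially. a / 2 * real (Suc t) powr - \<alpha> \<le> pmf D (int (Suc t))"
        using lower by (subst eventually_sequentially_Suc)
      then show ?thesis
      proof eventually_elim
        case (elim t)
        have "0 < a / 2 * real (Suc t) powr - \<alpha>" using a by simp
        then show ?case using elim by (simp add: add.commute)
      qed
    qed
    show ?thesis
      using order_tendstoD(2)[OF left l] pos eventually_ge_at_top[of 1]
    proof eventually_elim
      case (elim t)
      define R where "R = measure_pmf.prob D {y. int t < y}"
      have "pmf D (int t + 1) \<le> R"
        unfolding R_def measure_pmf_single[symmetric] by (intro measure_pmf.finite_measure_mono) auto
      then have R: "0 < R" using elim by simp
      then have lt: "measure_pmf.prob D {y. y < - int t} \<le> (\<bar>l\<bar> + 1) * R"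
        using elim(1) by (simp add: R_def field_simps)
      have "{y. int t < \<bar>y\<bar>} = {y. int t < y} \<union> {y. y < - int t}" by auto
      then have "measure_pmf.prob D {y. int t < \<bar>y\<bar>} \<le> R + measure_pmf.prob D {y. y < - int t}"
        unfolding R_def by (simp add: measure_Un_le)
      also have "\<dots> \<le> (\<bar>l\<bar> + 2) * R" using lt by (simp add: algebra_simps)
      also have "\<dots> \<le> (\<bar>l\<bar> + 2) * (C / (\<alpha> - 1) * real t powr - (\<alpha> - 1))"
        unfolding R_def by (intro mult_left_mono right elim) auto
      finally show ?case by (simp add: mult.assoc)
    qed
  qed
  show "\<exists>K. drift_walk D \<mu> (\<alpha> - 1) K"
    by (rule drift_walk_of_tail[OF mean _ _ tail]) (use \<alpha> in auto)
qed

text \<open>The square is split into three ranges: the far left by hypothesis, the positive axis by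
  the density bound with an index still above 3, and the bounded range between by a
  constant.\<close>

lemma finite_variance_case:
  assumes \<alpha>: "3 < \<alpha>" and L: "slowly_varying L"
    and f: "\<And>t::nat. 1 \<le> t \<Longrightarrow> pmf D (int t) = real t powr - \<alpha> * L (real t)"
    and left: "integrable (measure_pmf D) (\<lambda>y. indicator {y. y < - int T} y * (real_of_int y)\<^sup>2)"
    and mean: "integrable (measure_pmf D) real_of_int" "(\<integral>y. real_of_int y \<partial>measure_pmf D) = \<mu>" "0 < \<mu>"
  shows "\<exists>K. drift_walk D \<mu> 2 K"
proof (rule drift_walk_of_square_integrable[OF mean])
  obtain C where "0 \<le> C" and C: "\<And>t. 1 \<le> t \<Longrightarrow> pmf D (int t) \<le> C * real t powr - (\<alpha> - (\<alpha> - 3) / 2)"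
    by (rule regularly_varying_upper[OF L _ _ f pmf_le_1, of "(\<alpha> - 3) / 2"]) (use \<alpha> in auto)
  have right: "integrable (measure_pmf D) (\<lambda>y. max 0 (real_of_int y) powr 2)"
    by (rule integrable_positive_powr[OF C]) (use \<alpha> in \<open>auto simp: field_simps\<close>)
  show "integrable (measure_pmf D) (\<lambda>y. (real_of_int y)\<^sup>2)"
  proof (rule Bochner_Integration.integrable_bound)
    show "integrable (measure_pmf D) (\<lambda>y. indicator {y. y < - int T} y * (real_of_int y)\<^sup>2 + max 0 (real_of_int y) powr 2 + (real T)\<^sup>2)"
      using left right by simp
    show "AE y in measure_pmf D. norm ((real_of_int y)\<^sup>2) \<le> norm (indicator {y. y < - int T} y * (real_of_int y)\<^sup>2 + max 0 (real_of_int y) powr 2 + (real T)\<^sup>2)"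
    proof (rule AE_I2)
      fix y
      have "(real_of_int y)\<^sup>2 \<le> (real T)\<^sup>2" if "- int T \<le> y" "y \<le> 0"
      proof -
        have "\<bar>real_of_int y\<bar> \<le> \<bar>real T\<bar>" using that by simp
        then show ?thesis unfolding abs_le_square_iff .
      qed
      moreover have "max 0 (real_of_int y) powr 2 = (real_of_int y)\<^sup>2" if "y > 0"
        using that by simp
      ultimately show "norm ((real_of_int y)\<^sup>2) \<le> norm (indicator {y. y < - int T} y * (real_of_int y)\<^sup>2 + max 0 (real_of_int y) powr 2 + (real T)\<^sup>2)"
        by (cases "y > 0"; cases "y < - int T") (auto simp: not_less)
    qed
  qed simp
qed

section \<open>Local regularity of the number of summands\<close>

text \<open>Condition (R1) freed from its particular ratio: every bounded ratio of arguments is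
  allowed, at the price of a constant and a threshold depending on that ratio.\<close>

definition locally_comparable :: "(nat \<Rightarrow> real) \<Rightarrow> bool" where
  "locally_comparable p \<longleftrightarrow> (\<forall>K\<ge>1. \<exists>C\<ge>1. \<exists>A. \<forall>a\<ge>A. \<forall>b. a \<le> b \<and> real b \<le> K * real a \<longrightarrow> p b \<le> C * p a \<and> p a \<le> C * p b)"

text \<open>Chain (R1) along a geometric progression from \<open>a\<close> to \<open>b\<close>,
  multiplying the constants. Positivity comes from equal arguments, since a zero weight would give
  the quotient 0, below \<open>c2\<close>.\<close>

lemma locally_comparable_of_ratio:
  fixes p :: "nat \<Rightarrow> real"
  assumes p0: "\<And>n. 0 \<le> p n" and c: "1 < c1" "0 < c2" "0 < c3"
    and R: "\<And>t1 t2. 1 \<le> t1 \<Longrightarrow> 1 \<le> t2 \<Longrightarrow> 1 \<le> real t2 / real t1 \<Longrightarrow> real t2 / real t1 \<le> c1 \<Longrightarrow>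
       c2 \<le> p t2 / p t1 \<and> p t2 / p t1 \<le> c3"
  shows "\<And>n. 1 \<le> n \<Longrightarrow> 0 < p n" "locally_comparable p"
proof -
  show pos: "0 < p n" if "1 \<le> n" for n
  proof -
    have "c2 \<le> p n / p n" using R[of n n] that c by auto
    then have "p n \<noteq> 0" using c by auto
    then show ?thesis using p0[of n] by simp
  qed
  define C where "C = max 1 (max c3 (1 / c2))"
  have C: "1 \<le> C" "c3 \<le> C" "1 / c2 \<le> C" by (auto simp: C_def)
  \<comment> \<open>The points of the chain are integers, so a step by \<open>c1\<close> is rounded
    down. It still gains at least the factor \<open>r\<close> as soon as
    \<open>a * (c1 - 1) \<ge> 2\<close>, which is the origin of the threshold
    \<open>A\<close>.\<close>
  define r where "r = (1 + c1) / 2"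
  have r: "1 < r" "r < c1" using c by (simp_all add: r_def)
  define A where "A = nat \<lceil>2 / (c1 - 1)\<rceil> + 1"
  have one: "p b \<le> C * p a \<and> p a \<le> C * p b" if "1 \<le> a" "a \<le> b" "real b \<le> c1 * real a" for a b
  proof -
    have "1 \<le> real b / real a" "real b / real a \<le> c1" using that by (auto simp: field_simps)
    then have *: "c2 \<le> p b / p a" "p b / p a \<le> c3" using R[of a b] that by auto
    have pa: "0 < p a" "0 < p b" using pos that by auto
    have "p b \<le> c3 * p a" "p a \<le> (1 / c2) * p b" using * pa c by (auto simp: field_simps)
    moreover have "c3 * p a \<le> C * p a" "(1 / c2) * p b \<le> C * p b" using C pa by (intro mult_right_mono; simp)+
    ultimately show ?thesis by linarith
  qed
  have iter: "p b \<le> C ^ Suc k * p a \<and> p a \<le> C ^ Suc k * p b" if "A \<le> a" "a \<le> b" "real b \<le> r ^ k * real a" for a b k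
    using that
  proof (induction k arbitrary: a)
    case 0
    then have "a = b" by simp
    moreover have "p b * 1 \<le> p b * C" using C p0 by (intro mult_left_mono) auto
    ultimately show ?case by (simp add: mult.commute)
  next
    case (Suc k)
    have a1: "1 \<le> a" using Suc.prems(1) by (simp add: A_def)
    show ?case
    proof (cases "real b \<le> c1 * real a")
      case True
      have Ck: "1 \<le> C ^ Suc k" by (rule one_le_power[OF C(1)])
      have "C * p x \<le> C ^ Suc (Suc k) * p x" for x
        using mult_right_mono[OF mult_left_mono[OF Ck, of C] p0[of x]] C by simp
      then show ?thesis using one[OF a1 Suc.prems(2) True] by (meson order.trans)
    next
      case False
      define a' where "a' = nat \<lfloor>c1 * real a\<rfloor>"
      have a'_eq: "real a' = of_int \<lfloor>c1 * real a\<rfloor>" using c by (simp add: a'_def)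
      have a'_le: "real a' \<le> c1 * real a" "c1 * real a < real a' + 1" unfolding a'_eq by linarith+
      have "2 / (c1 - 1) \<le> real A" unfolding A_def by linarith
      then have "2 / (c1 - 1) \<le> real a" using Suc.prems(1) by simp
      then have "2 \<le> real a * (c1 - 1)" using c by (simp add: field_simps)
      then have ra: "r * real a \<le> real a'" using a'_le by (simp add: r_def field_simps)
      have "real a * 1 \<le> real a * r" using r by (intro mult_left_mono) auto
      then have aa': "a \<le> a'" using ra by (simp add: mult.commute)
      have a'b: "a' \<le> b" using a'_le False by simp
      have "real b \<le> r ^ k * (r * real a)" using Suc.prems(3) by (simp add: mult_ac)
      also have "\<dots> \<le> r ^ k * real a'" using ra r by (intro mult_left_mono) auto
      finally have IH: "p b \<le> C ^ Suc k * p a' \<and> p a' \<le> C ^ Suc k * p b"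
        using Suc.prems(1) aa' a'b by (intro Suc.IH) auto
      have s: "p a' \<le> C * p a \<and> p a \<le> C * p a'" by (rule one[OF a1 aa' a'_le(1)])
      have Cp: "0 \<le> C ^ Suc k" "0 \<le> C" using C by simp_all
      have "p b \<le> C ^ Suc k * (C * p a)" using IH mult_left_mono[OF conjunct1[OF s] Cp(1)] by linarith
      moreover have "p a \<le> C * (C ^ Suc k * p b)" using s mult_left_mono[OF conjunct2[OF IH] Cp(2)] by linarith
      ultimately show ?thesis by (simp add: mult_ac)
    qed
  qed
  show "locally_comparable p"
    unfolding locally_comparable_def
  proof (intro allI impI)
    fix K :: real assume "1 \<le> K"
    obtain k where k: "K < r ^ k" using real_arch_pow[OF r(1)] by blast
    show "\<exists>C\<ge>1. \<exists>A. \<forall>a\<ge>A. \<forall>b. a \<le> b \<and> real b \<le> K * real a \<longrightarrow> p b \<le> C * p a \<and> p a \<le> C * p b"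
    proof (intro exI conjI allI impI)
      show "1 \<le> C ^ Suc k" by (rule one_le_power[OF C(1)])
      fix a b assume a: "A \<le> a" and b: "a \<le> b \<and> real b \<le> K * real a"
      have "K * real a \<le> r ^ k * real a" using k by (intro mult_right_mono) auto
      then show "p b \<le> C ^ Suc k * p a" "p a \<le> C ^ Suc k * p b" using iter[OF a, of b k] b by auto
    qed
  qed
qed

text \<open>The form used later, with \<open>b\<close> on either side of \<open>a\<close>. If
  \<open>b < a\<close>, the smaller index is \<open>b\<close>; the enlarged threshold on
  \<open>a\<close> keeps it above \<open>A\<close>.\<close>

lemma locally_comparableE:
  assumes p: "locally_comparable p" and c: "0 < c" "0 < K"
  obtains C A where "1 \<le> C" "\<And>a b. A \<le> a \<Longrightarrow> c * real a \<le> real b \<Longrightarrow> real b \<le> K * real a \<Longrightarrow> p b \<le> C * p a"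
proof -
  define K' where "K' = max 1 (max K (1 / c))"
  have K': "1 \<le> K'" "K \<le> K'" "1 / c \<le> K'" by (auto simp: K'_def)
  obtain C A where C: "1 \<le> C" and A: "\<And>a b. A \<le> a \<Longrightarrow> a \<le> b \<Longrightarrow> real b \<le> K' * real a \<Longrightarrow> p b \<le> C * p a \<and> p a \<le> C * p b"
    using p K'(1) unfolding locally_comparable_def by blast
  show ?thesis
  proof (rule that[OF C])
    fix a b assume a: "max A (nat \<lceil>real A / c\<rceil>) \<le> a" and b: "c * real a \<le> real b" "real b \<le> K * real a"
    show "p b \<le> C * p a"
    proof (cases "a \<le> b")
      case True
      have "K * real a \<le> K' * real a" using K' by (intro mult_right_mono) auto
      then show ?thesis using A[of a b] a b True by auto
    next
      case False
      have "real A / c \<le> real a" using a by linarith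
      then have "A \<le> b" using b(1) c by (simp add: field_simps)
      moreover have "real a \<le> (1 / c) * real b" using b(1) c by (simp add: field_simps)
      moreover have "(1 / c) * real b \<le> K' * real b" using K' by (intro mult_right_mono) auto
      ultimately show ?thesis using A[of b a] False by auto
    qed
  qed
qed

definition locally_constant :: "real \<Rightarrow> (nat \<Rightarrow> real) \<Rightarrow> bool" where
  "locally_constant \<theta> p \<longleftrightarrow> (\<forall>e>0. \<forall>\<^sub>F t in sequentially. \<forall>s. \<bar>real t - real s\<bar> \<le> real t powr \<theta> \<longrightarrow> \<bar>p s - p t\<bar> \<le> e * p t)"

text \<open>(R2) bounds \<open>p t / p s\<close> from above only. The reverse bound comes from
  exchanging \<open>s\<close> and \<open>t\<close>, which requires \<open>t\<close> to lie in the
  window around \<open>s\<close>; the strict inequality \<theta> < \<kappa> absorbs the change of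
  the window size.\<close>

lemma locally_constant_of_ratio:
  fixes p :: "nat \<Rightarrow> real"
  assumes pos: "\<And>n. 1 \<le> n \<Longrightarrow> 0 < p n" and \<theta>: "0 < \<theta>" "\<theta> < \<kappa>" "\<theta> < 1"
    and lim: "(\<lambda>t::nat. SUP s\<in>{s::nat. s \<ge> 1 \<and> \<bar>real t - real s\<bar> \<le> real t powr \<kappa>}. p t / p s) \<longlonglongrightarrow> 1"
  shows "locally_constant \<theta> p"
  unfolding locally_constant_def
proof (intro allI impI)
  fix e :: real assume e: "0 < e"
  define d where "d = min 1 (e / 2)"
  have d: "0 < d" "d \<le> 1" "2 * d \<le> e" using e by (auto simp: d_def)
  define S where "S t = {s::nat. s \<ge> 1 \<and> \<bar>real t - real s\<bar> \<le> real t powr \<kappa>}" for t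
  have fin: "finite (S t)" for t
  proof (rule finite_subset)
    show "S t \<subseteq> {..nat \<lceil>real t + real t powr \<kappa>\<rceil>}"
    proof
      fix s assume "s \<in> S t"
      then have "real s \<le> real t + real t powr \<kappa>" by (auto simp: S_def)
      then show "s \<in> {..nat \<lceil>real t + real t powr \<kappa>\<rceil>}" by simp linarith
    qed
  qed simp
  have "\<forall>\<^sub>F t in sequentially. (SUP s\<in>S t. p t / p s) < 1 + d"
    unfolding S_def using lim d by (intro order_tendstoD(2)) auto
  then obtain A where A: "\<And>t. A \<le> t \<Longrightarrow> (SUP s\<in>S t. p t / p s) < 1 + d"
    by (auto simp: eventually_sequentially)
  have ratio: "p t \<le> (1 + d) * p s" if "A \<le> t" "s \<in> S t" for t s
  proof -
    have "p t / p s \<le> (SUP s\<in>S t. p t / p s)"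
      using fin that by (intro cSUP_upper bdd_above_finite) auto
    also have "\<dots> < 1 + d" by (rule A[OF that(1)])
    finally show ?thesis using pos[of s] that by (simp add: S_def field_simps)
  qed
  have half: "\<forall>\<^sub>F t::nat in sequentially. real t powr \<theta> \<le> real t / 2"
    using \<theta> by real_asymp
  have "\<forall>\<^sub>F t::nat in sequentially. 2 powr \<theta> * real t powr \<theta> \<le> real t powr \<kappa>"
    using \<theta> by real_asymp
  then obtain A2 where A2: "\<And>t. A2 \<le> t \<Longrightarrow> 2 powr \<theta> * real t powr \<theta> \<le> real t powr \<kappa>"
    by (auto simp: eventually_sequentially)
  show "\<forall>\<^sub>F t in sequentially. \<forall>s. \<bar>real t - real s\<bar> \<le> real t powr \<theta> \<longrightarrow> \<bar>p s - p t\<bar> \<le> e * p t"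
    using half eventually_ge_at_top[of "2 * (A + A2 + 1)"]
  proof eventually_elim
    case (elim t)
    show ?case
    proof (intro allI impI)
      fix s assume s: "\<bar>real t - real s\<bar> \<le> real t powr \<theta>"
      have s2: "real t / 2 \<le> real s" using s elim(1) by linarith
      have "real (2 * (A + A2 + 1)) \<le> real t" using elim(2) by (simp only: of_nat_le_iff)
      then have s3: "A \<le> s" "A2 \<le> s" "1 \<le> s" using s2 by simp_all
      have t3: "A \<le> t" "1 \<le> t" using elim(2) by simp_all
      have "real t powr \<theta> \<le> real t powr \<kappa>" using t3 \<theta> by (intro powr_mono) auto
      then have "s \<in> S t" using s s3 by (simp add: S_def)
      have "real t powr \<theta> \<le> (2 * real s) powr \<theta>" using s2 \<theta> by (intro powr_mono2) auto
      also have "\<dots> \<le> real s powr \<kappa>" using A2[OF s3(2)] by (simp add: powr_mult)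
      finally have "t \<in> S s" using s t3 by (simp add: S_def abs_minus_commute)
      have "p t \<le> (1 + d) * p s" by (rule ratio[OF t3(1) \<open>s \<in> S t\<close>])
      moreover have ps: "p s \<le> (1 + d) * p t" by (rule ratio[OF s3(1) \<open>t \<in> S s\<close>])
      moreover have "d * p s \<le> d * (2 * p t)"
      proof (rule mult_left_mono)
        have "(1 + d) * p t \<le> 2 * p t" using d pos[OF t3(2)] by (intro mult_right_mono) auto
        then show "p s \<le> 2 * p t" using ps by linarith
      qed (use d in simp)
      moreover have "2 * d * p t \<le> e * p t" "d * p t \<le> 2 * d * p t"
        using d pos[OF t3(2)] by (intro mult_right_mono; simp)+
      ultimately show "\<bar>p s - p t\<bar> \<le> e * p t" by (simp add: abs_le_iff algebra_simps)
    qed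
  qed
qed

section \<open>Compound walks\<close>

lemma filterlim_nat_floor_divide:
  assumes "0 < (\<mu>::real)"
  shows "filterlim (\<lambda>t::nat. nat \<lfloor>real t / \<mu>\<rfloor>) at_top sequentially"
proof -
  have "filterlim (\<lambda>t::nat. real t / \<mu>) at_top sequentially"
    using assms by real_asymp
  from filterlim_compose[OF filterlim_floor_sequentially this]
  have "filterlim (\<lambda>t::nat. \<lfloor>real t / \<mu>\<rfloor>) at_top sequentially" .
  then show ?thesis by (rule filterlim_compose[OF filterlim_nat_sequentially])
qed

text \<open>\<theta> is the exponent of the window around \<open>t / \<mu>\<close>: above
  \<open>1 / \<beta>\<close>, so that few visits fall outside it, and below 1, so that the window is
  short compared with its centre.\<close>

locale compound_walk = drift_walk D \<mu> \<beta> K + big_jump D c0 \<epsilon>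
  for D and \<mu> \<beta> K c0 \<epsilon> :: real +
  fixes PN :: "nat pmf" and \<theta> :: real
  assumes comparable: "locally_comparable (pmf PN)"
    and pos_N: "\<And>n. 1 \<le> n \<Longrightarrow> 0 < pmf PN n"
    and theta: "1 / \<beta> < \<theta>" "\<theta> < 1"
    and loc_const: "locally_constant \<theta> (pmf PN)"
begin

definition tau :: "nat \<Rightarrow> nat" where "tau t = nat \<lfloor>real t / \<mu>\<rfloor>"

lemma tau_bounds: "tau t * \<mu> \<le> t" "t < (tau t + 1) * \<mu>"
proof -
  have "0 \<le> real t / \<mu>" using mu_pos by simp
  then have eq: "real (tau t) = of_int \<lfloor>real t / \<mu>\<rfloor>" by (simp add: tau_def)
  have "real (tau t) \<le> real t / \<mu>" "real t / \<mu> < real (tau t) + 1" unfolding eq by linarith+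
  then show "tau t * \<mu> \<le> t" "t < (tau t + 1) * \<mu>" using mu_pos by (simp_all add: field_simps)
qed

lemma tau_at_top: "filterlim tau at_top sequentially"
  unfolding tau_def by (rule filterlim_nat_floor_divide[OF mu_pos])

lemma eventually_tau: "eventually P sequentially \<Longrightarrow> \<forall>\<^sub>F t in sequentially. P (tau t)"
  by (rule eventually_compose_filterlim[OF _ tau_at_top])

lemma visits_limit: "(\<lambda>t. visits (int t)) \<longlonglongrightarrow> 1 / \<mu>"
proof -
  obtain Z where Z: "\<And>t. Z \<le> t \<Longrightarrow> 0 < pmf D t"
    using pmf_pos by (auto simp: eventually_at_top_linorder)
  from filterlim_compose[OF renewal[OF Z[of Z] Z[of "Z + 1"]] filterlim_int_sequentially]
  show ?thesis by simp
qed

text \<open>Bounds the expected visits to \<open>t\<close> outside the window when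
  \<open>n = tau t\<close>. The distance is \<open>x = \<mu> * n powr \<theta> / 2\<close>, and
  \<open>3 * n + 2\<close> bounds \<open>a + m\<close> with \<open>a \<le> n\<close> and
  \<open>m = 2 * n + 2\<close>. Later epochs than \<open>m\<close> are left to
  \<open>tail_bound\<close>.\<close>

definition err :: "nat \<Rightarrow> real" where
  "err n = off_const * (3 * real n + 2) * (\<mu> * real n powr \<theta> / 2) powr - \<beta> + tail_bound (2 * n + 2)"

lemma err_tendsto_0: "err \<longlonglongrightarrow> 0"
proof -
  define q where "q = \<theta> * \<beta>"
  have q: "1 < q" using theta(1) beta_gt_1 by (simp add: q_def field_simps)
  have "filterlim (\<lambda>n::nat. 2 * n + 2) at_top sequentially"
    by (rule filterlim_at_top_mono[OF filterlim_ident]) auto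
  from filterlim_compose[OF tail_bound_tendsto_0 this]
  have tb: "(\<lambda>n. tail_bound (2 * n + 2)) \<longlonglongrightarrow> 0" .
  have "(\<lambda>n::nat. (3 * real n + 2) * real n powr - q) \<longlonglongrightarrow> 0" using q by real_asymp
  then have "(\<lambda>n::nat. (off_const * (\<mu> / 2) powr - \<beta>) * ((3 * real n + 2) * real n powr - q)) \<longlonglongrightarrow> (off_const * (\<mu> / 2) powr - \<beta>) * 0"
    by (intro tendsto_mult tendsto_const)
  then have "(\<lambda>n::nat. (off_const * (\<mu> / 2) powr - \<beta>) * ((3 * real n + 2) * real n powr - q)) \<longlonglongrightarrow> 0"
    by (simp only: mult_zero_right)
  then have "(\<lambda>n::nat. off_const * (3 * real n + 2) * (\<mu> * real n powr \<theta> / 2) powr - \<beta>) \<longlonglongrightarrow> 0"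
  proof (rule Lim_transform_eventually)
    show "\<forall>\<^sub>F n::nat in sequentially. off_const * (\<mu> / 2) powr - \<beta> * ((3 * real n + 2) * real n powr - q) = off_const * (3 * real n + 2) * (\<mu> * real n powr \<theta> / 2) powr - \<beta>"
    proof (intro always_eventually allI)
      fix n :: nat
      have "(\<mu> * real n powr \<theta> / 2) powr - \<beta> = (\<mu> / 2) powr - \<beta> * real n powr - q"
        using mu_pos powr_mult[of "\<mu> / 2" "real n powr \<theta>" "- \<beta>"] by (simp add: q_def powr_powr)
      then show "off_const * (\<mu> / 2) powr - \<beta> * ((3 * real n + 2) * real n powr - q) = off_const * (3 * real n + 2) * (\<mu> * real n powr \<theta> / 2) powr - \<beta>"
        by simp
    qed
  qed
  from tendsto_add[OF this tb] show ?thesis by (simp add: err_def[abs_def])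
qed

definition middle :: "real \<Rightarrow> nat \<Rightarrow> nat set" where
  "middle \<delta> t = {n. \<delta> * real t < real n \<and> n < 2 * tau t + 2}"

lemma finite_middle: "finite (middle \<delta> t)"
  by (rule finite_subset[of _ "{..<2 * tau t + 2}"]) (auto simp: middle_def)

text \<open>Only the window \<open>\<bar>n - tau t\<bar> \<le> tau t powr \<theta>\<close> contributes to the middle range: there \<open>pmf PN\<close> is
  nearly constant and the renewal theorem applies, while all other epochs together are visited
  \<open>o(1)\<close> times.\<close>

lemma middle_sum:
  assumes \<delta>: "0 < \<delta>" "\<delta> * \<mu> \<le> 1 / 4"
  shows "(\<lambda>t. (\<Sum>n\<in>middle \<delta> t. pmf PN n * pmf (walk D n) (int t)) - pmf PN (tau t) / \<mu>) \<in> o(\<lambda>t. pmf PN (tau t))"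
proof (rule landau_o.smallI)
  fix e :: real assume e: "0 < e"
  define G where "G = 2 * green_sup"
  have G: "2 \<le> G" using green_sup_ge_1 by (simp add: G_def)
  \<comment> \<open>In the middle range \<open>n / tau t\<close> stays between
    \<open>\<delta> * \<mu>\<close> and 4, so each weight is at most a constant multiple of the
    weight at \<open>tau t\<close>.\<close>
  obtain C A where C: "1 \<le> C" and A: "\<And>a b. A \<le> a \<Longrightarrow> \<delta> * \<mu> * real a \<le> real b \<Longrightarrow> real b \<le> 4 * real a \<Longrightarrow> pmf PN b \<le> C * pmf PN a"
    by (rule locally_comparableE[OF comparable, of "\<delta> * \<mu>" 4]) (use \<delta> mu_pos in auto)
  define e1 where "e1 = e / (2 * (G + 1))"
  define e2 where "e2 = e / (2 * (1 + C))"
  have e1: "0 < e1" "e1 * (G + 1) = e / 2" and e2: "0 < e2" "(1 + C) * e2 = e / 2"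
    using e G C by (auto simp: e1_def e2_def divide_simps)
  have "\<forall>\<^sub>F n in sequentially. \<forall>s. \<bar>real n - real s\<bar> \<le> real n powr \<theta> \<longrightarrow> \<bar>pmf PN s - pmf PN n\<bar> \<le> e1 * pmf PN n"
    using loc_const e1 unfolding locally_constant_def by blast
  moreover have "\<forall>\<^sub>F n in sequentially. err n < e2"
    using err_tendsto_0 e2 by (intro order_tendstoD(2)) auto
  moreover have "\<forall>\<^sub>F n::nat in sequentially. 4 \<le> real n powr \<theta>"
    using theta beta_gt_1 less_trans[of 0 "1 / \<beta>" \<theta>] by real_asymp
  moreover have "\<forall>\<^sub>F n::nat in sequentially. real n powr \<theta> \<le> real n / 2"
    using theta by real_asymp
  ultimately have "\<forall>\<^sub>F n in sequentially. (\<forall>s. \<bar>real n - real s\<bar> \<le> real n powr \<theta> \<longrightarrow> \<bar>pmf PN s - pmf PN n\<bar> \<le> e1 * pmf PN n)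
      \<and> err n < e2 \<and> 4 \<le> real n powr \<theta> \<and> real n powr \<theta> \<le> real n / 2 \<and> A \<le> n \<and> 2 \<le> n"
    using eventually_ge_at_top[of A] eventually_ge_at_top[of 2] by eventually_elim blast
  note ev = eventually_tau[OF this]
  have "\<forall>\<^sub>F t in sequentially. dist (visits (int t)) (1 / \<mu>) < e1"
    using visits_limit e1(1) by (rule tendstoD)
  with ev show "\<forall>\<^sub>F t in sequentially. norm ((\<Sum>n\<in>middle \<delta> t. pmf PN n * pmf (walk D n) (int t)) - pmf PN (tau t) / \<mu>) \<le> e * norm (pmf PN (tau t))"
  proof eventually_elim
    case (elim t)
    define T where "T = tau t"
    define w where "w = real T powr \<theta>"
    define p where "p = pmf PN"
    define q where "q n = pmf (walk D n) (int t)" for n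
    have loc: "\<And>s. \<bar>real T - real s\<bar> \<le> w \<Longrightarrow> \<bar>p s - p T\<bar> \<le> e1 * p T" and er: "err T < e2"
      and w: "4 \<le> w" "w \<le> real T / 2" and T: "A \<le> T" "2 \<le> T"
      using elim(1) by (auto simp: T_def w_def p_def)
    have u: "\<bar>visits (int t) - 1 / \<mu>\<bar> < e1" using elim(2) by (simp add: dist_real_def)
    have pT: "0 < p T" using pos_N T by (simp add: p_def)
    have q0: "0 \<le> q n" for n by (simp add: q_def)
    define a where "a = nat \<lceil>real T - w\<rceil>"
    define b where "b = nat \<lfloor>real T + w\<rfloor>"
    have a: "real T - w \<le> real a" "real a < real T - w + 1" and b: "real b \<le> real T + w" "real T + w - 1 < real b"
      using w by (simp_all add: a_def b_def) linarith+
    have W: "n \<in> {a..b} \<longleftrightarrow> \<bar>real T - real n\<bar> \<le> w" for n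
    proof -
      have "a \<le> n \<longleftrightarrow> real T - w \<le> real n" unfolding a_def using w by (auto simp: ceiling_le_iff nat_le_iff)
      moreover have "n \<le> b \<longleftrightarrow> real n \<le> real T + w"
      proof -
        have "0 \<le> \<lfloor>real T + w\<rfloor>" using w by simp
        then show ?thesis unfolding b_def by (simp only: le_nat_iff le_floor_iff of_int_of_nat_eq)
      qed
      ultimately show ?thesis by auto
    qed
    note tb = tau_bounds[of t, folded T_def]
    \<comment> \<open>Rounding the window ends costs less than 1 each, and \<open>t\<close> may
      exceed \<open>T * \<mu>\<close> by almost \<open>\<mu>\<close>. With \<open>w \<ge> 4\<close>
      a distance of \<open>\<mu> * w / 2\<close> remains on both sides.\<close>
    have t1: "real a * \<mu> + \<mu> * w / 2 \<le> real_of_int (int t)"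
    proof -
      have "(real a + w / 2) * \<mu> \<le> real T * \<mu>" using a w mu_pos by (intro mult_right_mono) auto
      then show ?thesis using tb(1) by (simp add: algebra_simps)
    qed
    have t2: "real_of_int (int t) \<le> real b * \<mu> - \<mu> * w / 2"
    proof -
      have "(real T + 1) * \<mu> \<le> (real b - w / 2) * \<mu>" using b w mu_pos by (intro mult_right_mono) auto
      then show ?thesis using tb(2) by (simp add: algebra_simps)
    qed
    have t3: "real_of_int (int t) \<le> real (2 * T + 2) * \<mu> / 2" using tb(2) by (simp add: algebra_simps)
    have out: "(\<Sum>n\<in>B. q n) \<le> err T" if B: "finite B" "B \<inter> {a..b} = {}" for B
    proof -
      have "(\<Sum>n\<in>B. q n) \<le> off_const * (real a + real (2 * T + 2)) * (\<mu> * w / 2) powr - \<beta> + tail_bound (2 * T + 2)"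
        unfolding q_def using w mu_pos by (intro sum_visits_outside_le[OF _ _ t1 t2 t3 B]) auto
      also have "\<dots> \<le> off_const * (3 * real T + 2) * (\<mu> * w / 2) powr - \<beta> + tail_bound (2 * T + 2)"
        using a w off_const_nonneg by (intro add_right_mono mult_right_mono mult_left_mono) auto
      finally show ?thesis by (simp add: err_def w_def)
    qed
    define N where "N = middle \<delta> t"
    have fin: "finite N" by (simp add: N_def finite_middle)
    \<comment> \<open>The bound \<open>\<delta> * \<mu> \<le> 1 / 4\<close> puts the lower end of
      the middle range below half of \<open>T\<close>, hence below the window.\<close>
    have dt: "\<delta> * real t < real T / 2"
    proof -
      have "\<delta> * real t \<le> \<delta> * ((real T + 1) * \<mu>)" using tb(2) \<delta> by (intro mult_left_mono) (auto simp: add.commute)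
      also have "\<dots> = (\<delta> * \<mu>) * (real T + 1)" by simp
      also have "\<dots> \<le> 1 / 4 * (real T + 1)" using \<delta> by (intro mult_right_mono) auto
      finally show ?thesis using T by simp
    qed
    have sub: "{a..b} \<subseteq> N"
    proof
      fix n assume "n \<in> {a..b}"
      then have "\<bar>real T - real n\<bar> \<le> w" using W by blast
      then have n: "real T / 2 \<le> real n" "real n < real (2 * T + 2)" using w by auto
      then have "n < 2 * T + 2" by (simp only: of_nat_less_iff)
      then show "n \<in> N" using n dt by (simp add: N_def middle_def T_def)
    qed
    have pN: "p n \<le> C * p T" if "n \<in> N" for n
      unfolding p_def
    proof (rule A[OF T(1)])
      have "\<delta> * \<mu> * real T \<le> \<delta> * real t" using tb(1) \<delta> by (simp add: mult_ac mult_left_mono)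
      then show "\<delta> * \<mu> * real T \<le> real n" using that by (simp add: N_def middle_def)
      have "n < 2 * T + 2" using that by (simp add: N_def middle_def T_def)
      then show "real n \<le> 4 * real T" using T by simp
    qed
    define s where "s = (\<Sum>n\<in>{a..b}. q n)"
    have s_le: "s \<le> visits (int t)"
      unfolding s_def q_def visits_def by (rule sum_le_suminf[OF summable_visits]) auto
    have s_ge: "visits (int t) \<le> s + err T"
      unfolding s_def q_def by (rule visits_minus_sum_le) (use out in \<open>auto simp: q_def\<close>)
    have s0: "0 \<le> s" "s \<le> G" using s_le visits_bound[of "int t"] q0 by (auto simp: s_def G_def sum_nonneg)
    have split: "(\<Sum>n\<in>N. p n * q n) = (\<Sum>n\<in>{a..b}. p n * q n) + (\<Sum>n\<in>N - {a..b}. p n * q n)"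
      using sum.subset_diff[OF sub fin, of "\<lambda>n. p n * q n"] by simp
    have rest0: "0 \<le> (\<Sum>n\<in>N - {a..b}. p n * q n)" by (intro sum_nonneg) (simp add: p_def q0)
    have rest: "(\<Sum>n\<in>N - {a..b}. p n * q n) \<le> p T * (C * e2)"
    proof -
      have "(\<Sum>n\<in>N - {a..b}. p n * q n) \<le> (\<Sum>n\<in>N - {a..b}. C * p T * q n)"
        using q0 pN by (intro sum_mono mult_right_mono) auto
      also have "\<dots> = C * p T * (\<Sum>n\<in>N - {a..b}. q n)" by (simp add: sum_distrib_left)
      also have "\<dots> \<le> C * p T * e2"
        using order.trans[OF out less_imp_le[OF er], of "N - {a..b}"] fin C pT
        by (intro mult_left_mono) (auto simp: Int_Diff)
      finally show ?thesis by (simp add: mult_ac)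
    qed
    have win: "\<bar>(\<Sum>n\<in>{a..b}. p n * q n) - p T * s\<bar> \<le> p T * (e1 * G)"
    proof -
      have "(\<Sum>n\<in>{a..b}. p n * q n) - p T * s = (\<Sum>n\<in>{a..b}. (p n - p T) * q n)"
        by (simp add: s_def sum_distrib_left left_diff_distrib sum_subtractf)
      also have "\<bar>\<dots>\<bar> \<le> (\<Sum>n\<in>{a..b}. \<bar>(p n - p T) * q n\<bar>)" by (rule sum_abs)
      also have "\<dots> \<le> (\<Sum>n\<in>{a..b}. (e1 * p T) * q n)"
      proof (rule sum_mono)
        fix n assume "n \<in> {a..b}"
        then have "\<bar>p n - p T\<bar> \<le> e1 * p T" using W loc by blast
        then show "\<bar>(p n - p T) * q n\<bar> \<le> (e1 * p T) * q n"
          using q0[of n] by (simp add: abs_mult mult_right_mono)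
      qed
      also have "\<dots> = (e1 * p T) * s" by (simp add: s_def sum_distrib_left)
      also have "\<dots> \<le> (e1 * p T) * G" using s0 e1 pT by (intro mult_left_mono) auto
      finally show ?thesis by (simp add: mult_ac)
    qed
    have "\<bar>s - 1 / \<mu>\<bar> \<le> e1 + e2" using s_le s_ge u er e2 by linarith
    then have "p T * \<bar>s - 1 / \<mu>\<bar> \<le> p T * (e1 + e2)" using pT by (intro mult_left_mono) auto
    moreover have "p T * s - p T / \<mu> = p T * (s - 1 / \<mu>)" by (simp add: right_diff_distrib)
    ultimately have mid: "\<bar>p T * s - p T / \<mu>\<bar> \<le> p T * (e1 + e2)"
      using pT by (simp only: abs_mult)
    have "\<bar>(\<Sum>n\<in>N. p n * q n) - p T / \<mu>\<bar> \<le> p T * (e1 * G) + p T * (e1 + e2) + p T * (C * e2)"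
      unfolding split using rest0 rest win mid by linarith
    also have "\<dots> = p T * (e1 * (G + 1) + (1 + C) * e2)" by (simp add: algebra_simps)
    also have "\<dots> = e * p T" by (simp add: e1 e2)
    finally show ?case using pT by (simp add: N_def p_def q_def T_def)
  qed
qed

end

section \<open>Regularly varying weights\<close>

lemma sum_pmf_le_integral:
  fixes g :: "'b \<Rightarrow> real"
  assumes "finite F" "integrable (measure_pmf P) g" "\<And>n. 0 \<le> g n"
  shows "(\<Sum>n\<in>F. pmf P n * g n) \<le> (\<integral>n. g n \<partial>measure_pmf P)"
proof -
  have "(\<Sum>n\<in>F. pmf P n * g n) = (\<integral>n. indicator F n * g n \<partial>measure_pmf P)"
    using integral_measure_pmf[OF assms(1), of P "\<lambda>n. indicator F n * g n"] by (simp add: indicator_def)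
  also have "\<dots> \<le> (\<integral>n. g n \<partial>measure_pmf P)"
    using assms by (intro integral_mono') (auto simp: indicator_def)
  finally show ?thesis .
qed

text \<open>Potter's bound with exponent \<gamma> itself: the possible growth of \<open>L\<close>
  cancels the decay of the power, and only the constant remains.\<close>

lemma regularly_varying_almost_decreasing:
  fixes p :: "nat \<Rightarrow> real"
  assumes L: "slowly_varying L" and \<gamma>: "0 < \<gamma>"
    and p: "\<And>t. 1 \<le> t \<Longrightarrow> p t = real t powr - \<gamma> * L (real t)"
  obtains A where "\<And>m n. A \<le> m \<Longrightarrow> m \<le> n \<Longrightarrow> p n \<le> exp \<gamma> * p m"
proof -
  obtain X where X: "0 < X" "\<And>x y. X \<le> x \<Longrightarrow> x \<le> y \<Longrightarrow> L y \<le> exp \<gamma> * (y / x) powr \<gamma> * L x"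
    using potter_bound[OF L \<gamma>] by metis
  show ?thesis
  proof (rule that)
    fix m n assume m: "nat \<lceil>X\<rceil> + 1 \<le> m" and n: "m \<le> n"
    have mX: "X \<le> real m" using m by linarith
    have pos: "1 \<le> m" "1 \<le> n" using m n by simp_all
    have "p n \<le> real n powr - \<gamma> * (exp \<gamma> * (real n / real m) powr \<gamma> * L (real m))"
      unfolding p[OF pos(2)] using X(2)[OF mX, of n] n by (intro mult_left_mono) auto
    also have "\<dots> = exp \<gamma> * p m"
      using pos by (simp add: p powr_divide powr_minus field_simps)
    finally show "p n \<le> exp \<gamma> * p m" .
  qed
qed

lemma integrable_of_index_gt_2:
  fixes P :: "nat pmf"
  assumes L: "slowly_varying L" and \<gamma>: "2 < \<gamma>"
    and p: "\<And>t. 1 \<le> t \<Longrightarrow> pmf P t = real t powr - \<gamma> * L (real t)"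
  shows "integrable (measure_pmf P) real"
proof -
  obtain C where C: "0 \<le> C" "\<And>t. 1 \<le> t \<Longrightarrow> pmf P t \<le> C * real t powr - (\<gamma> - (\<gamma> - 2) / 2)"
    by (rule regularly_varying_upper[OF L _ _ p pmf_le_1, of "(\<gamma> - 2) / 2"]) (use \<gamma> in auto)
  \<comment> \<open>Half of the margin \<open>\<gamma> - 2\<close> goes to \<open>L\<close>;
    multiplying by \<open>n\<close> leaves the exponent \<open>- \<gamma> / 2\<close>, below
    -1.\<close>
  define r where "r = - (\<gamma> / 2)"
  have sm: "summable (\<lambda>n. C * real n powr r)"
    using \<gamma> by (intro summable_mult) (subst summable_real_powr_iff, simp add: r_def)
  show ?thesis
  proof (rule integrable_pmf_exhaust(1))
    show "incseq (\<lambda>k. {..<k::nat})" by (auto intro!: monoI)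
    show "(\<Union>k. {..<k::nat}) = UNIV" by blast
    fix k
    have "(\<Sum>n<k. pmf P n * real n) \<le> (\<Sum>n<k. C * real n powr r)"
    proof (rule sum_mono)
      fix n
      show "pmf P n * real n \<le> C * real n powr r"
      proof (cases "n = 0")
        case False
        then have "pmf P n * real n \<le> (C * real n powr - (\<gamma> - (\<gamma> - 2) / 2)) * real n powr 1"
          using C(2)[of n] by (simp add: mult_right_mono)
        also have "\<dots> = C * (real n powr - (\<gamma> - (\<gamma> - 2) / 2) * real n powr 1)" by simp
        also have "real n powr - (\<gamma> - (\<gamma> - 2) / 2) * real n powr 1 = real n powr r"
          by (subst powr_add[symmetric]) (simp add: r_def field_simps)
        finally show ?thesis .
      qed (use C in simp)
    qed
    also have "\<dots> \<le> (\<Sum>n. C * real n powr r)"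
      using C by (intro sum_le_suminf sm) auto
    finally show "(\<Sum>n<k. pmf P n * real n) \<le> (\<Sum>n. C * real n powr r)" .
  qed auto
qed

text \<open>A Karamata-type bound with a loss \<open>e\<close> in the exponent. Potter's bound
  compares \<open>L n\<close> with \<open>L t\<close>, leaving
  \<open>n powr (2 - \<gamma>) * n powr (- 1 - e)\<close>; since \<gamma> \<le> 2 the first factor
  is at most \<open>t powr (2 - \<gamma>)\<close>, and the second is summable.\<close>

lemma partial_mean_le:
  fixes p :: "nat \<Rightarrow> real"
  assumes L: "slowly_varying L" and \<gamma>: "\<gamma> \<le> 2" and e: "0 < e" and p01: "\<And>n. 0 \<le> p n" "\<And>n. p n \<le> 1"
    and p: "\<And>t. 1 \<le> t \<Longrightarrow> p t = real t powr - \<gamma> * L (real t)"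
  obtains A B where "0 \<le> B" "\<And>t. 1 \<le> t \<Longrightarrow> (\<Sum>n\<le>t. p n * real n) \<le> A + B * (p t * real t powr (2 + e))"
proof -
  obtain X where X: "0 < X" "\<And>x y. X \<le> x \<Longrightarrow> x \<le> y \<Longrightarrow> L x \<le> exp e * (y / x) powr e * L y"
    using potter_bound[OF L e] by metis
  define N where "N = nat \<lceil>X\<rceil> + 1"
  define S where "S = (\<Sum>n. real n powr (- 1 - e))"
  have sm: "summable (\<lambda>n. real n powr (- 1 - e))"
    using e by (subst summable_real_powr_iff) simp
  have S0: "0 \<le> S" unfolding S_def by (rule suminf_nonneg[OF sm]) simp
  show ?thesis
  proof (rule that)
    show "0 \<le> exp e * S" using S0 by simp
    fix t :: nat assume t: "1 \<le> t"
    have bound: "p n * real n \<le> exp e * (p t * real t powr (2 + e)) * real n powr (- 1 - e)" if n: "N \<le> n" "n \<le> t" for n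
    proof -
      have nX: "X \<le> real n" using n unfolding N_def by linarith
      have n1: "1 \<le> n" using n by (simp add: N_def)
      have Lt: "0 \<le> L (real t)" using p01(1)[of t] p[OF t] t by (simp add: zero_le_mult_iff)
      have "p n * real n \<le> (real n powr - \<gamma> * (exp e * (real t / real n) powr e * L (real t))) * real n"
        unfolding p[OF n1] using X(2)[OF nX, of t] n by (intro mult_right_mono mult_left_mono) auto
      also have "\<dots> = exp e * (real t powr e * L (real t)) * real n powr (2 - \<gamma>) * real n powr (- 1 - e)"
        using n1 t by (simp add: powr_divide powr_diff powr_minus power2_eq_square field_simps)
      also have "\<dots> \<le> exp e * (real t powr e * L (real t)) * real t powr (2 - \<gamma>) * real n powr (- 1 - e)"
        using n \<gamma> Lt by (intro mult_right_mono mult_left_mono powr_mono2) auto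
      also have "\<dots> = exp e * (p t * real t powr (2 + e)) * real n powr (- 1 - e)"
        using t by (simp add: p powr_add powr_diff powr_minus field_simps)
      finally show ?thesis .
    qed
    have "{..t} \<subseteq> {..<N} \<union> {N..t}" by auto
    then have "(\<Sum>n\<le>t. p n * real n) \<le> (\<Sum>n\<in>{..<N} \<union> {N..t}. p n * real n)"
      using p01 by (intro sum_mono2) auto
    also have "\<dots> = (\<Sum>n<N. p n * real n) + (\<Sum>n\<in>{N..t}. p n * real n)"
      by (rule sum.union_disjoint) auto
    also have "(\<Sum>n\<in>{N..t}. p n * real n) \<le> (\<Sum>n\<in>{N..t}. exp e * (p t * real t powr (2 + e)) * real n powr (- 1 - e))"
      by (intro sum_mono bound) auto
    also have "\<dots> = exp e * (p t * real t powr (2 + e)) * (\<Sum>n\<in>{N..t}. real n powr (- 1 - e))"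
      by (simp add: sum_distrib_left)
    also have "\<dots> \<le> exp e * (p t * real t powr (2 + e)) * S"
      unfolding S_def using p01(1)[of t] by (intro mult_left_mono sum_le_suminf[OF sm]) auto
    finally show "(\<Sum>n\<le>t. p n * real n) \<le> (\<Sum>n<N. p n * real n) + exp e * S * (p t * real t powr (2 + e))"
      by (simp add: mult_ac)
  qed
qed

section \<open>Contributions of few and of many summands\<close>

context compound_walk
begin

definition far :: "nat \<Rightarrow> real" where
  "far t = (\<integral>n. indicator {2 * tau t + 2..} n * pmf (walk D n) (int t) \<partial>measure_pmf PN)"

definition low :: "real \<Rightarrow> nat \<Rightarrow> real" where
  "low \<delta> t = (\<Sum>n\<in>{n. real n \<le> \<delta> * real t}. pmf PN n * pmf (walk D n) (int t))"

lemma finite_low: "finite {n. real n \<le> (x::real)}"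
  by (rule finite_subset[of _ "{..nat \<lceil>x\<rceil>}"]) (auto, linarith)

text \<open>The condition \<open>\<delta> * \<mu> \<le> 1 / 4\<close> gives
  \<open>\<delta> * t < 2 * tau t + 2\<close>, so the low range ends before the far one begins and
  the three ranges partition all \<open>n\<close>.\<close>

lemma total_split:
  assumes "\<delta> * \<mu> \<le> 1 / 4" "0 < \<delta>"
  shows "pmf (bind_pmf PN (walk D)) (int t)
    = low \<delta> t + (\<Sum>n\<in>middle \<delta> t. pmf PN n * pmf (walk D n) (int t)) + far t"
proof -
  define m where "m = 2 * tau t + 2"
  define q where "q n = pmf (walk D n) (int t)" for n
  have int: "integrable (measure_pmf PN) (\<lambda>n. indicator B n * q n)" for B
    by (rule integrable_pmf_bounded[where B=1]) (auto simp: indicator_def q_def pmf_le_1)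
  have "\<delta> * real t \<le> \<delta> * ((tau t + 1) * \<mu>)"
    using tau_bounds[of t] assms by (intro mult_left_mono) auto
  also have "\<dots> = (\<delta> * \<mu>) * (tau t + 1)" by simp
  also have "\<dots> \<le> 1/4 * (tau t + 1)" using assms by (intro mult_right_mono) auto
  also have "\<dots> < real m" by (simp add: m_def)
  finally have dm: "\<delta> * real t < real m" .
  have "pmf (bind_pmf PN (walk D)) (int t) = (\<integral>n. indicator {..<m} n * q n + indicator {m..} n * q n \<partial>measure_pmf PN)"
    unfolding pmf_bind q_def by (rule Bochner_Integration.integral_cong) (auto simp: indicator_def)
  also have "\<dots> = (\<integral>n. indicator {..<m} n * q n \<partial>measure_pmf PN) + far t"
    using int by (simp add: far_def m_def q_def)
  also have "(\<integral>n. indicator {..<m} n * q n \<partial>measure_pmf PN) = (\<Sum>n<m. pmf PN n * q n)"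
    using integral_measure_pmf[of "{..<m}" PN "\<lambda>n. indicator {..<m} n * q n"] by (simp add: indicator_def)
  also have "{..<m} = {n. real n \<le> \<delta> * real t} \<union> middle \<delta> t"
    using dm by (auto simp: middle_def m_def)
  also have "(\<Sum>n\<in>\<dots>. pmf PN n * q n) = low \<delta> t + (\<Sum>n\<in>middle \<delta> t. pmf PN n * q n)"
    unfolding low_def q_def by (rule sum.union_disjoint) (auto simp: finite_low finite_middle middle_def)
  finally show ?thesis by (simp add: q_def)
qed

lemma far_le:
  assumes "\<And>k. (\<Sum>n\<in>{2 * tau t + 2..<(2 * tau t + 2) * 2 ^ k}. pmf PN n * pmf (walk D n) (int t)) \<le> B"
  shows "far t \<le> B"
  unfolding far_def
proof (rule integrable_pmf_exhaust(2))
  define m where "m = 2 * tau t + 2"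
  show "incseq (\<lambda>k. {..<m * 2 ^ k})"
    by (intro monoI) (auto intro: order.strict_trans2 mult_left_mono power_increasing)
  have "n < m * 2 ^ n" for n
  proof -
    have "1 * 2 ^ n \<le> m * 2 ^ n" by (rule mult_right_mono) (simp_all add: m_def)
    then show ?thesis using less_exp[of n] by linarith
  qed
  then show "(\<Union>k. {..<m * 2 ^ k}) = UNIV" by blast
  fix k
  have "(\<Sum>n\<in>{..<m * 2 ^ k}. pmf PN n * (indicator {2 * tau t + 2..} n * pmf (walk D n) (int t)))
      = (\<Sum>n\<in>{m..<m * 2 ^ k}. pmf PN n * pmf (walk D n) (int t))"
    by (rule sum.mono_neutral_cong_right) (auto simp: m_def)
  then show "(\<Sum>n\<in>{..<m * 2 ^ k}. pmf PN n * (indicator {2 * tau t + 2..} n * pmf (walk D n) (int t))) \<le> B"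
    using assms[of k] by (simp add: m_def)
qed auto

lemma far_nonneg: "0 \<le> far t"
  unfolding far_def by (rule Bochner_Integration.integral_nonneg) simp

lemma t_le_far: "real_of_int (int t) \<le> real (2 * tau t + 2) * \<mu> / 2"
  using tau_bounds(2)[of t] by (simp add: algebra_simps)

text \<open>The conclusion takes an arbitrary bound \<open>B\<close> of the weighted dyadic sums,
  because the moment condition and the tail-sum condition on N supply it in different ways.\<close>

lemma far_weighted:
  obtains C where "0 \<le> C"
    "\<forall>\<^sub>F t in sequentially. \<forall>B. (\<forall>k. (\<Sum>n\<in>{2 * tau t + 2..<(2 * tau t + 2) * 2 ^ k}. pmf PN n * real n powr - \<beta>) \<le> B) \<longrightarrow> far t \<le> C * B"
proof -
  obtain C A where C: "1 \<le> C" and A: "\<And>a b. A \<le> a \<Longrightarrow> 1/2 * real a \<le> real b \<Longrightarrow> real b \<le> 2 * real a \<Longrightarrow> pmf PN b \<le> C * pmf PN a"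
    by (rule locally_comparableE[OF comparable, of "1/2" 2]) auto
  show ?thesis
  proof (rule that)
    show "0 \<le> block_const * C" using block_const_nonneg C by simp
    show "\<forall>\<^sub>F t in sequentially. \<forall>B. (\<forall>k. (\<Sum>n\<in>{2 * tau t + 2..<(2 * tau t + 2) * 2 ^ k}. pmf PN n * real n powr - \<beta>) \<le> B) \<longrightarrow> far t \<le> block_const * C * B"
      using eventually_tau[OF eventually_ge_at_top[of A]]
    proof eventually_elim
      case (elim t)
      show ?case
      proof (intro allI impI far_le)
        fix B k
        assume B: "\<forall>k. (\<Sum>n\<in>{2 * tau t + 2..<(2 * tau t + 2) * 2 ^ k}. pmf PN n * real n powr - \<beta>) \<le> B"
        have "(\<Sum>n\<in>{2 * tau t + 2..<(2 * tau t + 2) * 2 ^ k}. pmf PN n * pmf (walk D n) (int t))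
            \<le> block_const * C * (\<Sum>n\<in>{2 * tau t + 2..<(2 * tau t + 2) * 2 ^ k}. pmf PN n * real n powr - \<beta>)"
        proof (rule visits_weighted_tail[OF _ t_le_far])
          fix a n j assume "2 * tau t + 2 \<le> a" "n \<in> {a..2*a}" "j \<in> {a..2*a}"
          then show "pmf PN n \<le> C * pmf PN j" using elim by (intro A) auto
        qed (use C in auto)
        also have "\<dots> \<le> block_const * C * B"
          using B block_const_nonneg C by (intro mult_left_mono) auto
        finally show "(\<Sum>n\<in>{2 * tau t + 2..<(2 * tau t + 2) * 2 ^ k}. pmf PN n * pmf (walk D n) (int t)) \<le> block_const * C * B" .
      qed
    qed
  qed
qed

lemma far_at_top: "filterlim (\<lambda>t. 2 * tau t + 2) at_top sequentially"
  by (rule filterlim_at_top_mono[OF tau_at_top]) auto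

text \<open>For \<open>n \<ge> m\<close> one has
  \<open>n powr - \<beta> \<le> m powr (- \<beta> - 1) * n\<close>, so the far part is at most a
  multiple of \<open>m powr (- \<beta> - 1)\<close> times the tail of the mean of N, which tends to
  0. In case (i) \<open>- \<beta> - 1\<close> is \<open>- \<alpha>\<close>, the order of the step
  density.\<close>

lemma far_moment:
  assumes int: "integrable (measure_pmf PN) real"
    and c: "0 < c" "\<forall>\<^sub>F t in sequentially. c * real t powr (- \<beta> - 1) \<le> pmf D (int t)"
  shows "far \<in> o(\<lambda>t. pmf D (int t))"
proof -
  define T where "T m = (\<integral>n. indicator {m..} n * real n \<partial>measure_pmf PN)" for m
  obtain C where C: "0 \<le> C" and far: "\<forall>\<^sub>F t in sequentially. \<forall>B. (\<forall>k. (\<Sum>n\<in>{2 * tau t + 2..<(2 * tau t + 2) * 2 ^ k}. pmf PN n * real n powr - \<beta>) \<le> B) \<longrightarrow> far t \<le> C * B"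
    by (rule far_weighted)
  have "T \<longlonglongrightarrow> (\<integral>n. 0 \<partial>measure_pmf PN)"
    unfolding T_def
  proof (rule tendsto_integral_pmf[OF _ int])
    fix n
    show "(\<lambda>m. indicator {m..} n * real n) \<longlonglongrightarrow> 0"
      by (rule tendsto_eventually) (use eventually_gt_at_top[of n] in \<open>eventually_elim, simp\<close>)
  qed (simp add: indicator_def)
  then have T: "(\<lambda>t. T (2 * tau t + 2)) \<longlonglongrightarrow> 0"
    using filterlim_compose[OF _ far_at_top, of T "nhds 0"] by simp
  show ?thesis
  proof (rule landau_o.smallI)
    fix e :: real assume e: "0 < e"
    \<comment> \<open>\<open>C + 1\<close> keeps \<open>M\<close> positive for the quotient
      \<open>e / M\<close>; the power of \<mu> comes from \<open>m \<ge> t / \<mu>\<close>.\<close>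
    define M where "M = (C + 1) * \<mu> powr (\<beta> + 1) / c"
    have M: "0 < M" using C mu_pos c by (simp add: M_def)
    have "\<forall>\<^sub>F t in sequentially. T (2 * tau t + 2) < e / M"
      using T e M by (intro order_tendstoD(2)) auto
    then show "\<forall>\<^sub>F t in sequentially. norm (far t) \<le> e * norm (pmf D (int t))"
      using far c(2) eventually_gt_at_top[of 0]
    proof eventually_elim
      case (elim t)
      define m where "m = 2 * tau t + 2"
      have T0: "0 \<le> T m" unfolding T_def by (rule Bochner_Integration.integral_nonneg) simp
      have "(\<Sum>n\<in>{m..<m * 2 ^ k}. pmf PN n * real n powr - \<beta>) \<le> real m powr (- \<beta> - 1) * T m" for k
      proof -
        have "(\<Sum>n\<in>{m..<m * 2 ^ k}. pmf PN n * real n powr - \<beta>) \<le> (\<Sum>n\<in>{m..<m * 2 ^ k}. real m powr (- \<beta> - 1) * (pmf PN n * (indicator {m..} n * real n)))"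
        proof (rule sum_mono)
          fix n assume n: "n \<in> {m..<m * 2 ^ k}"
          then have n0: "0 < real m" "real m \<le> real n" by (simp_all add: m_def)
          have "real n powr - \<beta> = real n powr (- \<beta> - 1) * real n" using n0 by (simp add: powr_diff)
          also have "\<dots> \<le> real m powr (- \<beta> - 1) * real n"
            using n0 beta_gt_1 by (intro mult_right_mono powr_mono2') auto
          finally have "pmf PN n * real n powr - \<beta> \<le> pmf PN n * (real m powr (- \<beta> - 1) * real n)"
            by (rule mult_left_mono) simp
          then show "pmf PN n * real n powr - \<beta> \<le> real m powr (- \<beta> - 1) * (pmf PN n * (indicator {m..} n * real n))"
            using n by (simp add: mult_ac)
        qed
        also have "\<dots> = real m powr (- \<beta> - 1) * (\<Sum>n\<in>{m..<m * 2 ^ k}. pmf PN n * (indicator {m..} n * real n))"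
          by (simp add: sum_distrib_left)
        also have "\<dots> \<le> real m powr (- \<beta> - 1) * T m"
          unfolding T_def
        proof (intro mult_left_mono sum_pmf_le_integral)
          show "integrable (measure_pmf PN) (\<lambda>n. indicator {m..} n * real n)"
            by (rule Bochner_Integration.integrable_bound[OF int]) (auto simp: indicator_def)
        qed auto
        finally show ?thesis .
      qed
      then have "far t \<le> C * (real m powr (- \<beta> - 1) * T m)" using elim(2) by (simp add: m_def)
      also have "\<dots> \<le> (C + 1) * (real m powr (- \<beta> - 1) * T m)"
        using T0 by (intro mult_right_mono) auto
      also have "real m powr (- \<beta> - 1) \<le> \<mu> powr (\<beta> + 1) * real t powr (- \<beta> - 1)"
      proof -
        have t: "0 < real t / \<mu>" "real t / \<mu> \<le> real m"
          using t_le_far[of t] mu_pos elim(4) by (simp_all add: m_def field_simps)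
        have "real m powr (- \<beta> - 1) \<le> (real t / \<mu>) powr (- \<beta> - 1)"
          using t beta_gt_1 by (intro powr_mono2') auto
        also have "\<dots> = \<mu> powr (\<beta> + 1) * real t powr (- \<beta> - 1)"
        proof -
          have "\<mu> powr (- \<beta> - 1) = inverse (\<mu> powr (\<beta> + 1))"
            using powr_minus[of \<mu> "\<beta> + 1"] by simp
          moreover have "(real t / \<mu>) powr (- \<beta> - 1) = real t powr (- \<beta> - 1) / \<mu> powr (- \<beta> - 1)"
            by (rule powr_divide)
          ultimately show ?thesis by (simp add: divide_inverse)
        qed
        finally show ?thesis .
      qed
      also have "real t powr (- \<beta> - 1) \<le> pmf D (int t) / c" using elim(3) c(1) by (simp add: field_simps)
      also have "(C + 1) * (\<mu> powr (\<beta> + 1) * (pmf D (int t) / c) * T m) = (M * T m) * pmf D (int t)"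
        by (simp add: M_def)
      also have "\<dots> \<le> e * pmf D (int t)"
        using elim(1) M by (intro mult_right_mono) (auto simp: m_def field_simps)
      finally show ?case using C T0 mu_pos far_nonneg[of t] by (auto simp: mult_left_mono mult_right_mono)
    qed
  qed
qed

text \<open>Hypotheses on N are given at index \<open>t\<close>, far estimates arise at
  \<open>2 * tau t + 2\<close>, and the results are needed at \<open>tau t\<close>. All three are
  within bounded ratios of one another.\<close>

lemma comparable_tau:
  obtains C where "1 \<le> C" "\<forall>\<^sub>F t in sequentially. pmf PN (2 * tau t + 2) \<le> C * pmf PN (tau t)"
    "\<forall>\<^sub>F t in sequentially. pmf PN t \<le> C * pmf PN (tau t)"
proof -
  obtain C A where C: "1 \<le> C" and A: "\<And>a b. A \<le> a \<Longrightarrow> min 1 \<mu> * real a \<le> real b \<Longrightarrow> real b \<le> (4 + 2 * \<mu>) * real a \<Longrightarrow> pmf PN b \<le> C * pmf PN a"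
    by (rule locally_comparableE[OF comparable, of "min 1 \<mu>" "4 + 2 * \<mu>"]) (use mu_pos in auto)
  have ev: "\<forall>\<^sub>F t in sequentially. A \<le> tau t \<and> 1 \<le> tau t"
    by (rule eventually_tau) (intro eventually_conj eventually_ge_at_top)
  have min: "min 1 \<mu> * x \<le> x" "min 1 \<mu> * x \<le> \<mu> * x" if "0 \<le> x" for x
    using that mult_right_mono[of "min 1 \<mu>" 1 x] mult_right_mono[of "min 1 \<mu>" \<mu> x] by simp_all
  show ?thesis
  proof (rule that[OF C])
    show "\<forall>\<^sub>F t in sequentially. pmf PN (2 * tau t + 2) \<le> C * pmf PN (tau t)"
      using ev
    proof eventually_elim
      case (elim t)
      have "0 \<le> 2 * \<mu> * real (tau t)" using mu_pos by simp
      moreover have "1 \<le> real (tau t)" using elim by simp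
      ultimately show ?case
        using elim by (intro A order.trans[OF min(1)]) (auto simp: algebra_simps)
    qed
    show "\<forall>\<^sub>F t in sequentially. pmf PN t \<le> C * pmf PN (tau t)"
      using ev
    proof eventually_elim
      case (elim t)
      have "\<mu> * 1 \<le> \<mu> * real (tau t)" using elim mu_pos by (intro mult_left_mono) auto
      moreover have t: "\<mu> * real (tau t) \<le> real t" "real t < \<mu> * real (tau t) + \<mu>"
        using tau_bounds[of t] by (simp_all add: algebra_simps)
      ultimately have "real t \<le> (4 + 2 * \<mu>) * real (tau t)" unfolding distrib_right by linarith
      then show ?case using elim t by (intro A order.trans[OF min(2)]) auto
    qed
  qed
qed

lemma small_tau_of_small_far:
  assumes "g \<in> o(\<lambda>t. pmf PN (2 * tau t + 2))"
  shows "g \<in> o(\<lambda>t. pmf PN (tau t))"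
proof -
  obtain C where "\<forall>\<^sub>F t in sequentially. pmf PN (2 * tau t + 2) \<le> C * pmf PN (tau t)"
    by (rule comparable_tau)
  then have "(\<lambda>t. pmf PN (2 * tau t + 2)) \<in> O(\<lambda>t. pmf PN (tau t))"
    by (intro bigoI[of _ C]) (auto elim: eventually_mono)
  then show ?thesis using assms landau_o.small_big_trans by blast
qed

lemma small_tau_of_small:
  assumes "g \<in> o(\<lambda>t. pmf PN t)"
  shows "g \<in> o(\<lambda>t. pmf PN (tau t))"
proof -
  obtain C where "\<forall>\<^sub>F t in sequentially. pmf PN t \<le> C * pmf PN (tau t)"
    by (rule comparable_tau)
  then have "(\<lambda>t. pmf PN t) \<in> O(\<lambda>t. pmf PN (tau t))"
    by (intro bigoI[of _ C]) (auto elim: eventually_mono)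
  then show ?thesis using assms landau_o.small_big_trans by blast
qed

text \<open>For \<open>\<beta> \<ge> 3/2\<close> the weights \<open>n powr - \<beta>\<close> are
  below \<open>n powr (-3/2)\<close>, so the tail-sum hypothesis taken at
  \<open>2 * tau t + 2\<close> bounds the far part directly.\<close>

lemma far_sum:
  assumes \<beta>: "3 / 2 \<le> \<beta>"
    and small: "(\<lambda>t::nat. \<Sum>\<^sub>\<infinity>n\<in>{t..}. real n powr (-3/2) * pmf PN n) \<in> o(\<lambda>t. pmf PN t)"
  shows "far \<in> o(\<lambda>t. pmf PN (tau t))"
proof (rule small_tau_of_small_far)
  define S where "S t = (\<Sum>\<^sub>\<infinity>n\<in>{t..}. real n powr (-3/2) * pmf PN n)" for t :: nat
  have le1: "real n powr (-3/2) \<le> 1" for n :: nat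
    using powr_mono[of "-3/2" 0 "real n"] by (cases "n = 0") auto
  have summ: "(\<lambda>n. real n powr (-3/2) * pmf PN n) summable_on {t..}" for t :: nat
  proof (rule nonneg_bdd_above_summable_on)
    show "bdd_above (sum (\<lambda>n. real n powr (-3/2) * pmf PN n) ` {F. F \<subseteq> {t..} \<and> finite F})"
    proof (rule bdd_aboveI2)
      fix F assume "F \<in> {F. F \<subseteq> {t..} \<and> finite F}"
      then have "finite F" by simp
      have "(\<Sum>n\<in>F. real n powr (-3/2) * pmf PN n) \<le> (\<Sum>n\<in>F. pmf PN n)"
        using le1 by (intro sum_mono) (simp add: mult_left_le_one_le)
      also have "\<dots> = measure_pmf.prob PN F" by (rule measure_measure_pmf_finite[OF \<open>finite F\<close>, symmetric])
      also have "\<dots> \<le> 1" by simp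
      finally show "(\<Sum>n\<in>F. real n powr (-3/2) * pmf PN n) \<le> 1" .
    qed
  qed auto
  obtain C where C: "0 \<le> C" and far: "\<forall>\<^sub>F t in sequentially. \<forall>B. (\<forall>k. (\<Sum>n\<in>{2 * tau t + 2..<(2 * tau t + 2) * 2 ^ k}. pmf PN n * real n powr - \<beta>) \<le> B) \<longrightarrow> far t \<le> C * B"
    by (rule far_weighted)
  have "far \<in> O(\<lambda>t. S (2 * tau t + 2))"
  proof (rule bigoI[of _ C])
    show "\<forall>\<^sub>F t in sequentially. norm (far t) \<le> C * norm (S (2 * tau t + 2))"
      using far
    proof eventually_elim
      case (elim t)
      define m where "m = 2 * tau t + 2"
      have "(\<Sum>n\<in>{m..<m * 2 ^ k}. pmf PN n * real n powr - \<beta>) \<le> S m" for k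
      proof -
        have "(\<Sum>n\<in>{m..<m * 2 ^ k}. pmf PN n * real n powr - \<beta>) \<le> (\<Sum>n\<in>{m..<m * 2 ^ k}. real n powr (-3/2) * pmf PN n)"
        proof (rule sum_mono)
          fix n assume "n \<in> {m..<m * 2 ^ k}"
          then have "1 \<le> real n" by (simp add: m_def)
          then have "real n powr - \<beta> \<le> real n powr (-3/2)" using \<beta> by (intro powr_mono) auto
          then show "pmf PN n * real n powr - \<beta> \<le> real n powr (-3/2) * pmf PN n"
            by (subst mult.commute) (rule mult_right_mono, auto)
        qed
        also have "\<dots> \<le> S m" unfolding S_def by (rule finite_sum_le_infsum[OF summ]) auto
        finally show ?thesis .
      qed
      then have "far t \<le> C * S m" using elim by (simp add: m_def)
      also have "\<dots> \<le> C * \<bar>S m\<bar>" using C by (intro mult_left_mono) auto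
      finally show ?case using far_nonneg[of t] by (simp add: m_def)
    qed
  qed
  also have "(\<lambda>t. S (2 * tau t + 2)) \<in> o(\<lambda>t. pmf PN (2 * tau t + 2))"
    by (rule landau_o.small.compose[OF small[folded S_def] far_at_top])
  finally show "far \<in> o(\<lambda>t. pmf PN (2 * tau t + 2))" .
qed

text \<open>All far weights are at most \<open>C\<close> times the one at
  \<open>2 * tau t + 2\<close>, and the number of visits at these epochs is below a bound tending to
  0.\<close>

lemma far_decreasing:
  assumes A: "\<And>m n. A \<le> m \<Longrightarrow> m \<le> n \<Longrightarrow> pmf PN n \<le> C * pmf PN m" and C: "0 \<le> C"
  shows "far \<in> o(\<lambda>t. pmf PN (tau t))"
proof (rule small_tau_of_small_far, rule landau_o.smallI)
  fix e :: real assume e: "0 < e"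
  have "\<forall>\<^sub>F m in sequentially. tail_bound m < e / (C + 1) \<and> A \<le> m"
    using e C by (intro eventually_conj eventually_ge_at_top order_tendstoD(2)[OF tail_bound_tendsto_0]) auto
  from eventually_compose_filterlim[OF this far_at_top]
  show "\<forall>\<^sub>F t in sequentially. norm (far t) \<le> e * norm (pmf PN (2 * tau t + 2))"
  proof eventually_elim
    case (elim t)
    define m where "m = 2 * tau t + 2"
    have "far t \<le> C * pmf PN m * tail_bound m"
    proof (rule far_le, fold m_def)
      fix k
      have "(\<Sum>n\<in>{m..<m * 2 ^ k}. pmf PN n * pmf (walk D n) (int t)) \<le> (\<Sum>n\<in>{m..<m * 2 ^ k}. C * pmf PN m * pmf (walk D n) (int t))"
        using elim by (intro sum_mono mult_right_mono A) (auto simp: m_def)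
      also have "\<dots> = C * pmf PN m * (\<Sum>n\<in>{m..<m * 2 ^ k}. pmf (walk D n) (int t))" by (simp add: sum_distrib_left)
      also have "\<dots> \<le> C * pmf PN m * tail_bound m"
        using C t_le_far[of t] by (intro mult_left_mono sum_visits_tail_le) (auto simp: m_def)
      finally show "(\<Sum>n\<in>{m..<m * 2 ^ k}. pmf PN n * pmf (walk D n) (int t)) \<le> C * pmf PN m * tail_bound m" .
    qed
    also have "\<dots> \<le> C * pmf PN m * (e / (C + 1))" using elim C by (intro mult_left_mono) (auto simp: m_def)
    also have "\<dots> \<le> e * pmf PN m"
    proof -
      have "C * (e / (C + 1)) \<le> e" using C e by (simp add: field_simps)
      from mult_right_mono[OF this pmf_nonneg[of PN m]] show ?thesis by (simp add: mult_ac)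
    qed
    finally show ?case using far_nonneg[of t] by (simp add: m_def)
  qed
qed

text \<open>Dominated convergence over N: the ratio of point masses tends to \<open>n\<close> for
  each \<open>n\<close> and is at most \<open>C * n\<close> on the low range, integrable because N
  has a mean.\<close>

lemma low_moment:
  assumes int: "integrable (measure_pmf PN) real"
    and \<delta>: "0 < \<delta>"
    and dom: "\<forall>\<^sub>F t in at_top. \<forall>n. real n \<le> \<delta> * real_of_int t \<longrightarrow> pmf (walk D n) t \<le> C * n * pmf D t"
  shows "(\<lambda>t. low \<delta> t - (\<integral>n. real n \<partial>measure_pmf PN) * pmf D (int t)) \<in> o(\<lambda>t. pmf D (int t))"
proof -
  define EN where "EN = (\<integral>n. real n \<partial>measure_pmf PN)"
  have "\<forall>\<^sub>F t in sequentially. 0 < pmf D (int t) \<and> (\<forall>n. real n \<le> \<delta> * real t \<longrightarrow> pmf (walk D n) (int t) \<le> C * n * pmf D (int t))"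
    using eventually_compose_filterlim[OF eventually_conj[OF pmf_pos dom] filterlim_int_sequentially] by simp
  then obtain T where T: "\<And>t. T \<le> t \<Longrightarrow> 0 < pmf D (int t)"
      "\<And>t n. T \<le> t \<Longrightarrow> real n \<le> \<delta> * real t \<Longrightarrow> pmf (walk D n) (int t) \<le> C * n * pmf D (int t)"
    by (auto simp: eventually_sequentially)
  define g where "g t n = (if T \<le> t then indicator {n. real n \<le> \<delta> * real t} n * (pmf (walk D n) (int t) / pmf D (int t)) else 0)" for t n
  have "(\<lambda>t. \<integral>n. g t n \<partial>measure_pmf PN) \<longlonglongrightarrow> EN"
    unfolding EN_def
  proof (rule tendsto_integral_pmf)
    fix n
    have "(\<lambda>t. pmf (walk D n) (int t) / pmf D (int t)) \<longlonglongrightarrow> real n"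
      by (rule filterlim_compose[OF pmf_walk_ratio filterlim_int_sequentially])
    then show "(\<lambda>t. g t n) \<longlonglongrightarrow> real n"
    proof (rule Lim_transform_eventually)
      have "\<forall>\<^sub>F t::nat in sequentially. real n \<le> \<delta> * real t" using \<delta> by real_asymp
      then show "\<forall>\<^sub>F t in sequentially. pmf (walk D n) (int t) / pmf D (int t) = g t n"
        using eventually_ge_at_top[of T] by eventually_elim (simp add: g_def)
    qed
    show "integrable (measure_pmf PN) (\<lambda>n. \<bar>C\<bar> * real n)" using int by simp
    fix t
    have C: "C * real n \<le> \<bar>C\<bar> * real n" by (intro mult_right_mono) auto
    show "\<bar>g t n\<bar> \<le> \<bar>C\<bar> * real n"
    proof (cases "T \<le> t \<and> real n \<le> \<delta> * real t")
      case True
      then have "pmf (walk D n) (int t) / pmf D (int t) \<le> C * real n"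
        using T(1)[of t] T(2)[of t n] by (simp add: divide_le_eq)
      then show ?thesis using True C by (simp add: g_def)
    qed (auto simp: g_def)
  qed
  then have lim: "(\<lambda>t. low \<delta> t / pmf D (int t)) \<longlonglongrightarrow> EN"
  proof (rule Lim_transform_eventually)
    have g_low: "(\<integral>n. g t n \<partial>measure_pmf PN) = low \<delta> t / pmf D (int t)" if "T \<le> t" for t
    proof -
      have "(\<integral>n. g t n \<partial>measure_pmf PN) = (\<Sum>n\<in>{n. real n \<le> \<delta> * real t}. pmf PN n * (pmf (walk D n) (int t) / pmf D (int t)))"
        using integral_measure_pmf[of "{n. real n \<le> \<delta> * real t}" PN "g t", OF finite_low] that by (simp add: g_def indicator_def)
      then show ?thesis by (simp add: low_def sum_divide_distrib)
    qed
    show "\<forall>\<^sub>F t in sequentially. (\<integral>n. g t n \<partial>measure_pmf PN) = low \<delta> t / pmf D (int t)"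
      using eventually_ge_at_top[of T] by eventually_elim (rule g_low)
  qed
  show ?thesis
    unfolding EN_def[symmetric]
  proof (rule smalloI_tendsto)
    have "(\<lambda>t. low \<delta> t / pmf D (int t) - EN) \<longlonglongrightarrow> EN - EN" by (intro tendsto_intros lim)
    then have "(\<lambda>t. low \<delta> t / pmf D (int t) - EN) \<longlonglongrightarrow> 0" by simp
    then show "(\<lambda>t. (low \<delta> t - EN * pmf D (int t)) / pmf D (int t)) \<longlonglongrightarrow> 0"
    proof (rule Lim_transform_eventually)
      show "\<forall>\<^sub>F t in sequentially. low \<delta> t / pmf D (int t) - EN = (low \<delta> t - EN * pmf D (int t)) / pmf D (int t)"
        using eventually_ge_at_top[of T]
      proof eventually_elim
        case (elim t)
        then show ?case using T(1)[OF elim] by (simp add: field_simps)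
      qed
    qed
    show "\<forall>\<^sub>F t in sequentially. pmf D (int t) \<noteq> 0"
      using eventually_ge_at_top[of T] by eventually_elim (use T(1) in force)
  qed
qed

lemma low_nonneg: "0 \<le> low \<delta> t"
  unfolding low_def by (intro sum_nonneg) simp

text \<open>Without a mean of N the uniform bound leaves \<open>pmf D t\<close> times the mean
  truncated at \<open>t\<close>, at most \<open>A + B * (pmf PN t * t powr (2 + e))\<close>. The
  first term is small by comparison of the two densities, the second because
  \<open>pmf D t * t powr (2 + e)\<close> tends to 0.\<close>

lemma low_regularly_varying:
  assumes L: "slowly_varying L" and \<gamma>: "\<gamma> \<le> 2" and e: "0 < e"
    and p: "\<And>t. 1 \<le> t \<Longrightarrow> pmf PN t = real t powr - \<gamma> * L (real t)"
    and \<delta>: "0 < \<delta>" "\<delta> \<le> 1" and C: "0 < C"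
    and dom: "\<forall>\<^sub>F t in at_top. \<forall>n. real n \<le> \<delta> * real_of_int t \<longrightarrow> pmf (walk D n) t \<le> C * n * pmf D t"
    and f: "(\<lambda>t. pmf D (int t) * real t powr (2 + e)) \<longlonglongrightarrow> 0"
    and small: "(\<lambda>t. pmf D (int t)) \<in> o(\<lambda>t. pmf PN t)"
  shows "low \<delta> \<in> o(\<lambda>t. pmf PN (tau t))"
proof (rule small_tau_of_small)
  have "\<exists>A B. 0 \<le> B \<and> (\<forall>t\<ge>1. (\<Sum>n\<le>t. pmf PN n * real n) \<le> A + B * (pmf PN t * real t powr (2 + e)))"
    by (rule partial_mean_le[OF L \<gamma> e pmf_nonneg pmf_le_1 p]) (assumption, blast)
  then obtain A B where B: "0 \<le> B" and AB: "\<And>t. 1 \<le> t \<Longrightarrow> (\<Sum>n\<le>t. pmf PN n * real n) \<le> A + B * (pmf PN t * real t powr (2 + e))"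
    by blast
  have "(\<lambda>t. pmf PN t * (pmf D (int t) * real t powr (2 + e))) \<in> o(\<lambda>t. pmf PN t * 1)"
    using f by (intro landau_o.small.mult_left) (auto intro: smalloI_tendsto)
  then have s2: "(\<lambda>t. C * B * (pmf PN t * (pmf D (int t) * real t powr (2 + e)))) \<in> o(\<lambda>t. pmf PN t)"
    by (cases "C * B = 0") simp_all
  have s1: "(\<lambda>t. C * A * pmf D (int t)) \<in> o(\<lambda>t. pmf PN t)"
    using small by simp
  have "low \<delta> \<in> O(\<lambda>t. C * A * pmf D (int t) + C * B * (pmf PN t * (pmf D (int t) * real t powr (2 + e))))"
  proof (rule bigoI[of _ 1])
    have "\<forall>\<^sub>F t in sequentially. \<forall>n. real n \<le> \<delta> * real t \<longrightarrow> pmf (walk D n) (int t) \<le> C * n * pmf D (int t)"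
      using eventually_compose_filterlim[OF dom filterlim_int_sequentially] by simp
    then show "\<forall>\<^sub>F t in sequentially. norm (low \<delta> t) \<le> 1 * norm (C * A * pmf D (int t) + C * B * (pmf PN t * (pmf D (int t) * real t powr (2 + e))))"
      using eventually_ge_at_top[of 1]
    proof eventually_elim
      case (elim t)
      have "low \<delta> t \<le> (\<Sum>n\<in>{n. real n \<le> \<delta> * real t}. pmf PN n * (C * n * pmf D (int t)))"
        unfolding low_def using elim(1) by (intro sum_mono mult_left_mono) auto
      also have "\<dots> = C * pmf D (int t) * (\<Sum>n\<in>{n. real n \<le> \<delta> * real t}. pmf PN n * real n)"
        by (simp add: sum_distrib_left mult_ac)
      also have "\<dots> \<le> C * pmf D (int t) * (\<Sum>n\<le>t. pmf PN n * real n)"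
      proof (intro mult_left_mono sum_mono2)
        have "\<delta> * real t \<le> 1 * real t" using \<delta> by (intro mult_right_mono) auto
        then show "{n. real n \<le> \<delta> * real t} \<subseteq> {..t}" by auto
      qed (use C in auto)
      also have "\<dots> \<le> C * pmf D (int t) * (A + B * (pmf PN t * real t powr (2 + e)))"
        using C by (intro mult_left_mono AB elim) auto
      also have "\<dots> = C * A * pmf D (int t) + C * B * (pmf PN t * (pmf D (int t) * real t powr (2 + e)))"
        by (simp add: algebra_simps)
      finally show ?case using low_nonneg[of \<delta> t] by simp
    qed
  qed
  also have "(\<lambda>t. C * A * pmf D (int t) + C * B * (pmf PN t * (pmf D (int t) * real t powr (2 + e)))) \<in> o(\<lambda>t. pmf PN t)"
    using s1 s2 by (rule sum_in_smallo)
  finally show "low \<delta> \<in> o(\<lambda>t. pmf PN t)" .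
qed

lemma small_cutoff:
  obtains \<delta> C where "0 < \<delta>" "\<delta> * \<mu> \<le> 1 / 4" "\<delta> \<le> 1" "0 < C"
    "\<forall>\<^sub>F t in at_top. \<forall>n. real n \<le> \<delta> * real_of_int t \<longrightarrow> pmf (walk D n) t \<le> C * n * pmf D t"
proof -
  obtain \<delta>0 C where \<delta>0: "0 < \<delta>0" "0 < C"
    "\<forall>\<^sub>F t in at_top. \<forall>n. real n \<le> \<delta>0 * real_of_int t \<longrightarrow> pmf (walk D n) t \<le> C * n * pmf D t"
    by (rule pmf_walk_le)
  define \<delta> where "\<delta> = min \<delta>0 (min 1 (1 / (4 * \<mu>)))"
  have \<delta>: "0 < \<delta>" "\<delta> \<le> 1" "\<delta> \<le> \<delta>0" "\<delta> \<le> 1 / (4 * \<mu>)"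
    using \<delta>0 mu_pos by (auto simp: \<delta>_def)
  have "\<delta> * \<mu> \<le> 1 / 4" using \<delta>(4) mu_pos by (simp add: field_simps)
  moreover have "\<forall>\<^sub>F t in at_top. \<forall>n. real n \<le> \<delta> * real_of_int t \<longrightarrow> pmf (walk D n) t \<le> C * n * pmf D t"
    using \<delta>0(3) eventually_ge_at_top[of 0]
  proof eventually_elim
    case (elim t)
    have "\<delta> * real_of_int t \<le> \<delta>0 * real_of_int t" using \<delta> elim by (intro mult_right_mono) auto
    then show ?case using elim(1) by (meson order.trans)
  qed
  ultimately show ?thesis using \<delta> \<delta>0 that by blast
qed

text \<open>The errors are collected into a single additive one, relative to the sum of the two
  densities; this permits the far part to be negligible against either of them.\<close>

lemma two_term:
  assumes int: "integrable (measure_pmf PN) real"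
    and far: "far \<in> o(\<lambda>t. pmf D (int t)) \<or> far \<in> o(\<lambda>t. pmf PN (tau t))"
  shows "(\<lambda>t. pmf (bind_pmf PN (walk D)) (int t) - (\<integral>n. real n \<partial>measure_pmf PN) * pmf D (int t) - pmf PN (tau t) / \<mu>)
    \<in> o(\<lambda>t. pmf D (int t) + pmf PN (tau t))"
proof -
  obtain \<delta> C where \<delta>: "0 < \<delta>" "\<delta> * \<mu> \<le> 1 / 4"
    and dom: "\<forall>\<^sub>F t in at_top. \<forall>n. real n \<le> \<delta> * real_of_int t \<longrightarrow> pmf (walk D n) t \<le> C * n * pmf D t"
    by (rule small_cutoff)
  have big: "(\<lambda>t. pmf D (int t)) \<in> O(\<lambda>t. pmf D (int t) + pmf PN (tau t))"
    "(\<lambda>t. pmf PN (tau t)) \<in> O(\<lambda>t. pmf D (int t) + pmf PN (tau t))"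
    by (auto intro!: bigoI[of _ 1])
  have "far \<in> o(\<lambda>t. pmf D (int t) + pmf PN (tau t))"
    using far big landau_o.small_big_trans by blast
  moreover have "(\<lambda>t. low \<delta> t - (\<integral>n. real n \<partial>measure_pmf PN) * pmf D (int t)) \<in> o(\<lambda>t. pmf D (int t) + pmf PN (tau t))"
    using low_moment[OF int \<delta>(1) dom] big landau_o.small_big_trans by blast
  moreover have "(\<lambda>t. (\<Sum>n\<in>middle \<delta> t. pmf PN n * pmf (walk D n) (int t)) - pmf PN (tau t) / \<mu>) \<in> o(\<lambda>t. pmf D (int t) + pmf PN (tau t))"
    using middle_sum[OF \<delta>] big landau_o.small_big_trans by blast
  ultimately have "(\<lambda>t. (low \<delta> t - (\<integral>n. real n \<partial>measure_pmf PN) * pmf D (int t)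
      + ((\<Sum>n\<in>middle \<delta> t. pmf PN n * pmf (walk D n) (int t)) - pmf PN (tau t) / \<mu>)) + far t) \<in> o(\<lambda>t. pmf D (int t) + pmf PN (tau t))"
    by (intro sum_in_smallo(1))
  then show ?thesis
    unfolding total_split[OF \<delta>(2,1)] by (simp add: algebra_simps)
qed

lemma one_term_of_integrable:
  assumes int: "integrable (measure_pmf PN) real"
    and far: "far \<in> o(\<lambda>t. pmf D (int t)) \<or> far \<in> o(\<lambda>t. pmf PN (tau t))"
    and small: "(\<lambda>t. pmf D (int t)) \<in> o(\<lambda>t. pmf PN t)"
  shows "(\<lambda>t. pmf (bind_pmf PN (walk D)) (int t) - pmf PN (tau t) / \<mu>) \<in> o(\<lambda>t. pmf PN (tau t))"
proof -
  define EN where "EN = (\<integral>n. real n \<partial>measure_pmf PN)"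
  note s = small_tau_of_small[OF small]
  have "(\<lambda>t. pmf D (int t) + pmf PN (tau t)) \<in> O(\<lambda>t. pmf PN (tau t))"
    by (rule sum_in_bigo(1)[OF landau_o.small_imp_big[OF s]]) simp
  from landau_o.small_big_trans[OF two_term[OF int far] this]
  have 1: "(\<lambda>t. pmf (bind_pmf PN (walk D)) (int t) - EN * pmf D (int t) - pmf PN (tau t) / \<mu>) \<in> o(\<lambda>t. pmf PN (tau t))"
    by (simp add: EN_def)
  have 2: "(\<lambda>t. EN * pmf D (int t)) \<in> o(\<lambda>t. pmf PN (tau t))" using s by simp
  from sum_in_smallo(1)[OF 1 2] show ?thesis by (simp add: algebra_simps)
qed

text \<open>Covers the indices for which N may have infinite mean: the truncated mean handles few
  summands, and almost monotonicity of the weights handles many.\<close>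

lemma one_term_of_regularly_varying:
  assumes L: "slowly_varying L" and \<gamma>: "0 < \<gamma>" "\<gamma> \<le> 2" and e: "0 < e"
    and p: "\<And>t. 1 \<le> t \<Longrightarrow> pmf PN t = real t powr - \<gamma> * L (real t)"
    and f: "(\<lambda>t. pmf D (int t) * real t powr (2 + e)) \<longlonglongrightarrow> 0"
    and small: "(\<lambda>t. pmf D (int t)) \<in> o(\<lambda>t. pmf PN t)"
  shows "(\<lambda>t. pmf (bind_pmf PN (walk D)) (int t) - pmf PN (tau t) / \<mu>) \<in> o(\<lambda>t. pmf PN (tau t))"
proof -
  obtain \<delta> C where \<delta>: "0 < \<delta>" "\<delta> * \<mu> \<le> 1 / 4" "\<delta> \<le> 1" "0 < C"
    and dom: "\<forall>\<^sub>F t in at_top. \<forall>n. real n \<le> \<delta> * real_of_int t \<longrightarrow> pmf (walk D n) t \<le> C * n * pmf D t"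
    by (rule small_cutoff)
  obtain A where A: "\<And>m n. A \<le> m \<Longrightarrow> m \<le> n \<Longrightarrow> pmf PN n \<le> exp \<gamma> * pmf PN m"
    by (rule regularly_varying_almost_decreasing[OF L \<gamma>(1) p]) blast+
  have "far \<in> o(\<lambda>t. pmf PN (tau t))" by (rule far_decreasing[OF A]) auto
  moreover have "low \<delta> \<in> o(\<lambda>t. pmf PN (tau t))"
    by (rule low_regularly_varying[OF L \<gamma>(2) e p \<delta>(1,3,4) dom f small])
  ultimately have "(\<lambda>t. (low \<delta> t + ((\<Sum>n\<in>middle \<delta> t. pmf PN n * pmf (walk D n) (int t)) - pmf PN (tau t) / \<mu>)) + far t) \<in> o(\<lambda>t. pmf PN (tau t))"
    using middle_sum[OF \<delta>(1,2)] by (intro sum_in_smallo(1))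
  then show ?thesis
    unfolding total_split[OF \<delta>(2,1)] by (simp add: algebra_simps)
qed

end

section \<open>Random sums\<close>

lemma (in prob_space) pmf_of_random_variable:
  fixes Y :: "'a \<Rightarrow> 'b :: countable"
  assumes "random_variable (count_space UNIV) Y"
  obtains P where "measure_pmf P = distr M (count_space UNIV) Y"
proof -
  interpret Y: prob_space "distr M (count_space UNIV) Y" by (rule prob_space_distr[OF assms])
  have "AE x in distr M (count_space UNIV) Y. Y.prob {x} \<noteq> 0"
    by (subst Y.AE_support_countable) (auto intro!: exI[of _ UNIV])
  then have "measure_pmf (Abs_pmf (distr M (count_space UNIV) Y)) = distr M (count_space UNIV) Y"
    by (intro Abs_pmf_inverse) (auto simp: Y.prob_space_axioms)
  then show ?thesis using that by blast
qed

text \<open>Total probability for an event that depends on the value of a discrete variable: it is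
  the disjoint union, over the values \<open>y\<close>, of \<open>E y\<close> on
  \<open>Y = y\<close>.\<close>

lemma (in prob_space) prob_mixture:
  fixes Y :: "'a \<Rightarrow> 'b :: countable" and h :: "'b \<Rightarrow> real"
  assumes Y [measurable]: "random_variable (count_space UNIV) Y" and E: "\<And>y. E y \<in> events"
    and h: "\<And>y. 0 \<le> h y"
    and eq: "\<And>y. prob ({\<omega> \<in> space M. Y \<omega> = y} \<inter> E y) = pmf V y * h y"
  shows "prob {\<omega> \<in> space M. \<omega> \<in> E (Y \<omega>)} = (\<integral>y. h y \<partial>measure_pmf V)"
proof -
  define F where "F y = {\<omega> \<in> space M. Y \<omega> = y} \<inter> E y" for y
  have F: "F y \<in> events" for y
    unfolding F_def by (intro sets.Int E) measurable
  have "{\<omega> \<in> space M. \<omega> \<in> E (Y \<omega>)} = (\<Union>y\<in>UNIV. F y)" by (auto simp: F_def)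
  then have "ennreal (prob {\<omega> \<in> space M. \<omega> \<in> E (Y \<omega>)}) = emeasure M (\<Union>y\<in>UNIV. F y)"
    by (simp add: emeasure_eq_measure)
  also have "\<dots> = (\<integral>\<^sup>+y. emeasure M (F y) \<partial>count_space UNIV)"
    by (rule emeasure_UN_countable) (auto simp: F disjoint_family_on_def, auto simp: F_def)
  also have "\<dots> = (\<integral>\<^sup>+y. ennreal (h y) \<partial>measure_pmf V)"
    by (subst nn_integral_measure_pmf) (simp add: emeasure_eq_measure F_def eq ennreal_mult h)
  finally have "ennreal (prob {\<omega> \<in> space M. \<omega> \<in> E (Y \<omega>)}) = (\<integral>\<^sup>+y. ennreal (h y) \<partial>measure_pmf V)" .
  then have "enn2real (\<integral>\<^sup>+y. ennreal (h y) \<partial>measure_pmf V) = prob {\<omega> \<in> space M. \<omega> \<in> E (Y \<omega>)}"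
    by (metis enn2real_ennreal measure_nonneg)
  moreover have "(\<integral>y. h y \<partial>measure_pmf V) = enn2real (\<integral>\<^sup>+y. ennreal (h y) \<partial>measure_pmf V)"
    using h by (intro integral_eq_nn_integral) auto
  ultimately show ?thesis by simp
qed

lemma (in prob_space) prob_eq_pmf:
  assumes "measure_pmf P = distr M (count_space UNIV) Y" "random_variable (count_space UNIV) Y"
  shows "prob {\<omega> \<in> space M. Q (Y \<omega>)} = measure_pmf.prob P {y. Q y}"
    "prob {\<omega> \<in> space M. Y \<omega> = y} = pmf P y"
proof -
  show *: "prob {\<omega> \<in> space M. Q (Y \<omega>)} = measure_pmf.prob P {y. Q y}" for Q
    unfolding assms(1) by (subst measure_distr[OF assms(2)]) (auto intro!: arg_cong[where f=prob])
  show "prob {\<omega> \<in> space M. Y \<omega> = y} = pmf P y"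
    using *[of "\<lambda>z. z = y"] by (simp add: measure_pmf_single)
qed

context random_sum
begin

lemma measurable_X: "1 \<le> i \<Longrightarrow> random_variable (count_space UNIV) (X i)"
  using indep_X by (simp add: indep_vars_def)

lemma measurable_N: "random_variable (count_space UNIV) N"
proof (rule measurableI)
  fix A :: "nat set"
  show "N -` A \<inter> space M \<in> events" using indep_setD_ev1[OF indep_N_X] by blast
qed simp

text \<open>The last summand \<open>X (Suc n)\<close> plays the role of the first step of
  \<open>walk\<close>; the independent sum of the others has the law of \<open>walk D n\<close> by
  induction.\<close>

lemma prob_sum_X:
  assumes D: "measure_pmf D = distr M (count_space UNIV) (X 1)"
  shows "prob {\<omega> \<in> space M. (\<Sum>i=1..n. X i \<omega>) = t} = pmf (walk D n) t"
proof (induction n arbitrary: t)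
  case 0
  show ?case by (simp add: prob_space indicator_def)
next
  case (Suc n)
  define Y where "Y i \<omega> = real_of_int (X i \<omega>)" for i \<omega>
  have S: "{\<omega> \<in> space M. (\<Sum>i=1..n. X i \<omega>) = s} \<in> events" for n s
  proof -
    have [measurable]: "(\<lambda>\<omega>. \<Sum>i=1..n. real_of_int (X i \<omega>)) \<in> borel_measurable M"
      by (intro borel_measurable_sum measurable_compose[OF measurable_X]) auto
    have "{\<omega> \<in> space M. (\<Sum>i=1..n. real_of_int (X i \<omega>)) = real_of_int s} \<in> events" by measurable
    then show ?thesis unfolding of_int_sum[symmetric] of_int_eq_iff .
  qed
  have "indep_vars (\<lambda>_. borel) Y {1..}"
    unfolding Y_def by (rule indep_vars_compose2[OF indep_X]) simp
  then have "indep_vars (\<lambda>_. borel) Y (insert (Suc n) {1..n})"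
    by (rule indep_vars_subset) auto
  then have ind: "indep_var borel (Y (Suc n)) borel (\<lambda>\<omega>. \<Sum>i=1..n. Y i \<omega>)"
    by (rule indep_vars_sum[rotated 2]) auto
  define Z where "Z \<omega> = (\<Sum>i=1..n. X i \<omega>)" for \<omega>
  have "(\<lambda>\<omega>. \<Sum>i=1..n. Y i \<omega>) = (\<lambda>\<omega>. real_of_int (Z \<omega>))" by (simp add: Y_def Z_def)
  note ind = ind[unfolded this]
  have "prob ({\<omega> \<in> space M. X (Suc n) \<omega> = y} \<inter> {\<omega> \<in> space M. Z \<omega> = t - y}) = pmf D y * pmf (walk D n) (t - y)" for y
  proof -
    define z where "z = t - y"
    have "prob ((\<lambda>\<omega>. (Y (Suc n) \<omega>, real_of_int (Z \<omega>))) -` ({real_of_int y} \<times> {real_of_int z}) \<inter> space M)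
      = prob (Y (Suc n) -` {real_of_int y} \<inter> space M) * prob ((\<lambda>\<omega>. real_of_int (Z \<omega>)) -` {real_of_int z} \<inter> space M)"
      by (rule indep_varD[OF ind]) auto
    also have "(\<lambda>\<omega>. (Y (Suc n) \<omega>, real_of_int (Z \<omega>))) -` ({real_of_int y} \<times> {real_of_int z}) \<inter> space M
      = {\<omega> \<in> space M. X (Suc n) \<omega> = y} \<inter> {\<omega> \<in> space M. Z \<omega> = z}"
      by (auto simp: Y_def)
    also have "Y (Suc n) -` {real_of_int y} \<inter> space M = {\<omega> \<in> space M. X (Suc n) \<omega> = y}"
      by (auto simp: Y_def)
    also have "(\<lambda>\<omega>. real_of_int (Z \<omega>)) -` {real_of_int z} \<inter> space M = {\<omega> \<in> space M. Z \<omega> = z}"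
      by auto
    also have "prob {\<omega> \<in> space M. Z \<omega> = z} = pmf (walk D n) z"
      unfolding Z_def by (rule Suc.IH)
    also have "prob {\<omega> \<in> space M. X (Suc n) \<omega> = y} = pmf D y"
      using ident_X[of "Suc n"] D by (intro prob_eq_pmf(2) measurable_X) auto
    finally show ?thesis by (simp add: z_def)
  qed
  from prob_mixture[OF measurable_X[of "Suc n"] _ pmf_nonneg this]
  have "prob {\<omega> \<in> space M. \<omega> \<in> {\<omega>' \<in> space M. Z \<omega>' = t - X (Suc n) \<omega>}} = pmf (walk D (Suc n)) t"
    unfolding pmf_walk_Suc Z_def using S by simp
  also have "{\<omega> \<in> space M. \<omega> \<in> {\<omega>' \<in> space M. Z \<omega>' = t - X (Suc n) \<omega>}} = {\<omega> \<in> space M. (\<Sum>i=1..Suc n. X i \<omega>) = t}"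
    by (auto simp: Z_def)
  finally show ?case .
qed

text \<open>Each event that the first \<open>n\<close> summands add up to \<open>t\<close> lies in
  the sigma-algebra generated by all \<open>X i\<close>, from which N is independent. Mixing over
  the value of N then gives the bind.\<close>

lemma prob_random_partial_sum:
  assumes D: "measure_pmf D = distr M (count_space UNIV) (X 1)"
    and P: "measure_pmf P = distr M (count_space UNIV) N"
  shows "prob {\<omega> \<in> space M. random_partial_sum X N \<omega> = t} = pmf (bind_pmf P (walk D)) t"
proof -
  define G where "G = (\<Union>i\<in>{1..}. {X i -` A \<inter> space M | A. True})"
  have G: "G \<subseteq> Pow (space M)" by (auto simp: G_def)
  have sets: "sets (sigma (space M) G) = sigma_sets (space M) G" and sp: "space (sigma (space M) G) = space M"
    using G by simp_all
  have X_G: "(\<lambda>\<omega>. real_of_int (X i \<omega>)) \<in> borel_measurable (sigma (space M) G)" if "1 \<le> i" for i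
  proof (rule measurable_compose[where f="X i" and N="count_space UNIV" and g=real_of_int])
    have "X i -` A \<inter> space M \<in> sigma_sets (space M) G" for A
      by (rule sigma_sets.Basic) (use that in \<open>auto simp: G_def\<close>)
    then show "X i \<in> measurable (sigma (space M) G) (count_space UNIV)"
      unfolding measurable_def sets sp by simp
  qed simp
  have E: "{\<omega> \<in> space M. (\<Sum>i=1..n. X i \<omega>) = t} \<in> sigma_sets (space M) G" for n
  proof -
    have [measurable]: "(\<lambda>\<omega>. \<Sum>i=1..n. real_of_int (X i \<omega>)) \<in> borel_measurable (sigma (space M) G)"
      by (rule borel_measurable_sum) (simp add: X_G)
    have "{\<omega> \<in> space (sigma (space M) G). (\<Sum>i=1..n. real_of_int (X i \<omega>)) = real_of_int t} \<in> sets (sigma (space M) G)"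
      by measurable
    then show ?thesis unfolding sets sp of_int_sum[symmetric] of_int_eq_iff .
  qed
  note ind = indep_N_X[folded G_def]
  have "prob ({\<omega> \<in> space M. N \<omega> = n} \<inter> {\<omega> \<in> space M. (\<Sum>i=1..n. X i \<omega>) = t}) = pmf P n * pmf (walk D n) t" for n
  proof -
    have "{\<omega> \<in> space M. N \<omega> = n} = N -` {n} \<inter> space M" by auto
    then have "{\<omega> \<in> space M. N \<omega> = n} \<in> {N -` A \<inter> space M | A. True}" by blast
    from indep_setD[OF ind this E] show ?thesis
      by (simp only: prob_eq_pmf(2)[OF P measurable_N] prob_sum_X[OF D])
  qed
  then have "prob {\<omega> \<in> space M. \<omega> \<in> {\<omega>' \<in> space M. (\<Sum>i=1..N \<omega>. X i \<omega>') = t}} = pmf (bind_pmf P (walk D)) t"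
    unfolding pmf_bind
    by (intro prob_mixture[where Y=N and E="\<lambda>n. {\<omega>' \<in> space M. (\<Sum>i=1..n. X i \<omega>') = t}"]
        measurable_N subsetD[OF indep_setD_ev2[OF ind] E] pmf_nonneg)
  also have "{\<omega> \<in> space M. \<omega> \<in> {\<omega>' \<in> space M. (\<Sum>i=1..N \<omega>. X i \<omega>') = t}} = {\<omega> \<in> space M. random_partial_sum X N \<omega> = t}"
    by (auto simp: random_partial_sum_def)
  finally show ?thesis .
qed

end

lemma less_exponent_between:
  assumes "1 < (\<beta>::real)" "1 / \<beta> < \<kappa>"
  obtains \<theta> where "1 / \<beta> < \<theta>" "\<theta> < \<kappa>" "\<theta> < 1"
proof -
  have "1 / \<beta> < min \<kappa> 1" using assms by simp
  then obtain \<theta> where "1 / \<beta> < \<theta>" "\<theta> < min \<kappa> 1" using dense by blast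
  then show ?thesis using that by simp
qed

theorem theorem6:
  fixes M :: "'a measure" and X :: "nat \<Rightarrow> 'a \<Rightarrow> int" and N :: "'a \<Rightarrow> nat"
    and \<alpha> \<mu> :: real
  assumes "random_sum M X N"
    and "\<alpha> > 2"
    and "integrable M (\<lambda>\<omega>. real_of_int (X 1 \<omega>))"
    and "\<mu> = (LINT \<omega>|M. real_of_int (X 1 \<omega>))"
    and "\<mu> > 0"
    and "cond_R1 M N"
    and "cond_R2 M N \<alpha>"
  shows
    "(2 < \<alpha> \<and> \<alpha> < 3 \<and>
      (\<exists>a>0. (\<lambda>t::nat. \<P>(\<omega> in M. X 1 \<omega> = int t)) \<sim>[at_top] (\<lambda>t. a * real t powr (-\<alpha>))) \<and>
      (\<exists>l::real. (\<lambda>t::nat. \<P>(\<omega> in M. X 1 \<omega> < - int t) / \<P>(\<omega> in M. X 1 \<omega> > int t)) \<longlonglongrightarrow> l)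
      \<longrightarrow>
      (integrable M (\<lambda>\<omega>. real (N \<omega>)) \<longrightarrow> two_term_asymp M X N \<mu>) \<and>
      ((\<lambda>t::nat. \<P>(\<omega> in M. X 1 \<omega> = int t)) \<in> o(\<lambda>t. \<P>(\<omega> in M. N \<omega> = t)) \<longrightarrow>
        integrable M (\<lambda>\<omega>. real (N \<omega>)) \<or> cond_P M N \<longrightarrow> one_term_asymp M X N \<mu>))
     \<and>
     (\<alpha> > 3 \<and>
      (\<exists>L. slowly_varying L \<and>
        (\<forall>t::nat. t \<ge> 1 \<longrightarrow> \<P>(\<omega> in M. X 1 \<omega> = int t) = real t powr (-\<alpha>) * L (real t))) \<and>
      left_tail_cond M (X 1) \<and>
      (\<lambda>t::nat. \<Sum>\<^sub>\<infinity>n\<in>{t..}. real n powr (-3/2) * \<P>(\<omega> in M. N \<omega> = n))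
        \<in> o(\<lambda>t. \<P>(\<omega> in M. N \<omega> = t))
      \<longrightarrow>
      (integrable M (\<lambda>\<omega>. real (N \<omega>)) \<longrightarrow> two_term_asymp M X N \<mu>) \<and>
      ((\<lambda>t::nat. \<P>(\<omega> in M. X 1 \<omega> = int t)) \<in> o(\<lambda>t. \<P>(\<omega> in M. N \<omega> = t)) \<longrightarrow>
        integrable M (\<lambda>\<omega>. real (N \<omega>)) \<or> cond_P M N \<longrightarrow> one_term_asymp M X N \<mu>))"
proof -
  interpret random_sum M X N by fact
  obtain D where D: "measure_pmf D = distr M (count_space UNIV) (X 1)"
    using pmf_of_random_variable[OF measurable_X[of 1]] by auto
  obtain P where P: "measure_pmf P = distr M (count_space UNIV) N"
    using pmf_of_random_variable[OF measurable_N] by auto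
  have X1 [measurable]: "X 1 \<in> measurable M (count_space UNIV)" by (rule measurable_X) simp
  have N1 [measurable]: "N \<in> measurable M (count_space UNIV)" by (rule measurable_N)
  note probX = prob_eq_pmf[OF D X1] and probN = prob_eq_pmf[OF P N1]
  have mean: "integrable (measure_pmf D) real_of_int" "(\<integral>y. real_of_int y \<partial>measure_pmf D) = \<mu>"
    using assms(3,4) integrable_distr_eq[OF X1, of real_of_int] integral_distr[OF X1, of real_of_int]
    unfolding D by (simp_all del: One_nat_def)
  have intN: "integrable (measure_pmf P) real \<longleftrightarrow> integrable M (\<lambda>\<omega>. real (N \<omega>))"
    unfolding P by (simp add: integrable_distr_eq)
  have EN: "(LINT \<omega>|M. real (N \<omega>)) = (\<integral>n. real n \<partial>measure_pmf P)"
    unfolding P by (simp add: integral_distr)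
  obtain c1 c2 c3 where c: "1 < c1" "0 < c2" "0 < c3" and R1: "\<And>t1 t2. 1 \<le> t1 \<Longrightarrow> 1 \<le> t2 \<Longrightarrow> 1 \<le> real t2 / real t1 \<Longrightarrow> real t2 / real t1 \<le> c1 \<Longrightarrow>
       c2 \<le> pmf P t2 / pmf P t1 \<and> pmf P t2 / pmf P t1 \<le> c3"
    using assms(6) unfolding cond_R1_def probN(2) by blast
  have p_pos: "0 < pmf P n" if "1 \<le> n" for n
    by (rule locally_comparable_of_ratio(1)[where p="pmf P", OF pmf_nonneg c]) (rule R1, assumption+, rule that)
  have comparable: "locally_comparable (pmf P)"
    by (rule locally_comparable_of_ratio(2)[where p="pmf P", OF pmf_nonneg c]) (rule R1)
  obtain \<kappa> where \<kappa>: "\<kappa> > max (1 / (\<alpha> - 1)) (1 / 2)"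
    and R2: "(\<lambda>t::nat. SUP s\<in>{s::nat. s \<ge> 1 \<and> \<bar>real t - real s\<bar> \<le> real t powr \<kappa>}. pmf P t / pmf P s) \<longlonglongrightarrow> 1"
    using assms(7) unfolding cond_R2_def probN(2) by blast
  \<comment> \<open>\<theta> is chosen between \<open>1 / \<beta>\<close> and the smaller of
    \<kappa> and 1. Being strictly below \<kappa>, it inherits local constancy from (R2).\<close>
  have compound: "\<exists>\<theta>. compound_walk D \<mu> \<beta> K (\<alpha> + 1) ((\<alpha> - 2) / 2) P \<theta>"
    if walk: "drift_walk D \<mu> \<beta> K" and beta: "1 / \<beta> < \<kappa>" and L: "slowly_varying L"
     and f:       "\<And>t. 1 \<le> t \<Longrightarrow> pmf D (int t) = real t powr - \<alpha> * L (real t)" for \<beta> K L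
  proof -
    interpret drift_walk D \<mu> \<beta> K by fact
    obtain \<theta> where \<theta>: "1 / \<beta> < \<theta>" "\<theta> < \<kappa>" "\<theta> < 1"
      by (rule less_exponent_between[OF beta_gt_1 beta])
    have "0 < 1 / \<beta>" using beta_gt_1 by simp
    also note \<theta>(1)
    finally have "locally_constant \<theta> (pmf P)"
      using \<theta> by (intro locally_constant_of_ratio[where p="pmf P", OF p_pos _ _ _ R2]) auto
    then have "compound_walk_axioms \<beta> P \<theta>"
      using comparable p_pos \<theta> by (intro compound_walk_axioms.intro) auto
    with walk big_jump_of_slowly_varying[OF assms(2) L f] show ?thesis
      by (intro exI compound_walk.intro)
  qed
  have two: "two_term_asymp M X N \<mu>"
    if C: "compound_walk D \<mu> \<beta> K c0 \<epsilon> P \<theta>" and int: "integrable M (\<lambda>\<omega>. real (N \<omega>))"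
      and far: "compound_walk.far D \<mu> P \<in> o(\<lambda>t. pmf D (int t)) \<or> compound_walk.far D \<mu> P \<in> o(\<lambda>t. pmf P (compound_walk.tau \<mu> t))"
    for \<beta> K c0 \<epsilon> \<theta>
  proof -
    interpret compound_walk D \<mu> \<beta> K c0 \<epsilon> P \<theta> by fact
    define EN where "EN = (\<integral>n. real n \<partial>measure_pmf P)"
    \<comment> \<open>The sum of both main terms. Since each term is at most a multiple of
      \<open>g\<close>, the remainder is \<open>r = o(g)\<close>, and the single relative error
      \<open>r / g\<close> can serve in both factors.\<close>
    define g where "g t = EN * pmf D (int t) + pmf P (tau t) / \<mu>" for t
    define r where "r t = pmf (bind_pmf P (walk D)) (int t) - EN * pmf D (int t) - pmf P (tau t) / \<mu>" for t
    have intP: "integrable (measure_pmf P) real" using int intN by simp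
    \<comment> \<open>N takes the value 1 with positive probability, so \<open>pmf D (int t)\<close>
      is bounded by a multiple of \<open>g\<close>.\<close>
    have "0 < EN"
      using sum_pmf_le_integral[of "{1}" P real] intP p_pos[of 1] by (simp add: EN_def)
    then have g_pos: "0 < g t" if "1 \<le> tau t" for t
      unfolding g_def using p_pos[OF that] mu_pos by (intro add_nonneg_pos) auto
    have g0: "0 \<le> g t" for t using \<open>0 < EN\<close> mu_pos by (simp add: g_def)
    have "pmf D (int t) \<le> 1 / EN * g t" for t
      using \<open>0 < EN\<close> mu_pos by (simp add: g_def field_simps)
    then have "(\<lambda>t. pmf D (int t)) \<in> O(g)" using g0 by (intro bigoI[of _ "1 / EN"]) simp
    moreover have "pmf P (tau t) \<le> \<mu> * g t" for t
      using \<open>0 < EN\<close> mu_pos by (simp add: g_def field_simps)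
    then have "(\<lambda>t. pmf P (tau t)) \<in> O(g)" using g0 by (intro bigoI[of _ \<mu>]) simp
    ultimately have "(\<lambda>t. pmf D (int t) + pmf P (tau t)) \<in> O(g)" by (rule sum_in_bigo)
    from landau_o.small_big_trans[OF two_term[OF intP far] this]
    have "r \<in> o(g)" by (simp add: r_def[abs_def] EN_def)
    then have "(\<lambda>t. r t / g t) \<longlonglongrightarrow> 0" by (rule smalloD_tendsto)
    then have small: "(\<lambda>t. r t / g t) \<in> o(\<lambda>_. 1)" by (intro smalloI_tendsto) auto
    show ?thesis
      unfolding two_term_asymp_def prob_random_partial_sum[OF D P] probX(2) probN(2) \<open>(LINT \<omega>|M. real (N \<omega>)) = _\<close>
    proof (intro exI conjI)
      show "(\<lambda>t. r t / g t) \<in> o(\<lambda>_. 1)" "(\<lambda>t. r t / g t) \<in> o(\<lambda>_. 1)" by (rule small)+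
      show "\<forall>\<^sub>F t in at_top. pmf (bind_pmf P (walk D)) (int t) =
          (\<integral>n. real n \<partial>measure_pmf P) * pmf D (int t) * (1 + r t / g t)
          + 1 / \<mu> * pmf P (nat \<lfloor>real t / \<mu>\<rfloor>) * (1 + r t / g t)"
        using eventually_tau[OF eventually_ge_at_top[of 1]]
      proof eventually_elim
        case (elim t)
        have "pmf (bind_pmf P (walk D)) (int t) = g t + r t" by (simp add: g_def r_def)
        also have "\<dots> = g t * (1 + r t / g t)" using g_pos[OF elim] by (simp add: field_simps)
        finally show ?case
          by (simp add: g_def EN_def tau_def distrib_right)
      qed
    qed
  qed
  have one: "one_term_asymp M X N \<mu>"
    if C: "compound_walk D \<mu> \<beta> K c0 \<epsilon> P \<theta>"
      and small: "(\<lambda>t. pmf (bind_pmf P (walk D)) (int t) - pmf P (compound_walk.tau \<mu> t) / \<mu>) \<in> o(\<lambda>t. pmf P (compound_walk.tau \<mu> t))"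
    for \<beta> K c0 \<epsilon> \<theta>
  proof -
    interpret compound_walk D \<mu> \<beta> K c0 \<epsilon> P \<theta> by fact
    show ?thesis
      unfolding one_term_asymp_def prob_random_partial_sum[OF D P] probN(2) asymp_equiv_altdef
      using small mu_pos by (simp add: tau_def[abs_def])
  qed
  have both: "(integrable M (\<lambda>\<omega>. real (N \<omega>)) \<longrightarrow> two_term_asymp M X N \<mu>) \<and>
      ((\<lambda>t::nat. \<P>(\<omega> in M. X 1 \<omega> = int t)) \<in> o(\<lambda>t. \<P>(\<omega> in M. N \<omega> = t)) \<longrightarrow>
        integrable M (\<lambda>\<omega>. real (N \<omega>)) \<or> cond_P M N \<longrightarrow> one_term_asymp M X N \<mu>)"
    if C: "compound_walk D \<mu> \<beta> K c0 \<epsilon> P \<theta>" and L: "slowly_varying L"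
      and f: "\<And>t. 1 \<le> t \<Longrightarrow> pmf D (int t) = real t powr - \<alpha> * L (real t)"
      and far: "integrable (measure_pmf P) real \<Longrightarrow> compound_walk.far D \<mu> P \<in> o(\<lambda>t. pmf D (int t)) \<or> compound_walk.far D \<mu> P \<in> o(\<lambda>t. pmf P (compound_walk.tau \<mu> t))"
    for \<beta> K c0 \<epsilon> \<theta> L
  proof (intro conjI impI)
    interpret compound_walk D \<mu> \<beta> K c0 \<epsilon> P \<theta> by fact
    show "two_term_asymp M X N \<mu>" if "integrable M (\<lambda>\<omega>. real (N \<omega>))"
      using two[OF C that] far intN that by blast
    assume "(\<lambda>t::nat. \<P>(\<omega> in M. X 1 \<omega> = int t)) \<in> o(\<lambda>t. \<P>(\<omega> in M. N \<omega> = t))"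
    then have small: "(\<lambda>t. pmf D (int t)) \<in> o(\<lambda>t. pmf P t)" unfolding probX(2) probN(2) .
    have integrable_case: "one_term_asymp M X N \<mu>" if "integrable (measure_pmf P) real"
      by (rule one[OF C one_term_of_integrable[OF that far[OF that] small]])
    assume "integrable M (\<lambda>\<omega>. real (N \<omega>)) \<or> cond_P M N"
    then show "one_term_asymp M X N \<mu>"
    proof
      assume "integrable M (\<lambda>\<omega>. real (N \<omega>))"
      then show ?thesis using intN integrable_case by blast
    next
      assume "cond_P M N"
      then obtain \<gamma> L2 where \<gamma>: "1 < \<gamma>" and L2: "slowly_varying L2"
        and p: "\<And>t. 1 \<le> t \<Longrightarrow> pmf P t = real t powr - \<gamma> * L2 (real t)"
        unfolding cond_P_def probN(2) by blast
      show ?thesis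
      \<comment> \<open>Beyond index 2, condition (P) itself gives N a mean, and the integrable case
        applies.\<close>
      proof (cases "2 < \<gamma>")
        case True
        then show ?thesis by (intro integrable_case integrable_of_index_gt_2[OF L2 _ p])
      next
        case False
        obtain B where "0 \<le> B" and B: "\<And>t. 1 \<le> t \<Longrightarrow> pmf D (int t) \<le> B * real t powr - (\<alpha> - (\<alpha> - 2) / 4)"
          by (rule regularly_varying_upper[OF L _ _ f pmf_le_1, of "(\<alpha> - 2) / 4"]) (use assms(2) in auto)
        \<comment> \<open>The step density has order \<open>- \<alpha> + (\<alpha> - 2) / 4\<close>
          at most; adding \<open>2 + (\<alpha> - 2) / 2\<close> leaves
          \<open>- (\<alpha> - 2) / 4\<close>.\<close>
        have lim: "(\<lambda>t. pmf D (int t) * real t powr (2 + (\<alpha> - 2) / 2)) \<longlonglongrightarrow> 0"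
        proof (rule tendsto_sandwich)
          show "\<forall>\<^sub>F t in sequentially. 0 \<le> pmf D (int t) * real t powr (2 + (\<alpha> - 2) / 2)" by simp
          show "\<forall>\<^sub>F t in sequentially. pmf D (int t) * real t powr (2 + (\<alpha> - 2) / 2) \<le> B * real t powr - ((\<alpha> - 2) / 4)"
            using eventually_ge_at_top[of 1]
          proof eventually_elim
            case (elim t)
            have "pmf D (int t) * real t powr (2 + (\<alpha> - 2) / 2) \<le> (B * real t powr - (\<alpha> - (\<alpha> - 2) / 4)) * real t powr (2 + (\<alpha> - 2) / 2)"
              by (intro mult_right_mono B elim) auto
            also have "\<dots> = B * real t powr - ((\<alpha> - 2) / 4)"
              unfolding mult.assoc powr_add[symmetric]
              by (intro arg_cong[where f="\<lambda>x. B * real t powr x"]) (simp add: field_simps)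
            finally show ?case .
          qed
          define d where "d = (\<alpha> - 2) / 4"
          have "0 < d" using assms(2) by (simp add: d_def)
          then have "(\<lambda>t::nat. real t powr - d) \<longlonglongrightarrow> 0" by real_asymp
          from tendsto_mult[OF tendsto_const[of B] this]
          show "(\<lambda>t. B * real t powr - ((\<alpha> - 2) / 4)) \<longlonglongrightarrow> 0" by (simp add: d_def)
        qed simp
        show ?thesis
          by (rule one[OF C one_term_of_regularly_varying[OF L2 _ _ _ p lim small]])
             (use \<gamma> False assms(2) in auto)
      qed
    qed
  qed
  show ?thesis
  proof (rule conjI; rule impI)
    assume "2 < \<alpha> \<and> \<alpha> < 3 \<and>
      (\<exists>a>0. (\<lambda>t::nat. \<P>(\<omega> in M. X 1 \<omega> = int t)) \<sim>[at_top] (\<lambda>t. a * real t powr (-\<alpha>))) \<and>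
      (\<exists>l::real. (\<lambda>t::nat. \<P>(\<omega> in M. X 1 \<omega> < - int t) / \<P>(\<omega> in M. X 1 \<omega> > int t)) \<longlonglongrightarrow> l)"
    then obtain a l where \<alpha>: "2 < \<alpha>" "\<alpha> < 3" and a: "0 < a"
      and f: "(\<lambda>t::nat. pmf D (int t)) \<sim>[at_top] (\<lambda>t. a * real t powr (-\<alpha>))"
      and l: "(\<lambda>t::nat. measure_pmf.prob D {y. y < - int t} / measure_pmf.prob D {y. int t < y}) \<longlonglongrightarrow> l"
      unfolding probX(2) probX(1)[where Q="\<lambda>y. y < - int t" for t] probX(1)[where Q="\<lambda>y. int t < y" for t]
      by (elim conjE exE)
    note case_i = stable_case[OF \<alpha> a f l mean assms(5)]
    obtain K where K: "drift_walk D \<mu> (\<alpha> - 1) K" using case_i(1) by blast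
    obtain L where L: "slowly_varying L" "\<And>t. 1 \<le> t \<Longrightarrow> pmf D (int t) = real t powr - \<alpha> * L (real t)"
      using case_i(2) by blast
    \<comment> \<open>Here \<open>1 / \<beta>\<close> is \<open>1 / (\<alpha> - 1)\<close>, the
      first entry of the maximum that bounds \<kappa> from below.\<close>
    obtain \<theta> where C: "compound_walk D \<mu> (\<alpha> - 1) K (\<alpha> + 1) ((\<alpha> - 2) / 2) P \<theta>"
      using compound[OF K _ L] \<kappa> by auto
    interpret compound_walk D \<mu> "\<alpha> - 1" K "\<alpha> + 1" "(\<alpha> - 2) / 2" P \<theta> by fact
    have far_small: "far \<in> o(\<lambda>t. pmf D (int t)) \<or> far \<in> o(\<lambda>t. pmf P (tau t))" if "integrable (measure_pmf P) real"
      using far_moment[OF that, of "a / 2"] a case_i(3) by simp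
    show "(integrable M (\<lambda>\<omega>. real (N \<omega>)) \<longrightarrow> two_term_asymp M X N \<mu>) \<and>
      ((\<lambda>t::nat. \<P>(\<omega> in M. X 1 \<omega> = int t)) \<in> o(\<lambda>t. \<P>(\<omega> in M. N \<omega> = t)) \<longrightarrow>
        integrable M (\<lambda>\<omega>. real (N \<omega>)) \<or> cond_P M N \<longrightarrow> one_term_asymp M X N \<mu>)"
      by (rule both[OF C L far_small])
  next
    assume "\<alpha> > 3 \<and>
      (\<exists>L. slowly_varying L \<and>
        (\<forall>t::nat. t \<ge> 1 \<longrightarrow> \<P>(\<omega> in M. X 1 \<omega> = int t) = real t powr (-\<alpha>) * L (real t))) \<and>
      left_tail_cond M (X 1) \<and>
      (\<lambda>t::nat. \<Sum>\<^sub>\<infinity>n\<in>{t..}. real n powr (-3/2) * \<P>(\<omega> in M. N \<omega> = n))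
        \<in> o(\<lambda>t. \<P>(\<omega> in M. N \<omega> = t))"
    then obtain L where \<alpha>: "3 < \<alpha>" and L: "slowly_varying L" "\<And>t. 1 \<le> t \<Longrightarrow> pmf D (int t) = real t powr - \<alpha> * L (real t)"
      and left: "left_tail_cond M (X 1)"
      and sum: "(\<lambda>t::nat. \<Sum>\<^sub>\<infinity>n\<in>{t..}. real n powr (-3/2) * pmf P n) \<in> o(\<lambda>t. pmf P t)"
      unfolding probX(2) probN(2) by blast
    obtain T where T: "set_integrable M {\<omega> \<in> space M. X 1 \<omega> < - int T} (\<lambda>\<omega>. (real_of_int (X 1 \<omega>))\<^sup>2)"
      using left unfolding left_tail_cond_def eventually_sequentially by blast
    have "integrable M (\<lambda>\<omega>. indicator {y. y < - int T} (X 1 \<omega>) * (real_of_int (X 1 \<omega>))\<^sup>2)"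
      using T unfolding set_integrable_def
      by (rule Bochner_Integration.integrable_cong[THEN iffD1, rotated -1]) (auto simp: indicator_def)
    then have "integrable (measure_pmf D) (\<lambda>y. indicator {y. y < - int T} y * (real_of_int y)\<^sup>2)"
      unfolding D by (subst integrable_distr_eq[OF X1]) simp_all
    then obtain K where K: "drift_walk D \<mu> 2 K"
      using finite_variance_case[OF \<alpha> L _ mean assms(5)] by blast
    \<comment> \<open>With \<beta> = 2 the condition \<open>1 / \<beta> < \<kappa>\<close> is the
      second entry of that maximum.\<close>
    obtain \<theta> where C: "compound_walk D \<mu> 2 K (\<alpha> + 1) ((\<alpha> - 2) / 2) P \<theta>"
      using compound[OF K _ L] \<kappa> by auto
    interpret compound_walk D \<mu> 2 K "\<alpha> + 1" "(\<alpha> - 2) / 2" P \<theta> by fact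
    have far_small: "far \<in> o(\<lambda>t. pmf D (int t)) \<or> far \<in> o(\<lambda>t. pmf P (tau t))"
      using far_sum[OF _ sum] by simp
    show "(integrable M (\<lambda>\<omega>. real (N \<omega>)) \<longrightarrow> two_term_asymp M X N \<mu>) \<and>
      ((\<lambda>t::nat. \<P>(\<omega> in M. X 1 \<omega> = int t)) \<in> o(\<lambda>t. \<P>(\<omega> in M. N \<omega> = t)) \<longrightarrow>
        integrable M (\<lambda>\<omega>. real (N \<omega>)) \<or> cond_P M N \<longrightarrow> one_term_asymp M X N \<mu>)"
      by (rule both[OF C L far_small])
  qed
qed

end
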